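(* There is an algorithm with the following guarantee. Given any $\varepsilon > 0$ and access to independent samples from an unknown distribution $\mathcal{D} \in \mathcal{P}_{\mathrm{conv}}$, the algorithm uses $O(n/\varepsilon^2)$ samples, runs in $\mathrm{poly}(n,1/\varepsilon)$ time, and: (1) if $\mathcal{D} = N(0,I_n)$, then with probability at least $9/10$ it outputs "un-truncated"; (2) if $d_{\mathrm{TV}}(\mathcal{D}, N(0,I_n)) \ge \varepsilon$, then with probability at least $9/10$ it outputs "truncated".
   Context: For a Lebesgue measurable $K \subseteq \mathbb{R}^n$ with Gaussian volume $\mathrm{vol}(K) := \Pr_{x\sim N(0,I_n)}[x\in K] > 0$, $N(0,I_n)|_K$ denotes the standard Gaussian conditioned on $K$, i.e. the distribution with density $\mathrm{vol}(K)^{-1}\varphi_n(x)\mathbf{1}[x\in K]$, where $\varphi_n$ is the standard Gaussian density. $\mathcal{P}_{\mathrm{conv}}$ is the class of all distributions $N(0,I_n)|_K$ where $K\subseteq \mathbb{R}^n$ is any convex set (not necessarily symmetric). $d_{\mathrm{TV}}$ denotes total variation distance. *)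

theory Defs
  imports "HOL-Probability.Probability"
begin

section \<open>Gaussians conditioned on convex sets\<close>

text \<open>
  The dimension \<open>n\<close> is a parameter of the algorithm, so \<open>\<real>\<^sup>n\<close> is represented by the extensional
  functions \<open>{..<n} \<rightarrow>\<^sub>E UNIV\<close>, the carrier of the product measure below.  The completion makes the
  measurable sets the Lebesgue measurable ones; a convex set need not be Borel.
\<close>

definition lebesgue_space :: "nat \<Rightarrow> (nat \<Rightarrow> real) measure" where
  "lebesgue_space n = completion (\<Pi>\<^sub>M i\<in>{..<n}. lborel)"

definition gaussian_density :: "nat \<Rightarrow> (nat \<Rightarrow> real) \<Rightarrow> real" where
  "gaussian_density n x = (\<Prod>i<n. std_normal_density (x i))"

definition gaussian :: "nat \<Rightarrow> (nat \<Rightarrow> real) measure" where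
  "gaussian n = density (lebesgue_space n) (\<lambda>x. ennreal (gaussian_density n x))"

definition gaussian_vol :: "nat \<Rightarrow> (nat \<Rightarrow> real) set \<Rightarrow> real" where
  "gaussian_vol n K = measure (gaussian n) K"

definition truncated_gaussian :: "nat \<Rightarrow> (nat \<Rightarrow> real) set \<Rightarrow> (nat \<Rightarrow> real) measure" where
  "truncated_gaussian n K =
     density (lebesgue_space n)
       (\<lambda>x. ennreal (inverse (gaussian_vol n K) * gaussian_density n x * indicator K x))"

text \<open>
  The library constant \<open>convex\<close> requires a \<open>real_vector\<close> type, which function types are not.
\<close>

definition convex_in :: "nat \<Rightarrow> (nat \<Rightarrow> real) set \<Rightarrow> bool" where
  "convex_in n K \<longleftrightarrow> K \<subseteq> {..<n} \<rightarrow>\<^sub>E UNIV \<and>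
     (\<forall>x\<in>K. \<forall>y\<in>K. \<forall>u\<ge>0. \<forall>v\<ge>0. u + v = 1 \<longrightarrow> (\<lambda>i\<in>{..<n}. u * x i + v * y i) \<in> K)"

definition P_conv :: "nat \<Rightarrow> (nat \<Rightarrow> real) measure set" where
  "P_conv n = {truncated_gaussian n K | K.
     K \<in> sets (lebesgue_space n) \<and> convex_in n K \<and> gaussian_vol n K > 0}"

definition tv_dist :: "'a measure \<Rightarrow> 'a measure \<Rightarrow> real" where
  "tv_dist M N = (SUP A\<in>sets M. \<bar>measure M A - measure N A\<bar>)"

definition iid_samples :: "'a measure \<Rightarrow> (nat \<Rightarrow> 'a) measure" where
  "iid_samples D = (\<Pi>\<^sub>M j\<in>(UNIV :: nat set). D)"


section \<open>Algorithms: programs of a real RAM with a sample oracle\<close>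

text \<open>
  Programs work on real registers, natural-number index registers and an array of reals addressed
  through index registers.  Each instruction and each evaluation of a test costs one time unit.
  There is neither a rounding operation from reals to indices nor multiplication of indices, and
  the only constants are integers, so that unit cost arithmetic is the usual real RAM convention.
  \<open>Draw\<close> requests a fresh sample; \<open>Coord r i\<close> then reads one of its coordinates.
\<close>

datatype verdict = Untruncated | Truncated

datatype instr =
    Draw
  | Coord nat nat
  | RConst nat int
  | RIndex nat nat
  | RAdd nat nat nat
  | RSub nat nat nat
  | RMul nat nat nat
  | RDiv nat nat nat
  | RLoad nat nat
  | RStore nat nat
  | IConst nat nat
  | IAdd nat nat nat
  | ISub nat nat nat
  | Answer verdict

datatype test = RLess nat nat | ILess nat nat

datatype prog =
    Skip
  | Instr instr
  | Seq prog prog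
  | Cond test prog prog
  | While test prog

record state =
  rreg :: "nat \<Rightarrow> real"
  ireg :: "nat \<Rightarrow> nat"
  mem :: "nat \<Rightarrow> real"
  draws :: nat
  answer :: "verdict option"

definition sample_coord :: "nat \<Rightarrow> (nat \<Rightarrow> nat \<Rightarrow> real) \<Rightarrow> nat \<Rightarrow> nat \<Rightarrow> real" where
  "sample_coord n \<omega> k i = (if 0 < k \<and> i < n then \<omega> (k - 1) i else 0)"

text \<open>
  The parameter \<open>n\<close> is the dimension and \<open>\<omega>\<close> the sequence of samples supplied by the oracle.  The
  first argument of an instruction is the destination, except that \<open>RStore i r\<close> stores the real
  register \<open>r\<close> in the array cell addressed by index register \<open>i\<close>.
\<close>

fun exec_instr :: "nat \<Rightarrow> (nat \<Rightarrow> nat \<Rightarrow> real) \<Rightarrow> instr \<Rightarrow> state \<Rightarrow> state" where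
  "exec_instr n \<omega> Draw s = s\<lparr>draws := Suc (draws s)\<rparr>"
| "exec_instr n \<omega> (Coord r i) s = s\<lparr>rreg := (rreg s)(r := sample_coord n \<omega> (draws s) (ireg s i))\<rparr>"
| "exec_instr n \<omega> (RConst r c) s = s\<lparr>rreg := (rreg s)(r := of_int c)\<rparr>"
| "exec_instr n \<omega> (RIndex r i) s = s\<lparr>rreg := (rreg s)(r := real (ireg s i))\<rparr>"
| "exec_instr n \<omega> (RAdd r a b) s = s\<lparr>rreg := (rreg s)(r := rreg s a + rreg s b)\<rparr>"
| "exec_instr n \<omega> (RSub r a b) s = s\<lparr>rreg := (rreg s)(r := rreg s a - rreg s b)\<rparr>"
| "exec_instr n \<omega> (RMul r a b) s = s\<lparr>rreg := (rreg s)(r := rreg s a * rreg s b)\<rparr>"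
| "exec_instr n \<omega> (RDiv r a b) s = s\<lparr>rreg := (rreg s)(r := rreg s a / rreg s b)\<rparr>"
| "exec_instr n \<omega> (RLoad r i) s = s\<lparr>rreg := (rreg s)(r := mem s (ireg s i))\<rparr>"
| "exec_instr n \<omega> (RStore i r) s = s\<lparr>mem := (mem s)(ireg s i := rreg s r)\<rparr>"
| "exec_instr n \<omega> (IConst i c) s = s\<lparr>ireg := (ireg s)(i := c)\<rparr>"
| "exec_instr n \<omega> (IAdd i a b) s = s\<lparr>ireg := (ireg s)(i := ireg s a + ireg s b)\<rparr>"
| "exec_instr n \<omega> (ISub i a b) s = s\<lparr>ireg := (ireg s)(i := ireg s a - ireg s b)\<rparr>"
| "exec_instr n \<omega> (Answer v) s = s\<lparr>answer := Some v\<rparr>"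

fun eval_test :: "test \<Rightarrow> state \<Rightarrow> bool" where
  "eval_test (RLess a b) s \<longleftrightarrow> rreg s a < rreg s b"
| "eval_test (ILess i j) s \<longleftrightarrow> ireg s i < ireg s j"

text \<open>
  \<open>exec n \<omega> p s t s'\<close>: started in state \<open>s\<close>, program \<open>p\<close> halts in state \<open>s'\<close> after \<open>t\<close> time units.
\<close>

inductive exec ::
  "nat \<Rightarrow> (nat \<Rightarrow> nat \<Rightarrow> real) \<Rightarrow> prog \<Rightarrow> state \<Rightarrow> nat \<Rightarrow> state \<Rightarrow> bool" for n \<omega> where
  Skip: "exec n \<omega> Skip s 1 s"
| Instr: "exec n \<omega> (Instr c) s 1 (exec_instr n \<omega> c s)"
| Seq: "exec n \<omega> p s t s' \<Longrightarrow> exec n \<omega> q s' t' s'' \<Longrightarrow> exec n \<omega> (Seq p q) s (t + t') s''"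
| CondTrue: "eval_test b s \<Longrightarrow> exec n \<omega> p s t s' \<Longrightarrow> exec n \<omega> (Cond b p q) s (1 + t) s'"
| CondFalse: "\<not> eval_test b s \<Longrightarrow> exec n \<omega> q s t s' \<Longrightarrow> exec n \<omega> (Cond b p q) s (1 + t) s'"
| WhileTrue: "eval_test b s \<Longrightarrow> exec n \<omega> p s t s' \<Longrightarrow> exec n \<omega> (While b p) s' t' s'' \<Longrightarrow>
    exec n \<omega> (While b p) s (1 + t + t') s''"
| WhileFalse: "\<not> eval_test b s \<Longrightarrow> exec n \<omega> (While b p) s 1 s"

inductive_cases exec_SkipE: "exec n \<omega> Skip s t s'"
inductive_cases exec_InstrE: "exec n \<omega> (Instr c) s t s'"
inductive_cases exec_SeqE: "exec n \<omega> (Seq p q) s t s'"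
inductive_cases exec_CondE: "exec n \<omega> (Cond b p q) s t s'"
inductive_cases exec_WhileE: "exec n \<omega> (While b p) s t s'"

lemma exec_deterministic:
  "exec n \<omega> p s t s' \<Longrightarrow> exec n \<omega> p s u s'' \<Longrightarrow> t = u \<and> s' = s''"
proof (induction arbitrary: u s'' rule: exec.induct)
  case (Skip s)
  from Skip.prems show ?case by (rule exec_SkipE) simp
next
  case (Instr c s)
  from Instr.prems show ?case by (rule exec_InstrE) simp
next
  case (Seq p s t s' q t' s2)
  from Seq.prems show ?case
  proof (rule exec_SeqE)
    fix t1 s1 t2
    assume u: "u = t1 + t2" and p: "exec n \<omega> p s t1 s1" and q: "exec n \<omega> q s1 t2 s''"
    from Seq.IH(1)[OF p] have eq: "t1 = t" "s1 = s'" by auto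
    from Seq.IH(2)[OF q[unfolded eq]] show ?case by (simp add: u eq)
  qed
next
  case (CondTrue b s p t s' q)
  from CondTrue.prems show ?case
  proof (rule exec_CondE)
    fix t1 assume u: "u = Suc t1" and p: "exec n \<omega> p s t1 s''"
    from CondTrue.IH[OF p] show ?case by (simp add: u)
  qed (use CondTrue.hyps(1) in simp)
next
  case (CondFalse b s q t s' p)
  from CondFalse.prems show ?case
  proof (rule exec_CondE)
    fix t1 assume u: "u = Suc t1" and q: "exec n \<omega> q s t1 s''"
    from CondFalse.IH[OF q] show ?case by (simp add: u)
  qed (use CondFalse.hyps(1) in simp)
next
  case (WhileTrue b s p t s' t' s2)
  from WhileTrue.prems show ?case
  proof (rule exec_WhileE)
    fix t1 s1 t2
    assume u: "u = Suc (t1 + t2)" and p: "exec n \<omega> p s t1 s1"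
      and w: "exec n \<omega> (While b p) s1 t2 s''"
    from WhileTrue.IH(1)[OF p] have eq: "t1 = t" "s1 = s'" by auto
    from WhileTrue.IH(2)[OF w[unfolded eq]] show ?case by (simp add: u eq)
  qed (use WhileTrue.hyps(1) in simp)
next
  case (WhileFalse b s p)
  from WhileFalse.prems show ?case
    by (rule exec_WhileE) (use WhileFalse.hyps in simp_all)
qed

definition init_state :: "nat \<Rightarrow> real \<Rightarrow> state" where
  "init_state n \<epsilon> =
     \<lparr>rreg = (\<lambda>_. 0)(0 := \<epsilon>), ireg = (\<lambda>_. 0)(0 := n), mem = (\<lambda>_. 0), draws = 0, answer = None\<rparr>"

text \<open>
  \<open>runs P n \<epsilon> \<omega> v m t\<close>: on input \<open>(n, \<epsilon>)\<close> and sample sequence \<open>\<omega>\<close>, program \<open>P\<close> halts with output \<open>v\<close>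
  having used \<open>m\<close> samples and \<open>t\<close> time units.
\<close>

definition runs ::
  "prog \<Rightarrow> nat \<Rightarrow> real \<Rightarrow> (nat \<Rightarrow> nat \<Rightarrow> real) \<Rightarrow> verdict \<Rightarrow> nat \<Rightarrow> nat \<Rightarrow> bool" where
  "runs P n \<epsilon> \<omega> v m t \<longleftrightarrow>
     (\<exists>s. exec n \<omega> P (init_state n \<epsilon>) t s \<and> answer s = Some v \<and> draws s = m)"

definition outputs :: "prog \<Rightarrow> nat \<Rightarrow> real \<Rightarrow> (nat \<Rightarrow> nat \<Rightarrow> real) \<Rightarrow> verdict \<Rightarrow> bool" where
  "outputs P n \<epsilon> \<omega> v \<longleftrightarrow> (\<exists>m t. runs P n \<epsilon> \<omega> v m t)"

definition output_prob ::
  "prog \<Rightarrow> nat \<Rightarrow> real \<Rightarrow> (nat \<Rightarrow> real) measure \<Rightarrow> verdict \<Rightarrow> real" where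
  "output_prob P n \<epsilon> D v =
     measure (iid_samples D) {\<omega> \<in> space (iid_samples D). outputs P n \<epsilon> \<omega> v}"

end

theory Submission
  imports Defs 
begin

text \<open>
  Let \<open>x, x'\<close> be independent samples from the Gaussian conditioned on \<open>K\<close>, \<open>p\<close> the Gaussian volume of \<open>K\<close>,
  and \<open>V = \<bar>x - x'\<bar>\<^sup>2 / 2\<close>, so that the expectation of \<open>V\<close> is the trace of the covariance matrix.
  The tester compares the average of \<open>V\<close> over \<open>O(n / \<epsilon>\<^sup>2)\<close> disjoint pairs with \<open>n - \<epsilon> / 128\<close>.

  Rotating \<open>(x, x')\<close> by 45 degrees, \<open>y = (x - x') / \<surd>2\<close> conditioned on \<open>z = (x + x') / \<surd>2\<close> is a Gaussian restricted
  to a symmetric convex set.  Such a set is star-shaped around 0, and differentiating its measure under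
  dilation gives \<open>E V \<le> n\<close> and \<open>E V\<^sup>2 \<le> (n + 2) E V\<close>; hence the variance is small enough for Chebyshev's inequality.

  It remains to bound the deficit \<open>n - E V\<close> below by a multiple of \<open>1 - p\<close>.  If in some direction \<open>K\<close> extends at most
  \<open>1 / 2\<close> beyond its mean, then the symmetric sections lie in slabs which are narrow on average, and this
  direction alone produces a constant deficit.  Otherwise \<open>p\<close> times the deficit is the rate at which the Gaussian
  measure of \<open>K\<close> grows under dilation from its mean.  It controls the probability that, of two Gaussian vectors at a
  small angle \<open>\<theta>\<close>, one lies inside \<open>K\<close> and the other outside, and this probability is at least of order
  \<open>\<theta> p (1 - p)\<close>, since rotating a Gaussian vector into an independent one takes \<open>O(1 / \<theta>)\<close> such steps.
\<close>

section \<open>Linear algebra and Lebesgue measure on extensional functions\<close>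

text \<open>Two obstacles shape the development. The convex set may fail to be Borel, while iterated
  integrals want Borel integrands; so integrals run over a Borel set \<open>B\<close>, the geometry
  uses \<open>K\<close>, and the null set between them is carried through every rotation. The mean
  of \<open>K\<close> is unknown to the tester; taking differences of two samples removes it, and
  exchanging the two samples supplies the symmetry that \<open>K\<close> lacks. With the mean as
  centre of dilation the first-order growth of the measure is exactly \<open>p\<close> times the
  deficit. To turn a dilation into a distance, the separating hyperplane must lie a fixed distance
  beyond the mean; the threshold 1/2 of the case split supplies this. Instead of a boundary measure,
  crossings are bounded at the dyadic scales 2^i * 4 * \<theta>, and \<theta> tends to 0, which
  removes all second-order terms and leaves the constant 16 * pi < 64. The tester's \<epsilon> / 128
  is half of \<epsilon> / 64, the deficit guaranteed at distance \<epsilon>.\<close>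

abbreviation lborel_pow :: "nat \<Rightarrow> (nat \<Rightarrow> real) measure" where
  "lborel_pow n \<equiv> (\<Pi>\<^sub>M i\<in>{..<n}. lborel)"

text \<open>The Borel version of \<open>gaussian\<close>. Leaving out the completion keeps product
  measurability and Fubini available; the passage to the completed measure is made only for the
  final statements.\<close>

definition gauss :: "nat \<Rightarrow> (nat \<Rightarrow> real) measure" where
  "gauss n = density (lborel_pow n) (\<lambda>x. ennreal (gaussian_density n x))"

abbreviation gauss1 :: "real measure" where
  "gauss1 \<equiv> density lborel (\<lambda>x. ennreal (std_normal_density x))"

definition dot :: "nat \<Rightarrow> (nat \<Rightarrow> real) \<Rightarrow> (nat \<Rightarrow> real) \<Rightarrow> real" where
  "dot n x y = (\<Sum>i<n. x i * y i)"

text \<open>The restriction keeps the result in the carrier of \<open>lborel_pow\<close>. A single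
  multiple of \<open>x\<close> is written \<open>lin n c x 0 x\<close>.\<close>

definition lin :: "nat \<Rightarrow> real \<Rightarrow> (nat \<Rightarrow> real) \<Rightarrow> real \<Rightarrow> (nat \<Rightarrow> real) \<Rightarrow> nat \<Rightarrow> real" where
  "lin n a x b y = (\<lambda>i\<in>{..<n}. a * x i + b * y i)"

lemma lin_apply [simp]: "i < n \<Longrightarrow> lin n a x b y i = a * x i + b * y i"
  by (simp add: lin_def)

lemma dot_lin_left [simp]: "dot n (lin n a x b y) z = a * dot n x z + b * dot n y z"
  by (simp add: dot_def sum_distrib_left algebra_simps sum.distrib)

lemma dot_lin_right [simp]: "dot n z (lin n a x b y) = a * dot n z x + b * dot n z y"
  by (simp add: dot_def sum_distrib_left algebra_simps sum.distrib)

lemma dot_commute: "dot n x y = dot n y x"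
  by (simp add: dot_def mult.commute)

lemma dot_nonneg [simp]: "0 \<le> dot n x x"
  by (simp add: dot_def sum_nonneg)

lemma dot_Cauchy_Schwarz: "(dot n x y)\<^sup>2 \<le> dot n x x * dot n y y"
  unfolding dot_def using Cauchy_Schwarz_ineq_sum[of x y "{..<n}"] by (simp add: power2_eq_square)

lemma lin_eq_iff: "lin n a x b y = lin n c u d w \<longleftrightarrow> (\<forall>i<n. a * x i + b * y i = c * u i + d * w i)"
  by (auto simp: lin_def fun_eq_iff restrict_def)

lemma space_lborel_pow [simp]: "space (lborel_pow n) = {..<n} \<rightarrow>\<^sub>E UNIV"
  by (simp add: space_PiM)

lemma lin_in_PiE [simp]: "lin n a x b y \<in> {..<n} \<rightarrow>\<^sub>E UNIV"
  by (simp add: lin_def)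

lemma eq_lin_iff:
  "x \<in> {..<n} \<rightarrow>\<^sub>E UNIV \<Longrightarrow> x = lin n a y b z \<longleftrightarrow> (\<forall>i<n. x i = a * y i + b * z i)"
  by (auto simp: fun_eq_iff lin_def restrict_def PiE_def extensional_def)

lemma measurable_lin [measurable (raw)]:
  assumes "f \<in> M \<rightarrow>\<^sub>M lborel_pow n" "g \<in> M \<rightarrow>\<^sub>M lborel_pow n"
    and [measurable]: "a \<in> borel_measurable M" "b \<in> borel_measurable M"
  shows "(\<lambda>x. lin n (a x) (f x) (b x) (g x)) \<in> M \<rightarrow>\<^sub>M lborel_pow n"
  unfolding lin_def
proof (rule measurable_restrict)
  fix i assume "i \<in> {..<n}"
  then have [measurable]: "(\<lambda>x. f x i) \<in> borel_measurable M" "(\<lambda>x. g x i) \<in> borel_measurable M"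
    using measurable_compose[OF assms(1) measurable_component_singleton[of i]]
      measurable_compose[OF assms(2) measurable_component_singleton[of i]] by simp_all
  show "(\<lambda>x. a x * f x i + b x * g x i) \<in> M \<rightarrow>\<^sub>M lborel" by simp
qed

lemma measurable_dot [measurable (raw)]:
  assumes "f \<in> M \<rightarrow>\<^sub>M lborel_pow n" "g \<in> M \<rightarrow>\<^sub>M lborel_pow n"
  shows "(\<lambda>x. dot n (f x) (g x)) \<in> borel_measurable M"
  unfolding dot_def
proof (rule borel_measurable_sum)
  fix i assume "i \<in> {..<n}"
  then have [measurable]: "(\<lambda>x. f x i) \<in> borel_measurable M" "(\<lambda>x. g x i) \<in> borel_measurable M"
    using measurable_compose[OF assms(1) measurable_component_singleton[of i]]
      measurable_compose[OF assms(2) measurable_component_singleton[of i]] by simp_all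
  show "(\<lambda>x. f x i * g x i) \<in> borel_measurable M" by simp
qed

lemma gaussian_density_eq: "gaussian_density n x = (1 / sqrt (2 * pi)) ^ n * exp (- dot n x x / 2)"
  by (simp add: gaussian_density_def normal_density_def prod.distrib exp_sum[symmetric] dot_def
      prod_dividef power_divide sum_divide_distrib sum_negf power2_eq_square)

lemma gaussian_density_pos: "0 < gaussian_density n x"
  by (simp add: gaussian_density_eq)

lemma measurable_gaussian_density [measurable (raw)]:
  assumes [measurable]: "f \<in> M \<rightarrow>\<^sub>M lborel_pow n"
  shows "(\<lambda>x. gaussian_density n (f x)) \<in> borel_measurable M"
  unfolding gaussian_density_eq by measurable

lemma sets_gauss [measurable_cong, simp]: "sets (gauss n) = sets (lborel_pow n)"
  by (simp add: gauss_def)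

lemma space_gauss [simp]: "space (gauss n) = {..<n} \<rightarrow>\<^sub>E UNIV"
  by (simp add: gauss_def)

lemma sigma_finite_lborel_pow: "sigma_finite_measure (lborel_pow n)"
proof -
  interpret product_sigma_finite "\<lambda>_::nat. lborel :: real measure" ..
  show ?thesis by (rule sigma_finite) simp
qed

lemma nn_integral_gauss:
  assumes [measurable]: "f \<in> borel_measurable (lborel_pow n)"
  shows "(\<integral>\<^sup>+x. f x \<partial>gauss n) = (\<integral>\<^sup>+x. ennreal (gaussian_density n x) * f x \<partial>lborel_pow n)"
  unfolding gauss_def by (rule nn_integral_density) measurable

lemma AE_gauss_iff: "(AE x in gauss n. P x) \<longleftrightarrow> (AE x in lborel_pow n. P x)"
  unfolding gauss_def by (subst AE_density) (auto simp: gaussian_density_pos)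

text \<open>The density is a product over coordinates, so both measures agree on boxes. This is how
  \<open>gauss n\<close> is seen to be a probability measure.\<close>

lemma gauss_eq_PiM: "gauss n = (\<Pi>\<^sub>M i\<in>{..<n}. gauss1)"
proof -
  interpret prob_space gauss1 by (rule prob_space_normal_density) simp
  interpret P: product_sigma_finite "\<lambda>_::nat. gauss1" ..
  interpret L: product_sigma_finite "\<lambda>_::nat. lborel :: real measure" ..
  show ?thesis
  proof (rule P.PiM_eqI)
    show "sets (gauss n) = sets (\<Pi>\<^sub>M i\<in>{..<n}. gauss1)"
      by (simp cong: sets_PiM_cong)
    fix A :: "nat \<Rightarrow> real set" assume "\<And>i. i \<in> {..<n} \<Longrightarrow> A i \<in> sets gauss1"
    then have A [measurable]: "\<And>i. i \<in> {..<n} \<Longrightarrow> A i \<in> sets borel" by simp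
    have "emeasure (gauss n) (Pi\<^sub>E {..<n} A) =
        (\<integral>\<^sup>+x. ennreal (gaussian_density n x) * indicator (Pi\<^sub>E {..<n} A) x \<partial>lborel_pow n)"
      unfolding gauss_def by (rule emeasure_density) (auto intro!: sets_PiM_I_finite A)
    also have "\<dots> = (\<integral>\<^sup>+x. (\<Prod>i<n. ennreal (std_normal_density (x i)) * indicator (A i) (x i)) \<partial>lborel_pow n)"
      by (intro nn_integral_cong)
        (auto simp: gaussian_density_def prod_ennreal prod.distrib indicator_def PiE_def Pi_def prod_zero_iff
          simp flip: prod_ennreal)
    also have "\<dots> = (\<Prod>i<n. \<integral>\<^sup>+x. ennreal (std_normal_density x) * indicator (A i) x \<partial>lborel)"
      by (rule L.product_nn_integral_prod) (use A in auto)
    also have "\<dots> = (\<Prod>i<n. emeasure gauss1 (A i))"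
      by (intro prod.cong refl emeasure_density[symmetric]) (use A in auto)
    finally show "emeasure (gauss n) (Pi\<^sub>E {..<n} A) = (\<Prod>i\<in>{..<n}. emeasure gauss1 (A i))" .
  qed simp
qed

lemma prob_space_gauss1: "prob_space gauss1"
  by (rule prob_space_normal_density) simp

lemma prob_space_gauss: "prob_space (gauss n)"
  unfolding gauss_eq_PiM using prob_space_gauss1 by (intro prob_space_PiM)

text \<open>Product measures are determined on boxes, and the preimage of a box under a
  coordinatewise affine map is a box; each side contributes the one-dimensional factor
  \<open>\<bar>c\<bar>\<close>.\<close>

lemma nn_integral_lborel_pow_affine:
  assumes c: "c \<noteq> 0" and f [measurable]: "f \<in> borel_measurable (lborel_pow n)"
    and a: "a \<in> {..<n} \<rightarrow>\<^sub>E UNIV"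
  shows "(\<integral>\<^sup>+x. f x \<partial>lborel_pow n) = ennreal (\<bar>c\<bar> ^ n) * (\<integral>\<^sup>+x. f (lin n c x 1 a) \<partial>lborel_pow n)"
proof -
  interpret L: product_sigma_finite "\<lambda>_::nat. lborel :: real measure" ..
  have [measurable]: "(\<lambda>x. a) \<in> lborel_pow n \<rightarrow>\<^sub>M lborel_pow n"
    using a by (intro measurable_const) simp
  let ?T = "\<lambda>x. lin n c x 1 a"
  have "density (distr (lborel_pow n) (lborel_pow n) ?T) (\<lambda>_. ennreal (\<bar>c\<bar> ^ n)) = lborel_pow n"
  proof (rule L.PiM_eqI)
    fix A :: "nat \<Rightarrow> real set" assume "\<And>i. i \<in> {..<n} \<Longrightarrow> A i \<in> sets lborel"
    then have A [measurable]: "\<And>i. i \<in> {..<n} \<Longrightarrow> A i \<in> sets borel" by simp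
    have *: "Pi\<^sub>E {..<n} A \<in> sets (lborel_pow n)" by (intro sets_PiM_I_finite) (auto intro: A)
    let ?B = "\<lambda>i. (\<lambda>x. a i + c * x) -` A i \<inter> space lborel"
    have B: "?B i \<in> sets lborel" if "i \<in> {..<n}" for i
      using that by measurable
    have "emeasure (distr (lborel_pow n) (lborel_pow n) ?T) (Pi\<^sub>E {..<n} A) =
        emeasure (lborel_pow n) (?T -` Pi\<^sub>E {..<n} A \<inter> space (lborel_pow n))"
      by (rule emeasure_distr[OF _ *]) measurable
    also have "?T -` Pi\<^sub>E {..<n} A \<inter> space (lborel_pow n) = Pi\<^sub>E {..<n} ?B"
      by (auto simp: PiE_def Pi_def extensional_def lin_def add.commute)
    also have "emeasure (lborel_pow n) (Pi\<^sub>E {..<n} ?B) = (\<Prod>i<n. emeasure lborel (?B i))"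
      by (rule L.emeasure_PiM) (use B in auto)
    finally have "emeasure (density (distr (lborel_pow n) (lborel_pow n) ?T) (\<lambda>_. ennreal (\<bar>c\<bar> ^ n))) (Pi\<^sub>E {..<n} A) =
        ennreal (\<bar>c\<bar> ^ n) * (\<Prod>i<n. emeasure lborel (?B i))"
      using * by (simp add: emeasure_density_const)
    also have "\<dots> = (\<Prod>i<n. ennreal \<bar>c\<bar> * emeasure lborel (?B i))"
      by (simp add: prod.distrib ennreal_power)
    also have "\<dots> = (\<Prod>i<n. emeasure lborel (A i))"
    proof (rule prod.cong[OF refl])
      fix i assume i: "i \<in> {..<n}"
      have "emeasure lborel (A i) = emeasure (density (distr lborel borel (\<lambda>x. a i + c * x)) (\<lambda>_. ennreal \<bar>c\<bar>)) (A i)"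
        by (subst lborel_real_affine[OF c, of "a i"]) simp
      also have "\<dots> = ennreal \<bar>c\<bar> * emeasure lborel (?B i)"
        using A[OF i] by (simp add: emeasure_density_const emeasure_distr)
      finally show "ennreal \<bar>c\<bar> * emeasure lborel (?B i) = emeasure lborel (A i)" by simp
    qed
    finally show "emeasure (density (distr (lborel_pow n) (lborel_pow n) ?T) (\<lambda>_. ennreal (\<bar>c\<bar> ^ n))) (Pi\<^sub>E {..<n} A)
      = (\<Prod>i\<in>{..<n}. emeasure lborel (A i))" .
  qed simp_all
  then have "(\<integral>\<^sup>+x. f x \<partial>lborel_pow n) =
      (\<integral>\<^sup>+x. f x \<partial>density (distr (lborel_pow n) (lborel_pow n) ?T) (\<lambda>_. ennreal (\<bar>c\<bar> ^ n)))" by simp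
  also have "\<dots> = (\<integral>\<^sup>+x. ennreal (\<bar>c\<bar> ^ n) * f x \<partial>distr (lborel_pow n) (lborel_pow n) ?T)"
    by (rule nn_integral_density) measurable
  also have "\<dots> = (\<integral>\<^sup>+x. ennreal (\<bar>c\<bar> ^ n) * f (?T x) \<partial>lborel_pow n)"
    by (rule nn_integral_distr) measurable
  also have "\<dots> = ennreal (\<bar>c\<bar> ^ n) * (\<integral>\<^sup>+x. f (?T x) \<partial>lborel_pow n)"
    by (rule nn_integral_cmult) measurable
  finally show ?thesis .
qed

lemma AE_lborel_pow_affine:
  assumes "c \<noteq> 0" and a: "a \<in> {..<n} \<rightarrow>\<^sub>E UNIV" and "AE x in lborel_pow n. P x"
  shows "AE x in lborel_pow n. P (lin n c x 1 a)"
proof -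
  obtain N where N: "{x \<in> space (lborel_pow n). \<not> P x} \<subseteq> N" "emeasure (lborel_pow n) N = 0"
    and [measurable]: "N \<in> sets (lborel_pow n)"
    using assms(3) by (rule AE_E)
  have P: "y \<notin> N \<Longrightarrow> y \<in> {..<n} \<rightarrow>\<^sub>E UNIV \<Longrightarrow> P y" for y
    using N(1) by auto
  have [measurable]: "(\<lambda>x. a) \<in> lborel_pow n \<rightarrow>\<^sub>M lborel_pow n"
    using a by (intro measurable_const) simp
  have "ennreal (\<bar>c\<bar> ^ n) * (\<integral>\<^sup>+x. indicator N (lin n c x 1 a) \<partial>lborel_pow n) = 0"
    using nn_integral_lborel_pow_affine[OF assms(1), of "indicator N" n a] a N(2) by simp
  then have "(\<integral>\<^sup>+x. indicator N (lin n c x 1 a) \<partial>lborel_pow n) = (0::ennreal)"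
    using assms(1) by simp
  then have "AE x in lborel_pow n. indicator N (lin n c x 1 a) = (0::ennreal)"
    by (subst (asm) nn_integral_0_iff_AE) auto
  then show ?thesis
    by eventually_elim (rule P, auto simp: indicator_eq_0_iff)
qed

lemma nn_integral_lborel_pow_translate:
  assumes "f \<in> borel_measurable (lborel_pow n)"
  shows "(\<integral>\<^sup>+x. f (lin n 1 x t y) \<partial>lborel_pow n) = (\<integral>\<^sup>+x. f x \<partial>lborel_pow n)"
proof -
  have "lin n 1 x t y = lin n 1 x 1 (lin n t y 0 y)" for x
    by (simp add: lin_eq_iff)
  then show ?thesis
    using nn_integral_lborel_pow_affine[OF _ assms, of 1 "lin n t y 0 y"] by simp
qed

lemma nn_integral_lborel_pow_Fubini:
  assumes [measurable]: "(\<lambda>(x, y). f x y) \<in> borel_measurable (lborel_pow n \<Otimes>\<^sub>M lborel_pow n)"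
  shows "(\<integral>\<^sup>+x. \<integral>\<^sup>+y. f x y \<partial>lborel_pow n \<partial>lborel_pow n) = (\<integral>\<^sup>+y. \<integral>\<^sup>+x. f x y \<partial>lborel_pow n \<partial>lborel_pow n)"
proof -
  interpret sigma_finite_measure "lborel_pow n" by (rule sigma_finite_lborel_pow)
  interpret pair_sigma_finite "lborel_pow n" "lborel_pow n" ..
  show ?thesis using Fubini'[of f] by simp
qed

lemma nn_integral_lborel_pow_rotation:
  assumes cs: "c\<^sup>2 + s\<^sup>2 = 1" "c \<noteq> -1"
    and F: "(\<lambda>(x, y). F x y) \<in> borel_measurable (lborel_pow n \<Otimes>\<^sub>M lborel_pow n)"
  shows "(\<integral>\<^sup>+x. \<integral>\<^sup>+y. F (lin n c x s y) (lin n (-s) x c y) \<partial>lborel_pow n \<partial>lborel_pow n) =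
    (\<integral>\<^sup>+x. \<integral>\<^sup>+y. F x y \<partial>lborel_pow n \<partial>lborel_pow n)"
proof -
  define t where "t = s / (1 + c)"
  have c1: "1 + c \<noteq> 0" using cs(2) by (simp add: add_eq_0_iff)
  have t: "t * s = 1 - c" "t * (1 + c) = s"
    using cs c1 by (simp_all add: t_def field_simps power2_eq_square)
  have Fm2 [measurable (raw)]: "(\<lambda>z. F (f z) (g z)) \<in> borel_measurable M"
    if [measurable]: "f \<in> M \<rightarrow>\<^sub>M lborel_pow n" "g \<in> M \<rightarrow>\<^sub>M lborel_pow n"
    for f g and M :: "((nat \<Rightarrow> real) \<times> (nat \<Rightarrow> real)) measure"
    using measurable_compose[OF measurable_Pair[OF that] F] by simp
  have Fm1 [measurable (raw)]: "(\<lambda>z. F (f z) (g z)) \<in> borel_measurable M"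
    if [measurable]: "f \<in> M \<rightarrow>\<^sub>M lborel_pow n" "g \<in> M \<rightarrow>\<^sub>M lborel_pow n"
    for f g and M :: "(nat \<Rightarrow> real) measure"
    using measurable_compose[OF measurable_Pair[OF that] F] by simp
  let ?L = "lborel_pow n"
  have "(\<integral>\<^sup>+x. \<integral>\<^sup>+y. F x y \<partial>?L \<partial>?L) = (\<integral>\<^sup>+y. \<integral>\<^sup>+x. F x y \<partial>?L \<partial>?L)"
    by (rule nn_integral_lborel_pow_Fubini[OF F])
  also have "\<dots> = (\<integral>\<^sup>+y. \<integral>\<^sup>+x. F (lin n 1 x t y) y \<partial>?L \<partial>?L)"
    by (intro nn_integral_cong nn_integral_lborel_pow_translate[symmetric]) simp
  also have "\<dots> = (\<integral>\<^sup>+x. \<integral>\<^sup>+y. F (lin n 1 x t y) y \<partial>?L \<partial>?L)"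
    by (rule nn_integral_lborel_pow_Fubini) (simp add: split_beta')
  also have "\<dots> = (\<integral>\<^sup>+x. \<integral>\<^sup>+y. F (lin n 1 x t (lin n 1 y (-s) x)) (lin n 1 y (-s) x) \<partial>?L \<partial>?L)"
    by (intro nn_integral_cong nn_integral_lborel_pow_translate[symmetric]) simp
  also have "\<dots> = (\<integral>\<^sup>+y. \<integral>\<^sup>+x. F (lin n 1 x t (lin n 1 y (-s) x)) (lin n 1 y (-s) x) \<partial>?L \<partial>?L)"
    by (rule nn_integral_lborel_pow_Fubini) (simp add: split_beta')
  also have "\<dots> = (\<integral>\<^sup>+y. \<integral>\<^sup>+x. F (lin n 1 (lin n 1 x t y) t (lin n 1 y (-s) (lin n 1 x t y))) (lin n 1 y (-s) (lin n 1 x t y)) \<partial>?L \<partial>?L)"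
    by (intro nn_integral_cong nn_integral_lborel_pow_translate[symmetric]) simp
  also have "\<dots> = (\<integral>\<^sup>+y. \<integral>\<^sup>+x. F (lin n c x s y) (lin n (-s) x c y) \<partial>?L \<partial>?L)"
  proof -
    have "lin n 1 y (-s) (lin n 1 x t y) = lin n (-s) x c y" for x y
    proof (unfold lin_eq_iff, intro allI impI)
      fix i assume "i < n"
      have "y i - s * (x i + t * y i) = - s * x i + (1 - t * s) * y i" by algebra
      then show "1 * y i + - s * lin n 1 x t y i = - s * x i + c * y i"
        using \<open>i < n\<close> t by simp
    qed
    moreover have "lin n 1 (lin n 1 x t y) t (lin n (-s) x c y) = lin n c x s y" for x y
    proof (unfold lin_eq_iff, intro allI impI)
      fix i assume "i < n"
      have "(x i + t * y i) + t * (- s * x i + c * y i) = (1 - t * s) * x i + (t * (1 + c)) * y i" by algebra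
      then show "1 * lin n 1 x t y i + t * lin n (-s) x c y i = c * x i + s * y i"
        using \<open>i < n\<close> t by simp
    qed
    ultimately show ?thesis by simp
  qed
  also have "\<dots> = (\<integral>\<^sup>+x. \<integral>\<^sup>+y. F (lin n c x s y) (lin n (-s) x c y) \<partial>?L \<partial>?L)"
    by (rule nn_integral_lborel_pow_Fubini[symmetric]) (simp add: split_beta')
  finally show ?thesis by simp
qed

section \<open>Symmetries of the Gaussian\<close>

lemma nn_integral_gauss_gauss:
  assumes [measurable]: "(\<lambda>(x, y). F x y) \<in> borel_measurable (lborel_pow n \<Otimes>\<^sub>M lborel_pow n)"
  shows "(\<integral>\<^sup>+x. \<integral>\<^sup>+y. F x y \<partial>gauss n \<partial>gauss n) =
    (\<integral>\<^sup>+x. \<integral>\<^sup>+y. ennreal (gaussian_density n x * gaussian_density n y) * F x y \<partial>lborel_pow n \<partial>lborel_pow n)"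
proof -
  interpret G: prob_space "gauss n" by (rule prob_space_gauss)
  have [measurable]: "F x \<in> borel_measurable (lborel_pow n)" if "x \<in> space (lborel_pow n)" for x
    using measurable_compose[OF measurable_Pair1'[OF that] assms] by simp
  have "(\<integral>\<^sup>+x. \<integral>\<^sup>+y. F x y \<partial>gauss n \<partial>gauss n) =
      (\<integral>\<^sup>+x. ennreal (gaussian_density n x) * (\<integral>\<^sup>+y. F x y \<partial>gauss n) \<partial>lborel_pow n)"
    by (rule nn_integral_gauss) measurable
  also have "\<dots> = (\<integral>\<^sup>+x. \<integral>\<^sup>+y. ennreal (gaussian_density n x * gaussian_density n y) * F x y \<partial>lborel_pow n \<partial>lborel_pow n)"
  proof (rule nn_integral_cong)
    fix x assume x: "x \<in> space (lborel_pow n)"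
    have [measurable]: "F x \<in> borel_measurable (lborel_pow n)"
      using measurable_compose[OF measurable_Pair1'[OF x] assms] by simp
    have "ennreal (gaussian_density n x) * (\<integral>\<^sup>+y. F x y \<partial>gauss n) =
        ennreal (gaussian_density n x) * (\<integral>\<^sup>+y. ennreal (gaussian_density n y) * F x y \<partial>lborel_pow n)"
      by (subst nn_integral_gauss) simp_all
    also have "\<dots> = (\<integral>\<^sup>+y. ennreal (gaussian_density n x) * (ennreal (gaussian_density n y) * F x y) \<partial>lborel_pow n)"
      by (rule nn_integral_cmult[symmetric]) measurable
    finally show "ennreal (gaussian_density n x) * (\<integral>\<^sup>+y. F x y \<partial>gauss n) =
        (\<integral>\<^sup>+y. ennreal (gaussian_density n x * gaussian_density n y) * F x y \<partial>lborel_pow n)"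
      by (simp add: ennreal_mult gaussian_density_pos less_imp_le mult.assoc)
  qed
  finally show ?thesis .
qed

lemma nn_integral_gauss_rotation:
  assumes cs: "c\<^sup>2 + s\<^sup>2 = 1" "c \<noteq> -1"
    and F [measurable]: "(\<lambda>(x, y). F x y) \<in> borel_measurable (lborel_pow n \<Otimes>\<^sub>M lborel_pow n)"
  shows "(\<integral>\<^sup>+x. \<integral>\<^sup>+y. F (lin n c x s y) (lin n (-s) x c y) \<partial>gauss n \<partial>gauss n) =
    (\<integral>\<^sup>+x. \<integral>\<^sup>+y. F x y \<partial>gauss n \<partial>gauss n)"
proof -
  have m: "(\<lambda>z. (lin n c (fst z) s (snd z), lin n (-s) (fst z) c (snd z)))
      \<in> lborel_pow n \<Otimes>\<^sub>M lborel_pow n \<rightarrow>\<^sub>M lborel_pow n \<Otimes>\<^sub>M lborel_pow n" by measurable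
  have Fm: "(\<lambda>(x, y). F (lin n c x s y) (lin n (-s) x c y))
      \<in> borel_measurable (lborel_pow n \<Otimes>\<^sub>M lborel_pow n)"
    using measurable_compose[OF m F] by (simp add: split_beta')
  \<comment> \<open>The product of the two densities depends only on |x|^2 + |y|^2, which a rotation
    preserves.\<close>
  have D: "gaussian_density n (lin n c x s y) * gaussian_density n (lin n (-s) x c y)
      = gaussian_density n x * gaussian_density n y" for x y
  proof -
    have "dot n (lin n c x s y) (lin n c x s y) + dot n (lin n (-s) x c y) (lin n (-s) x c y) =
        (c\<^sup>2 + s\<^sup>2) * (dot n x x + dot n y y)"
      by (simp add: dot_commute[of n y x] power2_eq_square algebra_simps)
    then have "exp (- dot n (lin n c x s y) (lin n c x s y) / 2) * exp (- dot n (lin n (-s) x c y) (lin n (-s) x c y) / 2)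
        = exp (- dot n x x / 2) * exp (- dot n y y / 2)"
      using cs(1) by (simp only: exp_add[symmetric]) (simp add: field_simps)
    then show ?thesis
      unfolding gaussian_density_eq by (metis (no_types, opaque_lifting) mult.assoc mult.left_commute)
  qed
  have "(\<integral>\<^sup>+x. \<integral>\<^sup>+y. F x y \<partial>gauss n \<partial>gauss n) =
    (\<integral>\<^sup>+x. \<integral>\<^sup>+y. ennreal (gaussian_density n x * gaussian_density n y) * F x y \<partial>lborel_pow n \<partial>lborel_pow n)"
    by (rule nn_integral_gauss_gauss[OF F])
  also have "\<dots> = (\<integral>\<^sup>+x. \<integral>\<^sup>+y. ennreal (gaussian_density n (lin n c x s y) * gaussian_density n (lin n (-s) x c y)) *
      F (lin n c x s y) (lin n (-s) x c y) \<partial>lborel_pow n \<partial>lborel_pow n)"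
    by (rule nn_integral_lborel_pow_rotation[OF cs, symmetric]) measurable
  also have "\<dots> = (\<integral>\<^sup>+x. \<integral>\<^sup>+y. F (lin n c x s y) (lin n (-s) x c y) \<partial>gauss n \<partial>gauss n)"
    unfolding D by (rule nn_integral_gauss_gauss[OF Fm, symmetric])
  finally show ?thesis by simp
qed

section \<open>Exchanging one Gaussian direction with an independent normal variable\<close>

lemma nn_integral_lborel_pow_lborel_Fubini:
  assumes [measurable]: "(\<lambda>(x, y). f x y) \<in> borel_measurable (lborel_pow n \<Otimes>\<^sub>M (lborel :: real measure))"
  shows "(\<integral>\<^sup>+x. \<integral>\<^sup>+y. f x y \<partial>lborel \<partial>lborel_pow n) = (\<integral>\<^sup>+y. \<integral>\<^sup>+x. f x y \<partial>lborel_pow n \<partial>lborel)"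
proof -
  interpret sigma_finite_measure "lborel_pow n" by (rule sigma_finite_lborel_pow)
  interpret pair_sigma_finite "lborel_pow n" "lborel :: real measure" ..
  show ?thesis using Fubini'[of f] by simp
qed

lemma nn_integral_lborel_translate:
  assumes [measurable]: "f \<in> borel_measurable borel"
  shows "(\<integral>\<^sup>+x. f (x + t) \<partial>lborel) = (\<integral>\<^sup>+x. f x \<partial>(lborel :: real measure))"
  using nn_integral_real_affine[of f 1 t] by (simp add: add.commute)

text \<open>
  With \<open>v\<close> a unit vector, the map \<open>(g, h) \<mapsto> (g + (h - \<langle>v, g\<rangle>) v, -\<langle>v, g\<rangle>)\<close> is a rotation of
  \<open>\<real>\<^sup>n \<times> \<real>\<close> which exchanges the component of \<open>g\<close> along \<open>v\<close> with \<open>h\<close>.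
\<close>

lemma nn_integral_lborel_pow_swap:
  assumes v: "dot n v v = 1" "v \<in> {..<n} \<rightarrow>\<^sub>E UNIV"
    and F: "(\<lambda>(x, y). F x y) \<in> borel_measurable (lborel_pow n \<Otimes>\<^sub>M (lborel :: real measure))"
  shows "(\<integral>\<^sup>+g. \<integral>\<^sup>+h. F (lin n 1 g (h - dot n v g) v) (- dot n v g) \<partial>lborel \<partial>lborel_pow n) =
    (\<integral>\<^sup>+g. \<integral>\<^sup>+h. F g h \<partial>lborel \<partial>lborel_pow n)"
proof -
  let ?L = "lborel_pow n"
  have [measurable]: "v \<in> space ?L" using v by simp
  have Fm2 [measurable (raw)]: "(\<lambda>z. F (f z) (g z)) \<in> borel_measurable M"
    if [measurable]: "f \<in> M \<rightarrow>\<^sub>M ?L" "g \<in> borel_measurable M"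
    for f g and M :: "((nat \<Rightarrow> real) \<times> real) measure"
    using measurable_compose[OF measurable_Pair[OF that(1)] F, of g] that(2) by simp
  have Fm1 [measurable (raw)]: "(\<lambda>z. F (f z) (g z)) \<in> borel_measurable M"
    if [measurable]: "f \<in> M \<rightarrow>\<^sub>M ?L" "g \<in> borel_measurable M"
    for f g and M :: "(nat \<Rightarrow> real) measure"
    using measurable_compose[OF measurable_Pair[OF that(1)] F, of g] that(2) by simp
  have Fm0 [measurable (raw)]: "(\<lambda>z. F (f z) (g z)) \<in> borel_measurable M"
    if [measurable]: "f \<in> M \<rightarrow>\<^sub>M ?L" "g \<in> borel_measurable M"
    for f g and M :: "real measure"
    using measurable_compose[OF measurable_Pair[OF that(1)] F, of g] that(2) by simp
  have "(\<integral>\<^sup>+g. \<integral>\<^sup>+h. F g h \<partial>lborel \<partial>?L) = (\<integral>\<^sup>+g. \<integral>\<^sup>+h. F g (h + - dot n v g) \<partial>lborel \<partial>?L)"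
    by (intro nn_integral_cong nn_integral_lborel_translate[symmetric]) measurable
  also have "\<dots> = (\<integral>\<^sup>+h. \<integral>\<^sup>+g. F g (h + - dot n v g) \<partial>?L \<partial>lborel)"
    by (rule nn_integral_lborel_pow_lborel_Fubini) (simp add: split_beta')
  also have "\<dots> = (\<integral>\<^sup>+h. \<integral>\<^sup>+g. F (lin n 1 g h v) (h + - dot n v (lin n 1 g h v)) \<partial>?L \<partial>lborel)"
    by (intro nn_integral_cong nn_integral_lborel_pow_translate[symmetric]) measurable
  \<comment> \<open>Second of three shears. Since v is a unit vector, <v, g + h v> = <v, g> + h, so
    h cancels from the second argument.\<close>
  also have "\<dots> = (\<integral>\<^sup>+h. \<integral>\<^sup>+g. F (lin n 1 g h v) (- dot n v g) \<partial>?L \<partial>lborel)"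
    using v(1) by simp
  also have "\<dots> = (\<integral>\<^sup>+g. \<integral>\<^sup>+h. F (lin n 1 g h v) (- dot n v g) \<partial>lborel \<partial>?L)"
    by (rule nn_integral_lborel_pow_lborel_Fubini[symmetric]) (simp add: split_beta')
  also have "\<dots> = (\<integral>\<^sup>+g. \<integral>\<^sup>+h. F (lin n 1 g (h + - dot n v g) v) (- dot n v g) \<partial>lborel \<partial>?L)"
    by (intro nn_integral_cong nn_integral_lborel_translate[symmetric]) measurable
  finally show ?thesis by simp
qed

lemma nn_integral_gauss1:
  assumes [measurable]: "f \<in> borel_measurable borel"
  shows "(\<integral>\<^sup>+x. f x \<partial>gauss1) = (\<integral>\<^sup>+x. ennreal (std_normal_density x) * f x \<partial>lborel)"
  by (rule nn_integral_density) measurable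

lemma AE_gauss1_iff: "(AE x in gauss1. P x) \<longleftrightarrow> (AE x in lborel. P x)"
  by (subst AE_density) (auto simp: normal_density_pos)

lemma nn_integral_gauss_gauss1:
  assumes [measurable]: "(\<lambda>(x, y). F x y) \<in> borel_measurable (lborel_pow n \<Otimes>\<^sub>M (lborel :: real measure))"
  shows "(\<integral>\<^sup>+x. \<integral>\<^sup>+y. F x y \<partial>gauss1 \<partial>gauss n) =
    (\<integral>\<^sup>+x. \<integral>\<^sup>+y. ennreal (gaussian_density n x * std_normal_density y) * F x y \<partial>lborel \<partial>lborel_pow n)"
proof -
  interpret G: prob_space gauss1 by (rule prob_space_gauss1)
  have "(\<integral>\<^sup>+x. \<integral>\<^sup>+y. F x y \<partial>gauss1 \<partial>gauss n) =
      (\<integral>\<^sup>+x. ennreal (gaussian_density n x) * (\<integral>\<^sup>+y. F x y \<partial>gauss1) \<partial>lborel_pow n)"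
    by (rule nn_integral_gauss) measurable
  also have "\<dots> = (\<integral>\<^sup>+x. \<integral>\<^sup>+y. ennreal (gaussian_density n x * std_normal_density y) * F x y \<partial>lborel \<partial>lborel_pow n)"
  proof (rule nn_integral_cong)
    fix x assume x: "x \<in> space (lborel_pow n)"
    have [measurable]: "F x \<in> borel_measurable borel"
      using measurable_compose[OF measurable_Pair1'[OF x] assms] by simp
    have "ennreal (gaussian_density n x) * (\<integral>\<^sup>+y. F x y \<partial>gauss1) =
        ennreal (gaussian_density n x) * (\<integral>\<^sup>+y. ennreal (std_normal_density y) * F x y \<partial>lborel)"
      by (subst nn_integral_gauss1) simp_all
    also have "\<dots> = (\<integral>\<^sup>+y. ennreal (gaussian_density n x) * (ennreal (std_normal_density y) * F x y) \<partial>lborel)"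
      by (rule nn_integral_cmult[symmetric]) measurable
    finally show "ennreal (gaussian_density n x) * (\<integral>\<^sup>+y. F x y \<partial>gauss1) =
        (\<integral>\<^sup>+y. ennreal (gaussian_density n x * std_normal_density y) * F x y \<partial>lborel)"
      by (simp add: ennreal_mult gaussian_density_pos less_imp_le mult.assoc)
  qed
  finally show ?thesis .
qed

lemma nn_integral_gauss_swap:
  assumes v: "dot n v v = 1" "v \<in> {..<n} \<rightarrow>\<^sub>E UNIV"
    and F [measurable]: "(\<lambda>(x, y). F x y) \<in> borel_measurable (lborel_pow n \<Otimes>\<^sub>M (lborel :: real measure))"
  shows "(\<integral>\<^sup>+g. \<integral>\<^sup>+h. F (lin n 1 g (h - dot n v g) v) (- dot n v g) \<partial>gauss1 \<partial>gauss n) =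
    (\<integral>\<^sup>+g. \<integral>\<^sup>+h. F g h \<partial>gauss1 \<partial>gauss n)"
proof -
  have [measurable]: "v \<in> space (lborel_pow n)" using v by simp
  have m: "(\<lambda>z. (lin n 1 (fst z) (snd z - dot n v (fst z)) v, - dot n v (fst z)))
      \<in> lborel_pow n \<Otimes>\<^sub>M lborel \<rightarrow>\<^sub>M lborel_pow n \<Otimes>\<^sub>M lborel" by measurable
  have Fm: "(\<lambda>(g, h). F (lin n 1 g (h - dot n v g) v) (- dot n v g))
      \<in> borel_measurable (lborel_pow n \<Otimes>\<^sub>M lborel)"
    using measurable_compose[OF m F] by (simp add: split_beta')
  have D: "gaussian_density n (lin n 1 g (h - dot n v g) v) * std_normal_density (- dot n v g)
      = gaussian_density n g * std_normal_density h" for g h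
  proof -
    have "dot n (lin n 1 g (h - dot n v g) v) (lin n 1 g (h - dot n v g) v) + (dot n v g)\<^sup>2 = dot n g g + h\<^sup>2"
      using v(1) by (simp add: dot_commute[of n g v] power2_eq_square algebra_simps)
    then have "exp (- dot n (lin n 1 g (h - dot n v g) v) (lin n 1 g (h - dot n v g) v) / 2) * exp (- (dot n v g)\<^sup>2 / 2)
        = exp (- dot n g g / 2) * exp (- h\<^sup>2 / 2)"
      by (simp only: exp_add[symmetric]) (simp add: field_simps)
    then show ?thesis
      unfolding gaussian_density_eq by (simp add: normal_density_def)
  qed
  have "(\<integral>\<^sup>+x. \<integral>\<^sup>+y. F x y \<partial>gauss1 \<partial>gauss n) =
    (\<integral>\<^sup>+x. \<integral>\<^sup>+y. ennreal (gaussian_density n x * std_normal_density y) * F x y \<partial>lborel \<partial>lborel_pow n)"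
    by (rule nn_integral_gauss_gauss1[OF F])
  also have "\<dots> = (\<integral>\<^sup>+g. \<integral>\<^sup>+h. ennreal (gaussian_density n (lin n 1 g (h - dot n v g) v) * std_normal_density (- dot n v g)) *
      F (lin n 1 g (h - dot n v g) v) (- dot n v g) \<partial>lborel \<partial>lborel_pow n)"
    by (rule nn_integral_lborel_pow_swap[OF v, symmetric]) measurable
  also have "\<dots> = (\<integral>\<^sup>+g. \<integral>\<^sup>+h. F (lin n 1 g (h - dot n v g) v) (- dot n v g) \<partial>gauss1 \<partial>gauss n)"
    unfolding D by (rule nn_integral_gauss_gauss1[OF Fm, symmetric])
  finally show ?thesis by simp
qed

text \<open>The swap lemma, applied to a function of the scalar component alone. The sign on the
  right is the one which the swap puts on <v, g>.\<close>

lemma nn_integral_gauss_dot: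
  assumes v: "dot n v v = 1" "v \<in> {..<n} \<rightarrow>\<^sub>E UNIV" and f [measurable]: "f \<in> borel_measurable borel"
  shows "(\<integral>\<^sup>+g. f (dot n v g) \<partial>gauss n) = (\<integral>\<^sup>+h. f (- h) \<partial>gauss1)"
proof -
  interpret G: prob_space gauss1 by (rule prob_space_gauss1)
  interpret H: prob_space "gauss n" by (rule prob_space_gauss)
  have "(\<integral>\<^sup>+g. f (dot n v g) \<partial>gauss n) = (\<integral>\<^sup>+g. \<integral>\<^sup>+h. f (- (- dot n v g)) \<partial>gauss1 \<partial>gauss n)"
    using G.emeasure_space_1 by simp
  also have "\<dots> = (\<integral>\<^sup>+g. \<integral>\<^sup>+h. f (- h) \<partial>gauss1 \<partial>gauss n)"
    by (rule nn_integral_gauss_swap[OF v]) measurable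
  also have "\<dots> = (\<integral>\<^sup>+h. f (- h) \<partial>gauss1)"
    using H.emeasure_space_1 by simp
  finally show ?thesis .
qed

lemma nn_integral_gauss1_square: "(\<integral>\<^sup>+h. ennreal (h\<^sup>2) \<partial>gauss1) = 1"
proof -
  have "(\<integral>\<^sup>+h. ennreal (h\<^sup>2) \<partial>gauss1) = (\<integral>\<^sup>+h. ennreal (std_normal_density h * h\<^sup>2) \<partial>lborel)"
    by (subst nn_integral_gauss1) (simp_all add: ennreal_mult)
  also have "\<dots> = ennreal (\<integral>h. std_normal_density h * h\<^sup>2 \<partial>lborel)"
    using std_normal_moment_even[of 1]
    by (intro nn_integral_eq_integral) (auto simp: has_bochner_integral_iff)
  also have "\<dots> = 1"
    using integral_std_normal_moment_even[of 1] by simp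
  finally show ?thesis .
qed

lemma nn_integral_gauss_dot_square:
  assumes v: "dot n v v = 1" "v \<in> {..<n} \<rightarrow>\<^sub>E UNIV"
  shows "(\<integral>\<^sup>+g. ennreal ((dot n v g)\<^sup>2) \<partial>gauss n) = 1"
  using nn_integral_gauss_dot[OF v, of "\<lambda>t. ennreal (t\<^sup>2)"] nn_integral_gauss1_square by simp

lemma nn_integral_gauss_norm: "(\<integral>\<^sup>+g. ennreal (dot n g g) \<partial>gauss n) = ennreal (real n)"
proof -
  have 1: "(\<integral>\<^sup>+g. ennreal ((g i)\<^sup>2) \<partial>gauss n) = 1" if i: "i < n" for i
  proof -
    let ?e = "\<lambda>j\<in>{..<n}. if j = i then 1 else (0::real)"
    have e: "dot n ?e g = g i" for g
      unfolding dot_def using i by (simp add: if_distrib[of "\<lambda>x. x * _"] sum.delta cong: if_cong)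
    show ?thesis using nn_integral_gauss_dot_square[of n ?e] i by (simp add: e)
  qed
  have "(\<integral>\<^sup>+g. ennreal (dot n g g) \<partial>gauss n) = (\<integral>\<^sup>+g. (\<Sum>i<n. ennreal ((g i)\<^sup>2)) \<partial>gauss n)"
    by (simp add: dot_def power2_eq_square sum_ennreal)
  also have "\<dots> = (\<Sum>i<n. \<integral>\<^sup>+g. ennreal ((g i)\<^sup>2) \<partial>gauss n)"
    by (rule nn_integral_sum) measurable
  also have "\<dots> = ennreal (real n)"
    using 1 by (simp add: ennreal_of_nat_eq_real_of_nat)
  finally show ?thesis .
qed

section \<open>Moments of radially decreasing weights\<close>

lemma one_plus_power_inverse_ge:
  fixes \<sigma> :: real
  assumes "0 < \<sigma>" "\<sigma> \<le> 1"
  shows "1 - real N * \<sigma> \<le> inverse ((1 + \<sigma>) ^ N)"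
proof -
  have "1 - \<sigma> \<le> inverse (1 + \<sigma>)"
    using assms by (simp add: field_simps)
  then have "(1 - \<sigma>) ^ N \<le> inverse (1 + \<sigma>) ^ N"
    using assms by (intro power_mono) auto
  moreover have "1 + real N * (- \<sigma>) \<le> (1 + - \<sigma>) ^ N"
    by (rule Bernoulli_inequality) (use assms in auto)
  ultimately show ?thesis by (simp add: power_inverse)
qed

text \<open>Substitute x by s * x with s = 1 + \<sigma>: the Jacobian gives s^n, the norm power
  gives s^(2k), and the Gaussian density loses at least exp (- \<sigma> |x|^2) because s^2 - 1 \<ge>
  2 * \<sigma>. The weight only grows when its argument contracts.\<close>

lemma dilation_upper_bound:
  assumes m [measurable]: "m \<in> borel_measurable (lborel_pow n)" and \<sigma>: "0 < \<sigma>"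
    and rad: "AE x in lborel_pow n. m x \<le> m (lin n (1 / (1 + \<sigma>)) x 0 x)"
  shows "(\<integral>\<^sup>+x. m x * ennreal (dot n x x ^ k) \<partial>gauss n) \<le>
    ennreal ((1 + \<sigma>) ^ (n + 2 * k)) *
      (\<integral>\<^sup>+x. m x * ennreal (dot n x x ^ k * exp (- \<sigma> * dot n x x)) \<partial>gauss n)"
proof -
  define s where "s = 1 + \<sigma>"
  have s: "s > 1" using \<sigma> by (simp add: s_def)
  let ?o = "\<lambda>i\<in>{..<n}. 0 :: real"
  have [measurable]: "?o \<in> space (lborel_pow n)" by simp
  have "(\<integral>\<^sup>+x. m x * ennreal (dot n x x ^ k) \<partial>gauss n) =
      (\<integral>\<^sup>+x. ennreal (gaussian_density n x) * (m x * ennreal (dot n x x ^ k)) \<partial>lborel_pow n)"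
    by (rule nn_integral_gauss) measurable
  also have "\<dots> \<le> (\<integral>\<^sup>+x. ennreal (gaussian_density n x) * (m (lin n (1 / s) x 0 x) * ennreal (dot n x x ^ k)) \<partial>lborel_pow n)"
    using rad by (intro nn_integral_mono_AE) (auto simp: s_def intro!: mult_left_mono mult_right_mono)
  also have "\<dots> = ennreal (\<bar>s\<bar> ^ n) * (\<integral>\<^sup>+x. ennreal (gaussian_density n (lin n s x 1 ?o)) *
      (m (lin n (1 / s) (lin n s x 1 ?o) 0 (lin n s x 1 ?o)) * ennreal (dot n (lin n s x 1 ?o) (lin n s x 1 ?o) ^ k)) \<partial>lborel_pow n)"
    by (rule nn_integral_lborel_pow_affine) (use s in auto)
  also have "\<dots> \<le> ennreal (s ^ n) * (\<integral>\<^sup>+x. ennreal (gaussian_density n x) * (ennreal (s ^ (2 * k)) *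
      (m x * ennreal (dot n x x ^ k * exp (- \<sigma> * dot n x x)))) \<partial>lborel_pow n)"
  proof -
    have "ennreal (gaussian_density n (lin n s x 1 ?o)) *
      (m (lin n (1 / s) (lin n s x 1 ?o) 0 (lin n s x 1 ?o)) * ennreal (dot n (lin n s x 1 ?o) (lin n s x 1 ?o) ^ k))
      \<le> ennreal (gaussian_density n x) * (ennreal (s ^ (2 * k)) *
      (m x * ennreal (dot n x x ^ k * exp (- \<sigma> * dot n x x))))" if x: "x \<in> space (lborel_pow n)" for x
    proof -
      have o: "dot n ?o y = 0" "dot n y ?o = 0" for y by (simp_all add: dot_def)
      have 1: "lin n (1 / s) (lin n s x 1 ?o) 0 (lin n s x 1 ?o) = x"
        using x s by (subst eq_commute, subst eq_lin_iff) auto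
      have 2: "dot n (lin n s x 1 ?o) (lin n s x 1 ?o) = s\<^sup>2 * dot n x x"
        by (simp add: o power2_eq_square)
      have 3: "gaussian_density n (lin n s x 1 ?o) \<le> gaussian_density n x * exp (- \<sigma> * dot n x x)"
      proof -
        have "\<sigma> * 2 * dot n x x \<le> (s\<^sup>2 - 1) * dot n x x"
          by (intro mult_right_mono) (auto simp: s_def power2_eq_square algebra_simps)
        then have "- (s\<^sup>2 * dot n x x) / 2 \<le> - dot n x x / 2 + - \<sigma> * dot n x x"
          by (simp add: algebra_simps)
        then have "exp (- (s\<^sup>2 * dot n x x) / 2) \<le> exp (- dot n x x / 2) * exp (- \<sigma> * dot n x x)"
          by (simp only: exp_add[symmetric] exp_le_cancel_iff)
        then show ?thesis
          unfolding gaussian_density_eq 2 mult.assoc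
          by (intro mult_left_mono) auto
      qed
      have "ennreal (gaussian_density n (lin n s x 1 ?o)) * (m x * ennreal ((s\<^sup>2 * dot n x x) ^ k)) \<le>
          ennreal (gaussian_density n x * exp (- \<sigma> * dot n x x)) * (m x * ennreal ((s\<^sup>2 * dot n x x) ^ k))"
        by (intro mult_right_mono ennreal_leI 3) auto
      also have "\<dots> = ennreal (gaussian_density n x) * (ennreal (s ^ (2 * k)) *
          (m x * ennreal (dot n x x ^ k * exp (- \<sigma> * dot n x x))))"
        using s by (simp add: ennreal_mult gaussian_density_pos less_imp_le power_mult_distrib mult_ac flip: power_mult)
      finally show ?thesis unfolding 1 2 .
    qed
    then show ?thesis using s by (auto intro!: mult_left_mono nn_integral_mono)
  qed
  also have "\<dots> = ennreal (s ^ n) * (\<integral>\<^sup>+x. ennreal (s ^ (2 * k)) *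
      (m x * ennreal (dot n x x ^ k * exp (- \<sigma> * dot n x x))) \<partial>gauss n)"
    by (subst nn_integral_gauss) simp_all
  also have "\<dots> = ennreal (s ^ n) * (ennreal (s ^ (2 * k)) *
     (\<integral>\<^sup>+x. m x * ennreal (dot n x x ^ k * exp (- \<sigma> * dot n x x)) \<partial>gauss n))"
    by (subst nn_integral_cmult) simp_all
  finally show ?thesis
    using s by (simp add: s_def ennreal_mult power_add mult.assoc)
qed

text \<open>The derivative at \<sigma> = 0 of the dilation bound, taken without differentiating
  under the integral. With A the moment of order k, the bound gives A \<le> (1 + \<sigma>)^(n + 2k)
  * (A - X \<sigma>), hence X \<sigma> \<le> (n + 2k) * \<sigma> * A by Bernoulli. Dividing by
  \<sigma> and using Fatou yields the next moment, whose finiteness is thereby a result and not an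
  assumption.\<close>

lemma radial_moment:
  assumes m [measurable]: "m \<in> borel_measurable (lborel_pow n)" and fin: "\<And>x. m x < \<top>"
    and rad: "\<And>s. 1 < s \<Longrightarrow> AE x in lborel_pow n. m x \<le> m (lin n (1 / s) x 0 x)"
  shows "(\<integral>\<^sup>+x. m x * ennreal (dot n x x ^ Suc k) \<partial>gauss n) \<le>
    ennreal (real (n + 2 * k)) * (\<integral>\<^sup>+x. m x * ennreal (dot n x x ^ k) \<partial>gauss n)"
proof -
  define A where "A = (\<integral>\<^sup>+x. m x * ennreal (dot n x x ^ k) \<partial>gauss n)"
  \<comment> \<open>In \<open>ennreal\<close>, 0 * \<top> = 0, so an infinite moment makes the
    right-hand side infinite only if its factor is nonzero; dimension 0 is treated apart because all
    norms vanish there.\<close>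
  consider "n = 0" | "n \<noteq> 0" "A = \<top>" | "A < \<top>" by (cases "A = \<top>") (auto simp: less_top)
  then show ?thesis
  proof cases
    case 1 then show ?thesis by (simp add: dot_def)
  next
    case 2 then show ?thesis by (simp add: A_def ennreal_mult_top)
  next
    case 3
    define X where "X \<sigma> = (\<integral>\<^sup>+x. m x * ennreal (dot n x x ^ k * (1 - exp (- \<sigma> * dot n x x))) \<partial>gauss n)" for \<sigma>
    have X_le: "X \<sigma> \<le> ennreal (real (n + 2 * k) * \<sigma>) * A" if \<sigma>: "0 < \<sigma>" "\<sigma> \<le> 1" for \<sigma>
    proof -
      define Y where "Y = (\<integral>\<^sup>+x. m x * ennreal (dot n x x ^ k * exp (- \<sigma> * dot n x x)) \<partial>gauss n)"
      have sum: "X \<sigma> + Y = A"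
        unfolding X_def Y_def A_def
      proof (subst nn_integral_add[symmetric], goal_cases)
        case 3
        have "m x * ennreal (dot n x x ^ k * (1 - exp (- \<sigma> * dot n x x))) + m x * ennreal (dot n x x ^ k * exp (- \<sigma> * dot n x x))
          = m x * ennreal (dot n x x ^ k)" for x
        proof -
          have "0 \<le> \<sigma> * dot n x x" using \<sigma> by simp
          then have "ennreal (dot n x x ^ k * (1 - exp (- \<sigma> * dot n x x))) + ennreal (dot n x x ^ k * exp (- \<sigma> * dot n x x))
              = ennreal (dot n x x ^ k)"
            by (subst ennreal_plus[symmetric]) (auto simp: right_diff_distrib intro!: mult_left_le)
          then show ?thesis by (simp only: distrib_left[symmetric])
        qed
        then show ?case by simp
      qed measurable
      have A_le: "A \<le> ennreal ((1 + \<sigma>) ^ (n + 2 * k)) * Y"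
        unfolding A_def Y_def by (rule dilation_upper_bound[OF m]) (use \<sigma> rad[of "1 + \<sigma>"] in auto)
      have fin: "X \<sigma> < \<top>" "Y < \<top>" using sum 3 by (auto simp: less_top[symmetric])
      obtain a where a: "A = ennreal a" "0 \<le> a" using 3 by (cases A) auto
      obtain x where x: "X \<sigma> = ennreal x" "0 \<le> x" using fin by (cases "X \<sigma>") auto
      obtain y where y: "Y = ennreal y" "0 \<le> y" using fin by (cases Y) auto
      have xy: "x + y = a" using sum a x y by (simp add: ennreal_plus[symmetric] del: ennreal_plus)
      have "a \<le> (1 + \<sigma>) ^ (n + 2 * k) * y"
        using A_le a y \<sigma> by (simp add: ennreal_mult[symmetric])
      then have "inverse ((1 + \<sigma>) ^ (n + 2 * k)) * a \<le> y"
        using \<sigma> by (simp add: field_simps)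
      moreover have "(1 - real (n + 2 * k) * \<sigma>) * a \<le> inverse ((1 + \<sigma>) ^ (n + 2 * k)) * a"
        by (intro mult_right_mono one_plus_power_inverse_ge \<sigma> a)
      ultimately have "x \<le> real (n + 2 * k) * \<sigma> * a"
        using xy by (simp add: algebra_simps)
      then show ?thesis
        using a x \<sigma> by (simp add: ennreal_mult[symmetric] ennreal_leI)
    qed
    define \<sigma> :: "nat \<Rightarrow> real" where "\<sigma> j = inverse (real (Suc j))" for j
    have \<sigma>: "0 < \<sigma> j" "\<sigma> j \<le> 1" for j by (simp_all add: \<sigma>_def inverse_le_1_iff)
    have lim: "\<sigma> \<longlonglongrightarrow> 0" unfolding \<sigma>_def by (rule LIMSEQ_inverse_real_of_nat)
    define f where "f j x = m x * ennreal (dot n x x ^ k * (dot n x x / (1 + \<sigma> j * dot n x x)))" for j x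
    have f_le: "(\<integral>\<^sup>+x. f j x \<partial>gauss n) \<le> ennreal (real (n + 2 * k)) * A" for j
    proof -
      have "ennreal (\<sigma> j) * (\<integral>\<^sup>+x. f j x \<partial>gauss n) = (\<integral>\<^sup>+x. ennreal (\<sigma> j) * f j x \<partial>gauss n)"
        unfolding f_def by (rule nn_integral_cmult[symmetric]) measurable
      also have "\<dots> \<le> X (\<sigma> j)"
        unfolding X_def
      proof (rule nn_integral_mono)
        fix x
        let ?r = "dot n x x"
        have t: "0 \<le> \<sigma> j * ?r" using \<sigma>(1)[of j] by simp
        \<comment> \<open>This replaces the difference quotient (1 - exp (- \<sigma> r)) / \<sigma>
          by the smaller r / (1 + \<sigma> r), which is rational and tends to r as \<sigma> tends to
          0.\<close>
        have "exp (- (\<sigma> j * ?r)) \<le> 1 / (1 + \<sigma> j * ?r)"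
          using exp_ge_add_one_self[of "\<sigma> j * ?r"] t by (simp add: exp_minus field_simps)
        also have "\<dots> = 1 - \<sigma> j * (?r / (1 + \<sigma> j * ?r))"
          using t by (simp add: field_simps)
        finally have "\<sigma> j * (?r / (1 + \<sigma> j * ?r)) \<le> 1 - exp (- \<sigma> j * ?r)" by simp
        then have "?r ^ k * (\<sigma> j * (?r / (1 + \<sigma> j * ?r))) \<le> ?r ^ k * (1 - exp (- \<sigma> j * ?r))"
          by (intro mult_left_mono) auto
        moreover have "ennreal (\<sigma> j) * f j x = m x * ennreal (?r ^ k * (\<sigma> j * (?r / (1 + \<sigma> j * ?r))))"
        proof -
          have "ennreal (\<sigma> j) * f j x = m x * (ennreal (\<sigma> j) * ennreal (?r ^ k * (?r / (1 + \<sigma> j * ?r))))"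
            unfolding f_def by (rule mult.left_commute)
          also have "ennreal (\<sigma> j) * ennreal (?r ^ k * (?r / (1 + \<sigma> j * ?r))) = ennreal (\<sigma> j * (?r ^ k * (?r / (1 + \<sigma> j * ?r))))"
            using \<sigma>(1)[of j] t by (intro ennreal_mult[symmetric]) auto
          also have "\<sigma> j * (?r ^ k * (?r / (1 + \<sigma> j * ?r))) = ?r ^ k * (\<sigma> j * (?r / (1 + \<sigma> j * ?r)))"
            by (rule mult.left_commute)
          finally show ?thesis .
        qed
        ultimately show "ennreal (\<sigma> j) * f j x \<le> m x * ennreal (?r ^ k * (1 - exp (- \<sigma> j * ?r)))"
          by (auto intro!: mult_left_mono ennreal_leI)
      qed
      also have "\<dots> \<le> ennreal (\<sigma> j) * (ennreal (real (n + 2 * k)) * A)"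
        using X_le[OF \<sigma>, of j] \<sigma>(1)[of j] by (simp add: ennreal_mult mult_ac)
      finally show ?thesis
        using \<sigma>(1)[of j] by (simp add: ennreal_mult_le_mult_iff)
    qed
    have "(\<integral>\<^sup>+x. m x * ennreal (dot n x x ^ Suc k) \<partial>gauss n) = (\<integral>\<^sup>+x. liminf (\<lambda>j. f j x) \<partial>gauss n)"
    proof (rule nn_integral_cong)
      fix x
      have "(\<lambda>j. dot n x x ^ k * (dot n x x / (1 + \<sigma> j * dot n x x))) \<longlonglongrightarrow> dot n x x ^ k * (dot n x x / (1 + 0 * dot n x x))"
        by (intro tendsto_intros lim) simp
      then have "(\<lambda>j. f j x) \<longlonglongrightarrow> m x * ennreal (dot n x x ^ Suc k)"
        unfolding f_def by (intro ennreal_tendsto_cmult fin tendsto_ennrealI) (simp add: mult.commute)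
      then show "m x * ennreal (dot n x x ^ Suc k) = liminf (\<lambda>j. f j x)"
        by (simp add: lim_imp_Liminf)
    qed
    also have "\<dots> \<le> liminf (\<lambda>j. \<integral>\<^sup>+x. f j x \<partial>gauss n)"
      unfolding f_def by (rule nn_integral_liminf) measurable
    also have "\<dots> \<le> ennreal (real (n + 2 * k)) * A"
      by (rule Liminf_le, simp, rule always_eventually, rule allI, rule f_le)
    finally show ?thesis unfolding A_def .
  qed
qed

section \<open>Gaussian measure of intervals on the line\<close>

lemma antiderivative_std_normal_density:
  obtains \<Phi> :: "real \<Rightarrow> real" where "\<And>x. a < x \<Longrightarrow> x < b \<Longrightarrow> DERIV \<Phi> x :> std_normal_density x"
proof -
  have "continuous_on {a..b} std_normal_density"
    unfolding normal_density_def by (intro continuous_intros) auto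
  then obtain g where g: "\<And>x. x \<in> {a..b} \<Longrightarrow> (g has_vector_derivative std_normal_density x) (at x within {a..b})"
    by (rule antiderivative_continuous) blast
  show ?thesis
  proof (rule that[of g])
    fix x assume x: "a < x" "x < b"
    then have "(g has_vector_derivative std_normal_density x) (at x within {a<..<b})"
      by (intro has_vector_derivative_within_subset[OF g]) auto
    then show "DERIV g x :> std_normal_density x"
      unfolding has_real_derivative_iff_has_vector_derivative using x at_within_open[of x "{a<..<b}"] by simp
  qed
qed

text \<open>The shift moves the midpoint of the interval towards 0 without passing it, since
  \<kappa> \<le> 1/2. The derivative of the mass is the difference of the densities at the two ends,
  and on the way the end nearer to 0 has the larger density.\<close>

lemma gauss1_interval_shift:
  assumes "l \<le> r" and \<kappa>: "0 \<le> \<kappa>" "\<kappa> \<le> 1 / 2" and d: "d = \<kappa> * (l + r)"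
  shows "emeasure gauss1 {l..r} \<le> emeasure gauss1 {l - d..r - d}"
proof -
  \<comment> \<open>Large enough for every endpoint l - t, r - t with |t| \<le> |d| to lie strictly
    inside the interval on which an antiderivative is available.\<close>
  define R where "R = 1 + \<bar>l\<bar> + \<bar>r\<bar> + \<bar>d\<bar>"
  obtain \<Phi> where \<Phi>: "\<And>x. -R < x \<Longrightarrow> x < R \<Longrightarrow> DERIV \<Phi> x :> std_normal_density x"
    using antiderivative_std_normal_density by blast
  have em: "emeasure gauss1 {u..w} = ennreal (\<Phi> w - \<Phi> u)" if "u \<le> w" "-R < u" "w < R" for u w
  proof -
    have "emeasure gauss1 {u..w} = (\<integral>\<^sup>+x. ennreal (std_normal_density x) * indicator {u..w} x \<partial>lborel)"
      by (rule emeasure_density) auto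
    also have "\<dots> = ennreal (\<Phi> w - \<Phi> u)"
      by (rule nn_integral_FTC_Icc) (use that in \<open>auto intro!: \<Phi>\<close>)
    finally show ?thesis .
  qed
  define H where "H t = \<Phi> (r - t) - \<Phi> (l - t)" for t
  have dH: "DERIV H t :> std_normal_density (l - t) - std_normal_density (r - t)" if "\<bar>t\<bar> \<le> \<bar>d\<bar>" for t
  proof -
    have 1: "DERIV \<Phi> (r - t) :> std_normal_density (r - t)" "DERIV \<Phi> (l - t) :> std_normal_density (l - t)"
      using that by (auto intro!: \<Phi> simp: R_def)
    have 2: "DERIV (\<lambda>t. r - t) t :> -1" "DERIV (\<lambda>t. l - t) t :> -1"
      by (auto intro!: derivative_eq_intros)
    show ?thesis
      unfolding H_def using DERIV_diff[OF DERIV_chain2[OF 1(1) 2(1)] DERIV_chain2[OF 1(2) 2(2)]] by simp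
  qed
  have cmp: "std_normal_density (r - t) \<le> std_normal_density (l - t)" if "2 * t \<le> l + r" for t
  proof -
    have "0 \<le> (r - l) * (l + r - 2 * t)" using that assms(1) by simp
    then have "(l - t)\<^sup>2 \<le> (r - t)\<^sup>2" by (simp add: power2_eq_square algebra_simps)
    then show ?thesis by (simp add: normal_density_def divide_right_mono)
  qed
  have cmp': "std_normal_density (l - t) \<le> std_normal_density (r - t)" if "l + r \<le> 2 * t" for t
  proof -
    have "0 \<le> (r - l) * (2 * t - (l + r))" using that assms(1) by simp
    then have "(r - t)\<^sup>2 \<le> (l - t)\<^sup>2" by (simp add: power2_eq_square algebra_simps)
    then show ?thesis by (simp add: normal_density_def divide_right_mono)
  qed
  have "H 0 \<le> H d"
  proof (cases "0 \<le> l + r")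
    case True
    then have d2: "0 \<le> d" "2 * d \<le> l + r"
      unfolding d using \<kappa> mult_right_mono[OF \<kappa>(2) True] by auto
    show ?thesis
      by (rule DERIV_nonneg_imp_nondecreasing[OF d2(1)]) (use dH cmp d2 in force)
  next
    case False
    then have d2: "d \<le> 0" "l + r \<le> 2 * d"
      unfolding d using \<kappa> mult_right_mono_neg[OF \<kappa>(2), of "l + r"] by (auto simp: mult_nonneg_nonpos)
    show ?thesis
      by (rule DERIV_nonpos_imp_nonincreasing[OF d2(1)]) (use dH cmp' d2 in force)
  qed
  then show ?thesis
    using assms(1) by (subst (1 2) em) (auto simp: R_def H_def intro!: ennreal_leI)
qed

lemma emeasure_gauss1_Icc_diff_Ioo: "l \<le> r \<Longrightarrow> emeasure gauss1 {l..r} = emeasure gauss1 {l<..<r}"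
proof -
  have "AE x in gauss1. x \<notin> {l, r}"
    unfolding AE_gauss1_iff by (rule AE_not_in) (rule finite_imp_null_set_lborel, simp)
  then have "AE x in gauss1. x \<in> {l..r} \<longleftrightarrow> x \<in> {l<..<r}"
    by eventually_elim auto
  then show ?thesis by (intro emeasure_eq_AE) auto
qed

text \<open>A convex set of reals is the intersection of an upward closed and a downward closed set,
  and monotone indicators are Borel. Hence line sections of a convex set are Borel even when the set
  itself is not.\<close>

lemma convex_real_borel:
  fixes A :: "real set"
  assumes "convex A"
  shows "A \<in> sets borel"
proof -
  let ?U = "{x. \<exists>a\<in>A. a \<le> x}" and ?D = "{x. \<exists>b\<in>A. x \<le> b}"
  have int: "is_interval A" using assms by (simp add: is_interval_convex_1)
  have eq: "A = ?U \<inter> - (- ?D)"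
    using int unfolding is_interval_1 by auto
  have "(indicator ?U :: real \<Rightarrow> real) \<in> borel_measurable borel"
    by (rule borel_measurable_mono) (auto simp: mono_def indicator_def intro: order_trans)
  then have U: "?U \<in> sets borel" by (simp add: borel_measurable_indicator_iff)
  have "(indicator (- ?D) :: real \<Rightarrow> real) \<in> borel_measurable borel"
    by (rule borel_measurable_mono) (auto simp: mono_def indicator_def intro: order_trans)
  then have D: "- ?D \<in> sets borel" by (simp add: borel_measurable_indicator_iff)
  show ?thesis by (subst eq) (intro sets.Int borel_comp U D)
qed

text \<open>The combinations in the last hypothesis fill the interval \<open>A\<close> shifted
  towards 0 by (1 - q) / 2 times the sum of its ends, so the previous comparison of intervals
  applies. Unbounded \<open>A\<close> is exhausted by bounded pieces, each an interval up to its
  endpoints.\<close>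

lemma gauss1_symmetrized_interval:
  assumes A: "convex A" and A': "A' \<in> sets borel" and q: "0 \<le> q" "q \<le> 1"
    and sub: "\<And>a b. a \<in> A \<Longrightarrow> b \<in> A \<Longrightarrow> (1 + q) / 2 * a - (1 - q) / 2 * b \<in> A'"
  shows "emeasure gauss1 A \<le> emeasure gauss1 A'"
proof -
  define B where "B k = A \<inter> {- real k..real k}" for k
  have cB: "convex (B k)" for k unfolding B_def by (intro convex_Int A convex_real_interval)
  have mB: "B k \<in> sets borel" for k by (rule convex_real_borel[OF cB])
  have le: "emeasure gauss1 (B k) \<le> emeasure gauss1 A'" for k
  proof (cases "B k = {}")
    case False
    define l where "l = Inf (B k)"
    define r where "r = Sup (B k)"
    have bdd: "bdd_below (B k)" "bdd_above (B k)" by (auto simp: B_def)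
    have sub1: "B k \<subseteq> {l..r}"
      using bdd by (auto simp: l_def r_def intro: cInf_lower cSup_upper)
    have lr: "l \<le> r" using sub1 False by fastforce
    have sub2: "{l<..<r} \<subseteq> B k"
    proof
      fix x assume "x \<in> {l<..<r}"
      then obtain a b where "a \<in> B k" "a < x" "b \<in> B k" "x < b"
        using False bdd by (auto simp: l_def r_def cInf_less_iff less_cSup_iff)
      moreover have "is_interval (B k)" using cB by (simp add: is_interval_convex_1)
      ultimately show "x \<in> B k" by (meson is_interval_1 less_imp_le)
    qed
    define \<kappa> where "\<kappa> = (1 - q) / 2"
    define d where "d = \<kappa> * (l + r)"
    have "{l - d<..<r - d} \<subseteq> A'"
    proof
      fix x assume x: "x \<in> {l - d<..<r - d}"
      \<comment> \<open>Each point is paired with its reflection at the midpoint; this choice makes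
        the combination equal to the point shifted back by d.\<close>
      have "x + d \<in> A" "l + r - (x + d) \<in> A"
        using x sub2 by (auto simp: B_def)
      from sub[OF this] have "(1 + q) / 2 * (x + d) - (1 - q) / 2 * (l + r - (x + d)) \<in> A'" .
      moreover have "(1 + q) / 2 * (x + d) - (1 - q) / 2 * (l + r - (x + d)) = x"
        by (simp add: d_def \<kappa>_def field_simps)
      ultimately show "x \<in> A'" by simp
    qed
    then have 1: "emeasure gauss1 {l - d<..<r - d} \<le> emeasure gauss1 A'"
      by (intro emeasure_mono) (simp_all add: A')
    have 2: "emeasure gauss1 (B k) \<le> emeasure gauss1 {l..r}"
      by (intro emeasure_mono sub1) simp
    have 3: "emeasure gauss1 {l..r} \<le> emeasure gauss1 {l - d..r - d}"
      by (rule gauss1_interval_shift[OF lr _ _ d_def]) (use q in \<open>auto simp: \<kappa>_def\<close>)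
    have 4: "emeasure gauss1 {l - d..r - d} = emeasure gauss1 {l - d<..<r - d}"
      using lr by (intro emeasure_gauss1_Icc_diff_Ioo) simp
    show ?thesis using order_trans[OF 2 order_trans[OF 3[unfolded 4] 1]] .
  qed simp
  have "A = (\<Union>k. B k)"
  proof -
    have "\<exists>k::nat. - real k \<le> x \<and> x \<le> real k" for x :: real
      using real_arch_simple[of "\<bar>x\<bar>"] by (metis abs_le_iff minus_le_iff)
    then show ?thesis by (auto simp: B_def)
  qed
  moreover have "incseq B" by (auto simp: incseq_def B_def)
  moreover have "range B \<subseteq> sets gauss1" using mB by auto
  ultimately have "emeasure gauss1 A = (SUP k. emeasure gauss1 (B k))"
    using SUP_emeasure_incseq[of B gauss1] by simp
  also have "\<dots> \<le> emeasure gauss1 A'" by (rule SUP_least) (rule le)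
  finally show ?thesis .
qed

section \<open>Symmetric convex bodies\<close>

lemma convex_inD:
  "convex_in n K \<Longrightarrow> x \<in> K \<Longrightarrow> y \<in> K \<Longrightarrow> 0 \<le> u \<Longrightarrow> 0 \<le> v \<Longrightarrow> u + v = 1 \<Longrightarrow> lin n u x v y \<in> K"
  unfolding convex_in_def lin_def by blast

lemma convex_in_space: "convex_in n K \<Longrightarrow> x \<in> K \<Longrightarrow> x \<in> {..<n} \<rightarrow>\<^sub>E UNIV"
  unfolding convex_in_def by blast

text \<open>A convex set need not be Borel, so it is accompanied by a Borel set \<open>L'\<close> equal to it almost everywhere.\<close>

definition symmetric_body :: "nat \<Rightarrow> (nat \<Rightarrow> real) set \<Rightarrow> (nat \<Rightarrow> real) set \<Rightarrow> bool" where
  "symmetric_body n L L' \<longleftrightarrow> convex_in n L \<and> (\<forall>y\<in>L. lin n (-1) y 0 y \<in> L) \<and>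
     L' \<in> sets (lborel_pow n) \<and> (AE y in lborel_pow n. y \<in> L \<longleftrightarrow> y \<in> L')"

lemma AE_lborel_pow_scale:
  assumes "c \<noteq> 0" "AE x in lborel_pow n. P x"
  shows "AE x in lborel_pow n. P (lin n c x 0 x)"
proof -
  let ?o = "\<lambda>i\<in>{..<n}. 0 :: real"
  have "lin n c x 0 x = lin n c x 1 ?o" for x by (simp add: lin_eq_iff)
  then show ?thesis using AE_lborel_pow_affine[OF assms(1) _ assms(2), of ?o] by simp
qed

text \<open>q * y is the convex combination of y and -y with weights (1 + q) / 2 and (1 - q) /
  2.\<close>

lemma symmetric_body_contract:
  assumes "symmetric_body n L L'" "y \<in> L" "0 \<le> q" "q \<le> 1"
  shows "lin n q y 0 y \<in> L"
proof -
  have "lin n ((1 + q) / 2) y ((1 - q) / 2) (lin n (-1) y 0 y) \<in> L"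
    using assms by (rule_tac convex_inD[of n L]) (auto simp: symmetric_body_def add_divide_distrib[symmetric])
  moreover have "lin n ((1 + q) / 2) y ((1 - q) / 2) (lin n (-1) y 0 y) = lin n q y 0 y"
    by (simp add: lin_eq_iff field_simps)
  ultimately show ?thesis by simp
qed

lemma symmetric_body_radial:
  assumes L: "symmetric_body n L L'" and s: "1 < s"
  shows "AE x in lborel_pow n. (indicator L' x :: ennreal) \<le> indicator L' (lin n (1 / s) x 0 x)"
proof -
  have AE: "AE y in lborel_pow n. y \<in> L \<longleftrightarrow> y \<in> L'" using L by (simp add: symmetric_body_def)
  have "AE x in lborel_pow n. lin n (1 / s) x 0 x \<in> L \<longleftrightarrow> lin n (1 / s) x 0 x \<in> L'"
    by (rule AE_lborel_pow_scale[OF _ AE]) (use s in simp)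
  with AE show ?thesis
  proof eventually_elim
    case (elim x)
    then show ?case
      using symmetric_body_contract[OF L, of x "1 / s"] s by (auto simp: indicator_def)
  qed
qed

lemma symmetric_body_moment:
  assumes L: "symmetric_body n L L'"
  shows "(\<integral>\<^sup>+y. indicator L' y * ennreal (dot n y y ^ Suc k) \<partial>gauss n) \<le>
    ennreal (real (n + 2 * k)) * (\<integral>\<^sup>+y. indicator L' y * ennreal (dot n y y ^ k) \<partial>gauss n)"
proof (rule radial_moment)
  show "indicator L' \<in> borel_measurable (lborel_pow n)"
    using L unfolding symmetric_body_def by (intro borel_measurable_indicator) blast
qed (use symmetric_body_radial[OF L] in \<open>auto simp: indicator_def less_top[symmetric]\<close>)

text \<open>The exceptional null set stays null under the measure-preserving swap, and Fubini then
  makes it null on almost every line parallel to \<open>v\<close>. This allows slices of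
  \<open>L'\<close> to be measured as the intervals cut out of \<open>L\<close>.\<close>

lemma symmetric_body_slices_AE:
  assumes L: "symmetric_body n L L'" and v: "dot n v v = 1" "v \<in> {..<n} \<rightarrow>\<^sub>E UNIV"
  shows "AE g in lborel_pow n. AE h in lborel.
    lin n 1 g (h - dot n v g) v \<in> L \<longleftrightarrow> lin n 1 g (h - dot n v g) v \<in> L'"
proof -
  interpret G1: prob_space gauss1 by (rule prob_space_gauss1)
  have AE: "AE y in lborel_pow n. y \<in> L \<longleftrightarrow> y \<in> L'" using L by (simp add: symmetric_body_def)
  have [measurable]: "v \<in> space (lborel_pow n)" using v by simp
  obtain N where N: "{x \<in> space (lborel_pow n). \<not> (x \<in> L \<longleftrightarrow> x \<in> L')} \<subseteq> N" "emeasure (lborel_pow n) N = 0"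
    and [measurable]: "N \<in> sets (lborel_pow n)"
    using AE by (rule AE_E)
  have N': "(y \<in> L \<longleftrightarrow> y \<in> L')" if "y \<notin> N" "y \<in> {..<n} \<rightarrow>\<^sub>E UNIV" for y
    using N(1) that by auto
  have "AE y in lborel_pow n. y \<notin> N" using N(2) by (intro AE_not_in) (auto simp: null_sets_def)
  then have "AE y in gauss n. y \<notin> N" by (simp add: AE_gauss_iff)
  then have "(\<integral>\<^sup>+y. \<integral>\<^sup>+h. indicator N y \<partial>gauss1 \<partial>gauss n) = 0"
    by (subst nn_integral_0_iff_AE) (auto elim!: eventually_mono)
  then have "(\<integral>\<^sup>+g. \<integral>\<^sup>+h. indicator N (lin n 1 g (h - dot n v g) v) \<partial>gauss1 \<partial>gauss n) = 0"
    by (subst nn_integral_gauss_swap[OF v, of "\<lambda>y h. indicator N y"]) simp_all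
  then have "AE g in gauss n. (\<integral>\<^sup>+h. indicator N (lin n 1 g (h - dot n v g) v) \<partial>gauss1) = 0"
    by (subst (asm) nn_integral_0_iff_AE) simp_all
  then have "AE g in lborel_pow n. (\<integral>\<^sup>+h. indicator N (lin n 1 g (h - dot n v g) v) \<partial>gauss1) = 0"
    by (simp add: AE_gauss_iff)
  then show ?thesis
    using AE_space
  proof eventually_elim
    case (elim g)
    then have [measurable]: "g \<in> space (lborel_pow n)" by simp
    have "AE h in gauss1. indicator N (lin n 1 g (h - dot n v g) v) = (0::ennreal)"
      using elim(1) by (subst (asm) nn_integral_0_iff_AE) simp_all
    then have "AE h in lborel. indicator N (lin n 1 g (h - dot n v g) v) = (0::ennreal)"
      by (simp only: AE_gauss1_iff)
    then show ?case
      by eventually_elim (rule N', auto simp: indicator_eq_0_iff)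
  qed
qed

text \<open>
  Slices of a symmetric convex body along a direction \<open>v\<close> have radially decreasing Gaussian measure,
  so the components orthogonal to \<open>v\<close> contribute at most \<open>n - 1\<close> to the second moment.
\<close>

lemma symmetric_body_slice_radial:
  assumes L: "symmetric_body n L L'" and v: "dot n v v = 1" "v \<in> {..<n} \<rightarrow>\<^sub>E UNIV" and s: "1 < s"
    and m: "m = (\<lambda>g. \<integral>\<^sup>+h. indicator L' (lin n 1 g (h - dot n v g) v) \<partial>gauss1)"
  shows "AE g in lborel_pow n. m g \<le> m (lin n (1 / s) g 0 g)"
proof -
  define q where "q = 1 / s"
  have q: "0 \<le> q" "q \<le> 1" "q \<noteq> 0" using s by (auto simp: q_def)
  define pi where "pi g h = lin n 1 g (h - dot n v g) v" for g h
  have cL: "convex_in n L" and sL: "\<And>y. y \<in> L \<Longrightarrow> lin n (-1) y 0 y \<in> L"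
    using L by (auto simp: symmetric_body_def)
  have [measurable]: "L' \<in> sets (lborel_pow n)" using L by (simp add: symmetric_body_def)
  have conv: "convex {h. pi g h \<in> L}" for g
    unfolding convex_def
  proof (safe, goal_cases)
    case (1 a b u w)
    have "lin n u (pi g a) w (pi g b) \<in> L" using 1 by (intro convex_inD[OF cL]) auto
    moreover have "lin n u (pi g a) w (pi g b) = pi g (u *\<^sub>R a + w *\<^sub>R b)"
      unfolding pi_def
    proof (unfold lin_eq_iff, safe)
      fix i assume "i < n"
      have w: "w = 1 - u" using 1 by simp
      show "u * lin n 1 g (a - dot n v g) v i + w * lin n 1 g (b - dot n v g) v i
          = 1 * g i + (u *\<^sub>R a + w *\<^sub>R b - dot n v g) * v i"
        using \<open>i < n\<close> by (simp add: w algebra_simps)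
    qed
    ultimately show ?case by simp
  qed
  \<comment> \<open>Combining a point over \<open>g\<close> with the reflection of another point
    over \<open>g\<close>, with weights (1 + q) / 2 and (1 - q) / 2, gives a point over q * g. The
    heights along \<open>v\<close> combine as \<open>gauss1_symmetrized_interval\<close>
    requires.\<close>
  have sym: "(1 + q) / 2 * a - (1 - q) / 2 * b \<in> {h. pi (lin n q g 0 g) h \<in> L}"
    if "a \<in> {h. pi g h \<in> L}" "b \<in> {h. pi g h \<in> L}" for g a b
  proof -
    have "lin n ((1 + q) / 2) (pi g a) ((1 - q) / 2) (lin n (-1) (pi g b) 0 (pi g b)) \<in> L"
      using that q by (intro convex_inD[OF cL] sL) (auto simp: field_simps)
    moreover have "lin n ((1 + q) / 2) (pi g a) ((1 - q) / 2) (lin n (-1) (pi g b) 0 (pi g b)) =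
        pi (lin n q g 0 g) ((1 + q) / 2 * a - (1 - q) / 2 * b)"
      unfolding pi_def by (simp add: lin_eq_iff field_simps)
    ultimately show ?thesis by simp
  qed
  have m_eq: "m g = emeasure gauss1 {h. pi g h \<in> L}"
    if g: "g \<in> space (lborel_pow n)" and ae: "AE h in lborel. pi g h \<in> L \<longleftrightarrow> pi g h \<in> L'" for g
  proof -
    have "m g = (\<integral>\<^sup>+h. indicator {h. pi g h \<in> L} h \<partial>gauss1)"
      unfolding m pi_def[symmetric]
    proof (rule nn_integral_cong_AE)
      have "AE h in gauss1. pi g h \<in> L \<longleftrightarrow> pi g h \<in> L'"
        using ae by (simp only: AE_gauss1_iff)
      then show "AE h in gauss1. (indicator L' (pi g h) :: ennreal) = indicator {h. pi g h \<in> L} h"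
        by eventually_elim (simp add: indicator_def)
    qed
    also have "\<dots> = emeasure gauss1 {h. pi g h \<in> L}"
      by (rule nn_integral_indicator) (simp add: convex_real_borel[OF conv])
    finally show ?thesis .
  qed
  have ae: "AE g in lborel_pow n. AE h in lborel. pi g h \<in> L \<longleftrightarrow> pi g h \<in> L'"
    unfolding pi_def by (rule symmetric_body_slices_AE[OF L v])
  moreover have "AE g in lborel_pow n. AE h in lborel. pi (lin n q g 0 g) h \<in> L \<longleftrightarrow> pi (lin n q g 0 g) h \<in> L'"
    by (rule AE_lborel_pow_scale[OF q(3) ae])
  ultimately show ?thesis
    using AE_space unfolding q_def[symmetric]
  proof eventually_elim
    case (elim g)
    have "emeasure gauss1 {h. pi g h \<in> L} \<le> emeasure gauss1 {h. pi (lin n q g 0 g) h \<in> L}"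
      by (rule gauss1_symmetrized_interval[OF conv convex_real_borel[OF conv] q(1,2) sym])
    then show ?case
      using m_eq[OF elim(3,1)] m_eq[OF _ elim(2)] by simp
  qed
qed

text \<open>The moment bound is applied in all n dimensions to the slice measure m, which depends
  only on the part of g orthogonal to \<open>v\<close>. After the swap that part is the one of y,
  while <v, g> has become an independent standard normal variable of second moment 1; this is the
  summand 1 on the left.\<close>

lemma symmetric_body_slab:
  assumes L: "symmetric_body n L L'" and v: "dot n v v = 1" "v \<in> {..<n} \<rightarrow>\<^sub>E UNIV"
  shows "(\<integral>\<^sup>+y. indicator L' y * ennreal (dot n y y - (dot n v y)\<^sup>2 + 1) \<partial>gauss n) \<le>
    ennreal (real n) * (\<integral>\<^sup>+y. indicator L' y \<partial>gauss n)"
proof -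
  interpret G1: prob_space gauss1 by (rule prob_space_gauss1)
  have [measurable]: "L' \<in> sets (lborel_pow n)" using L by (simp add: symmetric_body_def)
  have [measurable]: "v \<in> space (lborel_pow n)" using v by simp
  define m where "m = (\<lambda>g. \<integral>\<^sup>+h. indicator L' (lin n 1 g (h - dot n v g) v) \<partial>gauss1 :: ennreal)"
  have [measurable]: "m \<in> borel_measurable (lborel_pow n)" unfolding m_def by measurable
  have "m g < \<top>" for g
  proof -
    have "m g \<le> (\<integral>\<^sup>+h. 1 \<partial>gauss1)" unfolding m_def by (intro nn_integral_mono) (auto simp: indicator_def)
    also have "\<dots> = 1" using G1.emeasure_space_1 by simp
    finally show ?thesis by (simp add: order_le_less_trans)
  qed
  then have "(\<integral>\<^sup>+x. m x * ennreal (dot n x x ^ Suc 0) \<partial>gauss n) \<le>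
      ennreal (real (n + 2 * 0)) * (\<integral>\<^sup>+x. m x * ennreal (dot n x x ^ 0) \<partial>gauss n)"
    using symmetric_body_slice_radial[OF L v _ m_def] by (intro radial_moment) auto
  then have le: "(\<integral>\<^sup>+g. m g * ennreal (dot n g g) \<partial>gauss n) \<le> ennreal (real n) * (\<integral>\<^sup>+g. m g \<partial>gauss n)"
    by simp
  have m_int: "(\<integral>\<^sup>+g. m g \<partial>gauss n) = (\<integral>\<^sup>+y. indicator L' y \<partial>gauss n)"
    unfolding m_def
    by (subst nn_integral_gauss_swap[OF v, of "\<lambda>y h. indicator L' y"])
      (use G1.emeasure_space_1 in simp_all)
  have CS: "(dot n v y)\<^sup>2 \<le> dot n y y" for y
    using dot_Cauchy_Schwarz[of n v y] v by simp
  let ?F = "\<lambda>y h. indicator L' y * ennreal (dot n y y - (dot n v y)\<^sup>2 + h\<^sup>2)"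
  have "(\<integral>\<^sup>+g. m g * ennreal (dot n g g) \<partial>gauss n) =
      (\<integral>\<^sup>+g. \<integral>\<^sup>+h. ?F (lin n 1 g (h - dot n v g) v) (- dot n v g) \<partial>gauss1 \<partial>gauss n)"
  proof (rule nn_integral_cong)
    fix g assume "g \<in> space (gauss n)"
    then have [measurable]: "g \<in> space (lborel_pow n)" by simp
    have E: "dot n (lin n 1 g (h - dot n v g) v) (lin n 1 g (h - dot n v g) v) -
        (dot n v (lin n 1 g (h - dot n v g) v))\<^sup>2 + (- dot n v g)\<^sup>2 = dot n g g" for h
      using v by (simp add: dot_commute[of n g v] power2_eq_square algebra_simps)
    show "m g * ennreal (dot n g g) = (\<integral>\<^sup>+h. ?F (lin n 1 g (h - dot n v g) v) (- dot n v g) \<partial>gauss1)"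
      unfolding m_def E by (rule nn_integral_multc[symmetric]) measurable
  qed
  also have "\<dots> = (\<integral>\<^sup>+y. \<integral>\<^sup>+h. ?F y h \<partial>gauss1 \<partial>gauss n)"
    by (rule nn_integral_gauss_swap[OF v]) measurable
  also have "\<dots> = (\<integral>\<^sup>+y. indicator L' y * ennreal (dot n y y - (dot n v y)\<^sup>2 + 1) \<partial>gauss n)"
  proof (rule nn_integral_cong)
    fix y
    have "(\<integral>\<^sup>+h. ?F y h \<partial>gauss1) = indicator L' y * (\<integral>\<^sup>+h. ennreal (dot n y y - (dot n v y)\<^sup>2) + ennreal (h\<^sup>2) \<partial>gauss1)"
      using CS[of y] by (subst nn_integral_cmult[symmetric]) (simp_all flip: ennreal_plus)
    also have "(\<integral>\<^sup>+h. ennreal (dot n y y - (dot n v y)\<^sup>2) + ennreal (h\<^sup>2) \<partial>gauss1) = ennreal (dot n y y - (dot n v y)\<^sup>2) + 1"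
      using G1.emeasure_space_1 nn_integral_gauss1_square by (subst nn_integral_add) simp_all
    also have "\<dots> = ennreal (dot n y y - (dot n v y)\<^sup>2 + 1)"
      using CS[of y] by (simp flip: ennreal_1 ennreal_plus)
    finally show "(\<integral>\<^sup>+h. ?F y h \<partial>gauss1) = indicator L' y * ennreal (dot n y y - (dot n v y)\<^sup>2 + 1)" .
  qed
  finally show ?thesis using le m_int by simp
qed

section \<open>Separation of a point from a convex set\<close>

lemma compact_box:
  fixes C :: "'a \<Rightarrow> real set"
  assumes "\<And>i. compact (C i)"
  shows "compact {f. \<forall>i. f i \<in> C i}"
proof -
  have "compactin (product_topology (\<lambda>i. euclidean) UNIV) (PiE UNIV C)"
    unfolding compactin_PiE using assms by simp
  then show ?thesis
    by (simp add: euclidean_product_topology PiE_UNIV_domain Pi_def)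
qed

lemma convex_in_finite_combination:
  assumes K: "convex_in n K" and "finite F" "F \<noteq> {}" "F \<subseteq> K" "\<And>k. k \<in> F \<Longrightarrow> 0 \<le> c k" "(\<Sum>k\<in>F. c k) = 1"
  shows "(\<lambda>i\<in>{..<n}. \<Sum>k\<in>F. c k * k i) \<in> K"
  using assms(2-)
proof (induction F arbitrary: c rule: finite_ne_induct)
  case (singleton a)
  then have "a \<in> {..<n} \<rightarrow>\<^sub>E UNIV" using convex_in_space[OF K] by auto
  then have "(\<lambda>i\<in>{..<n}. \<Sum>k\<in>{a}. c k * k i) = a"
    using singleton by (auto simp: fun_eq_iff restrict_def PiE_def extensional_def)
  then show ?case using singleton by simp
next
  case (insert a F)
  have a: "a \<in> K" "a \<in> {..<n} \<rightarrow>\<^sub>E UNIV" using insert convex_in_space[OF K] by auto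
  have sum: "c a + (\<Sum>k\<in>F. c k) = 1" using insert by simp
  show ?case
  proof (cases "c a = 1")
    case True
    then have "(\<Sum>k\<in>F. c k) = 0" using sum by simp
    then have "\<forall>k\<in>F. c k = 0" using insert by (subst (asm) sum_nonneg_eq_0_iff) auto
    then have "(\<lambda>i\<in>{..<n}. \<Sum>k\<in>insert a F. c k * k i) = a"
      using insert True a(2) by (auto simp: fun_eq_iff restrict_def PiE_def extensional_def)
    then show ?thesis using a by simp
  next
    case False
    have "0 \<le> (\<Sum>k\<in>F. c k)" using insert by (intro sum_nonneg) auto
    then have c1: "1 - c a > 0" using sum False by linarith
    let ?y = "\<lambda>i\<in>{..<n}. \<Sum>k\<in>F. c k / (1 - c a) * k i"
    have "?y \<in> K"
    proof (rule insert.IH)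
      show "(\<Sum>k\<in>F. c k / (1 - c a)) = 1"
        using sum c1 by (simp flip: sum_divide_distrib add: field_simps)
    qed (use insert c1 in auto)
    then have "lin n (c a) a (1 - c a) ?y \<in> K"
      using a insert c1 by (rule_tac convex_inD[OF K]) auto
    moreover have "lin n (c a) a (1 - c a) ?y = (\<lambda>i\<in>{..<n}. \<Sum>k\<in>insert a F. c k * k i)"
      using insert c1 by (auto simp: lin_def fun_eq_iff restrict_def sum_distrib_left)
    ultimately show ?thesis by (simp only:)
  qed
qed

text \<open>First-order optimality: the derivative of a quadratic is nonnegative at a minimum at the
  left end of an interval.\<close>

lemma quadratic_nonneg_imp:
  fixes b d :: real
  assumes "\<And>t. 0 < t \<Longrightarrow> t \<le> 1 \<Longrightarrow> 0 \<le> 2 * b + t * d" and "0 \<le> d"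
  shows "0 \<le> b"
proof (rule ccontr)
  assume "\<not> 0 \<le> b"
  then have b: "b < 0" by simp
  define t where "t = min 1 (- b / (d + 1))"
  have t: "0 < t" "t \<le> 1" using b assms(2) by (auto simp: t_def divide_neg_pos)
  have "t * d \<le> (- b / (d + 1)) * d" using assms(2) by (intro mult_right_mono) (auto simp: t_def)
  also have "\<dots> \<le> - b" using b assms(2) by (simp add: field_simps)
  finally show False using assms(1)[OF t] b by linarith
qed

text \<open>The hull of a finite set is compact, so it has a point nearest to \<open>w\<close>, at
  positive distance because \<open>w\<close> is outside the convex set; the normalised difference is
  the normal vector. For \<open>K\<close> itself the distance could be 0, as \<open>K\<close> need
  not be closed.\<close>

lemma separation_finite:
  assumes K: "convex_in n K" and w: "w \<in> {..<n} \<rightarrow>\<^sub>E UNIV" "w \<notin> K" and F: "finite F" "F \<noteq> {}" "F \<subseteq> K"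
  shows "\<exists>v. (\<forall>i\<ge>n. v i = 0) \<and> dot n v v = 1 \<and> (\<forall>k\<in>F. dot n v k \<le> dot n v w)"
proof -
  \<comment> \<open>The simplex of convex coefficients, as functions supported on \<open>F\<close>.
    Pinning the value 0 elsewhere makes it compact by Tychonoff, so the distance is minimised over
    coefficients.\<close>
  define \<Delta> where "\<Delta> = {c :: (nat \<Rightarrow> real) \<Rightarrow> real. \<forall>k. c k \<in> (if k \<in> F then {0..1} else {0})} \<inter> {c. (\<Sum>k\<in>F. c k) = 1}"
  have "closed {c :: (nat \<Rightarrow> real) \<Rightarrow> real. (\<Sum>k\<in>F. c k) = 1}"
    by (intro closed_Collect_eq continuous_intros continuous_on_product_coordinates)
  then have comp: "compact \<Delta>"
    unfolding \<Delta>_def by (intro compact_Int_closed compact_box) auto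
  obtain a where a: "a \<in> F" using F by blast
  have ne: "\<Delta> \<noteq> {}"
  proof -
    have "(\<lambda>k. if k = a then 1 else 0) \<in> \<Delta>"
      using a F by (auto simp: \<Delta>_def)
    then show ?thesis by blast
  qed
  define u where "u c i = w i - (\<Sum>k\<in>F. c k * k i)" for c i
  have "continuous_on \<Delta> (\<lambda>c. dot n (u c) (u c))"
    unfolding dot_def u_def
    by (intro continuous_intros continuous_on_subset[OF continuous_on_product_coordinates]) auto
  then obtain c where c: "c \<in> \<Delta>" and min: "\<And>c'. c' \<in> \<Delta> \<Longrightarrow> dot n (u c) (u c) \<le> dot n (u c') (u c')"
    using continuous_attains_inf[OF comp ne] by blast
  have cF: "\<And>k. k \<in> F \<Longrightarrow> 0 \<le> c k" "(\<Sum>k\<in>F. c k) = 1"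
    using c by (auto simp: \<Delta>_def split: if_splits)
  have pos: "dot n (u c) (u c) > 0"
  proof (rule ccontr)
    assume "\<not> ?thesis"
    then have "dot n (u c) (u c) = 0" using dot_nonneg[of n "u c"] by linarith
    then have "\<forall>i<n. u c i = 0"
      unfolding dot_def by (subst (asm) sum_nonneg_eq_0_iff) auto
    then have "w = (\<lambda>i\<in>{..<n}. \<Sum>k\<in>F. c k * k i)"
      using w(1) by (auto simp: u_def fun_eq_iff restrict_def PiE_def extensional_def)
    then show False using convex_in_finite_combination[OF K F cF] w(2) by simp
  qed
  have sep: "dot n (u c) k \<le> dot n (u c) w" if k: "k \<in> F" for k
  proof -
    define d where "d i = w i - k i - u c i" for i
    have "0 \<le> dot n (u c) d"
    proof (rule quadratic_nonneg_imp)
      fix t :: real assume t: "0 < t" "t \<le> 1"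
      define c' where "c' j = (1 - t) * c j + t * (if j = k then 1 else 0)" for j
      have "c' \<in> \<Delta>"
      proof -
        have "(\<Sum>j\<in>F. c' j) = (1 - t) * (\<Sum>j\<in>F. c j) + t * (\<Sum>j\<in>F. if j = k then 1 else 0)"
          by (simp add: c'_def sum.distrib sum_distrib_left)
        then have 1: "(\<Sum>j\<in>F. c' j) = 1" using cF(2) k F(1) by simp
        have 2: "0 \<le> c' j" if "j \<in> F" for j
          unfolding c'_def using t cF(1)[OF that] by (intro add_nonneg_nonneg mult_nonneg_nonneg) auto
        have 3: "c' j \<le> 1" if "j \<in> F" for j
          using member_le_sum[OF that, of c'] 1 2 F(1) by auto
        have 4: "c' j = 0" if "j \<notin> F" for j
        proof -
          have "c j = 0" using c that by (auto simp: \<Delta>_def dest: spec[of _ j])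
          then show ?thesis using that k by (auto simp: c'_def)
        qed
        show ?thesis using 1 2 3 4 by (auto simp: \<Delta>_def)
      qed
      have u': "u c' i = u c i + t * d i" for i
      proof -
        have "(\<Sum>j\<in>F. c' j * j i) = (1 - t) * (\<Sum>j\<in>F. c j * j i) + t * (\<Sum>j\<in>F. (if j = k then 1 else 0) * j i)"
          unfolding sum_distrib_left sum.distrib[symmetric] by (intro sum.cong) (auto simp: c'_def algebra_simps)
        also have "(\<Sum>j\<in>F. (if j = k then 1 else 0) * j i) = k i"
          using k F(1) by (simp add: if_distrib[of "\<lambda>x. x * _"] sum.delta cong: if_cong)
        finally show ?thesis by (simp add: u_def d_def algebra_simps)
      qed
      have "dot n (u c') (u c') = dot n (u c) (u c) + 2 * t * dot n (u c) d + t * t * dot n d d"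
        unfolding dot_def u' sum_distrib_left by (simp add: algebra_simps sum.distrib)
      then have "0 \<le> t * (2 * dot n (u c) d + t * dot n d d)"
        using min[OF \<open>c' \<in> \<Delta>\<close>] by (simp add: algebra_simps)
      then show "0 \<le> 2 * dot n (u c) d + t * dot n d d"
        using t by (simp add: zero_le_mult_iff)
    qed simp
    moreover have "dot n (u c) d = dot n (u c) w - dot n (u c) k - dot n (u c) (u c)"
      by (simp add: dot_def d_def right_diff_distrib sum_subtractf)
    ultimately show ?thesis using pos by linarith
  qed
  define N where "N = sqrt (dot n (u c) (u c))"
  have N: "N > 0" "N * N = dot n (u c) (u c)" using pos by (auto simp: N_def)
  define v where "v i = (if i < n then u c i / N else 0)" for i
  have dv: "dot n v y = dot n (u c) y / N" for y
    by (simp add: dot_def v_def sum_divide_distrib)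
  have "dot n v v = dot n v (u c) / N"
    unfolding dot_def sum_divide_distrib by (intro sum.cong) (auto simp: v_def)
  also have "\<dots> = 1" using N pos by (simp add: dv)
  finally show ?thesis
    using sep N by (intro exI[of _ v]) (auto simp: dv divide_right_mono, simp add: v_def)
qed

text \<open>Each point of \<open>K\<close> allows a closed set of unit normals, and finitely many of
  these sets meet by the finite case. Compactness of the sphere then gives a common normal. The
  inequality is not strict, since \<open>w\<close> may lie on the boundary of
  \<open>K\<close>.\<close>

lemma convex_separation:
  assumes K: "convex_in n K" "K \<noteq> {}" and w: "w \<in> {..<n} \<rightarrow>\<^sub>E UNIV" "w \<notin> K"
  obtains v where "v \<in> {..<n} \<rightarrow>\<^sub>E UNIV" "dot n v v = 1" "\<And>k. k \<in> K \<Longrightarrow> dot n v k \<le> dot n v w"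
proof -
  \<comment> \<open>The unit sphere inside all functions; the coordinates from n on are fixed to 0
    to make it compact in the product topology.\<close>
  define S where "S = {v :: nat \<Rightarrow> real. \<forall>i. v i \<in> (if i < n then {-1..1} else {0})} \<inter> {v. dot n v v = 1}"
  have "closed {v. dot n v v = 1}"
    unfolding dot_def by (intro closed_Collect_eq continuous_intros continuous_on_product_coordinates)
  then have "compact S"
    unfolding S_def by (intro compact_Int_closed compact_box) auto
  then have "S \<inter> (\<Inter>k\<in>K. {v. dot n v k \<le> dot n v w}) \<noteq> {}"
  proof (rule compact_imp_fip_image)
    fix k
    show "closed {v. dot n v k \<le> dot n v w}"
      unfolding dot_def by (intro closed_Collect_le continuous_intros continuous_on_product_coordinates)
  next
    fix F assume F: "finite F" "F \<subseteq> K"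
    obtain a where a: "a \<in> K" using K by blast
    obtain v where v: "\<forall>i\<ge>n. v i = 0" "dot n v v = 1" "\<forall>k\<in>insert a F. dot n v k \<le> dot n v w"
      using separation_finite[OF K(1) w, of "insert a F"] F a by auto
    have "v i \<in> {-1..1}" if "i < n" for i
    proof -
      have "v i * v i \<le> dot n v v"
        unfolding dot_def using that by (intro member_le_sum) auto
      then have "(v i)\<^sup>2 \<le> 1" using v(2) by (simp add: power2_eq_square)
      then show ?thesis by (simp add: abs_square_le_1 abs_le_iff)
    qed
    then have "v \<in> S" using v by (auto simp: S_def)
    then show "S \<inter> (\<Inter>k\<in>F. {v. dot n v k \<le> dot n v w}) \<noteq> {}" using v by auto
  qed
  then obtain v where v: "dot n v v = 1" "\<forall>k\<in>K. dot n v k \<le> dot n v w"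
    by (auto simp: S_def)
  have d: "dot n (restrict v {..<n}) y = dot n v y" for y by (simp add: dot_def)
  have d': "dot n v (restrict v {..<n}) = dot n v v" by (simp add: dot_def)
  show ?thesis
    by (rule that[of "restrict v {..<n}"]) (use v in \<open>auto simp: d d'\<close>)
qed

section \<open>Pairs of samples from a convex body\<close>

lemma nn_integral_gauss_Fubini:
  assumes [measurable]: "(\<lambda>(x, y). f x y) \<in> borel_measurable (lborel_pow n \<Otimes>\<^sub>M lborel_pow n)"
  shows "(\<integral>\<^sup>+x. \<integral>\<^sup>+y. f x y \<partial>gauss n \<partial>gauss n) = (\<integral>\<^sup>+y. \<integral>\<^sup>+x. f x y \<partial>gauss n \<partial>gauss n)"
proof -
  interpret prob_space "gauss n" by (rule prob_space_gauss)
  interpret pair_sigma_finite "gauss n" "gauss n" ..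
  show ?thesis using Fubini'[of f] by simp
qed

lemma nn_integral_gauss_half_rotation:
  assumes F [measurable]: "(\<lambda>(x, y). F x y) \<in> borel_measurable (lborel_pow n \<Otimes>\<^sub>M lborel_pow n)"
  shows "(\<integral>\<^sup>+x. \<integral>\<^sup>+x'. F x x' \<partial>gauss n \<partial>gauss n) =
    (\<integral>\<^sup>+z. \<integral>\<^sup>+y. F (lin n (sqrt (1 / 2)) y (sqrt (1 / 2)) z) (lin n (- sqrt (1 / 2)) y (sqrt (1 / 2)) z) \<partial>gauss n \<partial>gauss n)"
proof -
  define r :: real where "r = sqrt (1 / 2)"
  have r: "r\<^sup>2 + r\<^sup>2 = 1" "r \<noteq> -1"
  proof -
    show "r\<^sup>2 + r\<^sup>2 = 1" by (simp add: r_def)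
    have "r \<ge> 0" by (simp add: r_def)
    then show "r \<noteq> -1" by linarith
  qed
  have m: "(\<lambda>z. (lin n r (fst z) r (snd z), lin n (-r) (fst z) r (snd z)))
      \<in> lborel_pow n \<Otimes>\<^sub>M lborel_pow n \<rightarrow>\<^sub>M lborel_pow n \<Otimes>\<^sub>M lborel_pow n" by measurable
  have Fm: "(\<lambda>(x, y). F (lin n r x r y) (lin n (-r) x r y)) \<in> borel_measurable (lborel_pow n \<Otimes>\<^sub>M lborel_pow n)"
    using measurable_compose[OF m F] by (simp add: split_beta')
  have "(\<integral>\<^sup>+x. \<integral>\<^sup>+x'. F x x' \<partial>gauss n \<partial>gauss n) =
      (\<integral>\<^sup>+y. \<integral>\<^sup>+z. F (lin n r y r z) (lin n (-r) y r z) \<partial>gauss n \<partial>gauss n)"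
    by (rule nn_integral_gauss_rotation[OF r F, symmetric])
  also have "\<dots> = (\<integral>\<^sup>+z. \<integral>\<^sup>+y. F (lin n r y r z) (lin n (-r) y r z) \<partial>gauss n \<partial>gauss n)"
    by (rule nn_integral_gauss_Fubini[OF Fm])
  finally show ?thesis by (simp add: r_def)
qed

text \<open>\<open>B\<close> carries the integrals and \<open>K\<close> the convexity; removing a
  null set from a convex set may destroy convexity, so the two cannot be merged.\<close>

locale convex_body =
  fixes n :: nat and K B :: "(nat \<Rightarrow> real) set"
  assumes convex: "convex_in n K"
    and B_sets [measurable]: "B \<in> sets (lborel_pow n)"
    and B_subset: "B \<subseteq> K"
    and AE_K: "AE x in lborel_pow n. x \<in> K \<longrightarrow> x \<in> B"
    and B_pos: "0 < measure (gauss n) B"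
begin

definition p :: real where "p = measure (gauss n) B"

text \<open>The differences y that remain possible once the sum z of the pair is fixed. Replacing y
  by -y exchanges the two samples, hence the two conditions.\<close>

definition slice :: "(nat \<Rightarrow> real) set \<Rightarrow> (nat \<Rightarrow> real) \<Rightarrow> (nat \<Rightarrow> real) set" where
  "slice A z = {y \<in> {..<n} \<rightarrow>\<^sub>E UNIV. lin n (sqrt (1 / 2)) y (sqrt (1 / 2)) z \<in> A \<and>
     lin n (- sqrt (1 / 2)) y (sqrt (1 / 2)) z \<in> A}"

lemma p_pos: "0 < p" using B_pos by (simp add: p_def)

lemma p_le_1: "p \<le> 1"
proof -
  interpret prob_space "gauss n" by (rule prob_space_gauss)
  show ?thesis by (simp add: p_def)
qed

lemma nn_integral_indicator_B: "(\<integral>\<^sup>+x. indicator B x \<partial>gauss n) = ennreal p"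
proof -
  interpret prob_space "gauss n" by (rule prob_space_gauss)
  show ?thesis by (simp add: p_def emeasure_eq_measure)
qed

lemma K_nonempty: "K \<noteq> {}"
  using B_subset B_pos by (auto simp: less_le)

lemma slice_B_sets [measurable]: "z \<in> space (lborel_pow n) \<Longrightarrow> slice B z \<in> sets (lborel_pow n)"
proof -
  assume [measurable]: "z \<in> space (lborel_pow n)"
  have "{y \<in> space (lborel_pow n). lin n (sqrt (1 / 2)) y (sqrt (1 / 2)) z \<in> B \<and>
     lin n (- sqrt (1 / 2)) y (sqrt (1 / 2)) z \<in> B} \<in> sets (lborel_pow n)" by measurable
  then show ?thesis by (simp add: slice_def)
qed

lemma nn_integral_pair_slices:
  assumes F [measurable]: "(\<lambda>(x, y). F x y) \<in> borel_measurable (lborel_pow n \<Otimes>\<^sub>M lborel_pow n)"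
  shows "(\<integral>\<^sup>+x. \<integral>\<^sup>+x'. indicator B x * indicator B x' * F x x' \<partial>gauss n \<partial>gauss n) =
    (\<integral>\<^sup>+z. \<integral>\<^sup>+y. indicator (slice B z) y *
       F (lin n (sqrt (1 / 2)) y (sqrt (1 / 2)) z) (lin n (- sqrt (1 / 2)) y (sqrt (1 / 2)) z) \<partial>gauss n \<partial>gauss n)"
proof -
  have m: "(\<lambda>(x, x'). indicator B x * indicator B x' * F x x' :: ennreal) \<in> borel_measurable (lborel_pow n \<Otimes>\<^sub>M lborel_pow n)"
    by measurable
  show ?thesis
    unfolding nn_integral_gauss_half_rotation[OF m]
    by (intro nn_integral_cong) (auto simp: slice_def indicator_def)
qed

text \<open>The null set where \<open>K\<close> and \<open>B\<close> differ is charged at both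
  samples at once; the sum of the two indicators integrates to 0 before the rotation, hence also
  after it, and Fubini gives almost every z.\<close>

lemma AE_slice_symmetric_body: "AE z in gauss n. symmetric_body n (slice K z) (slice B z)"
proof -
  interpret G: prob_space "gauss n" by (rule prob_space_gauss)
  define r :: real where "r = sqrt (1 / 2)"
  have sl: "slice A z = {y \<in> {..<n} \<rightarrow>\<^sub>E UNIV. lin n r y r z \<in> A \<and> lin n (- r) y r z \<in> A}" for A z
    by (simp add: slice_def r_def)
  obtain N where N: "{x \<in> space (lborel_pow n). \<not> (x \<in> K \<longrightarrow> x \<in> B)} \<subseteq> N" "emeasure (lborel_pow n) N = 0"
    and [measurable]: "N \<in> sets (lborel_pow n)"
    using AE_K by (rule AE_E)
  have N': "(y \<in> K \<longleftrightarrow> y \<in> B)" if "y \<notin> N" "y \<in> {..<n} \<rightarrow>\<^sub>E UNIV" for y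
    using N(1) that B_subset by auto
  have "AE y in lborel_pow n. y \<notin> N" using N(2) by (intro AE_not_in) (auto simp: null_sets_def)
  then have AEN: "AE y in gauss n. y \<notin> N" by (simp add: AE_gauss_iff)
  have z0: "(\<integral>\<^sup>+x. indicator N x \<partial>gauss n) = 0"
    using AEN by (subst nn_integral_0_iff_AE) (auto elim!: eventually_mono)
  have "(\<integral>\<^sup>+x. \<integral>\<^sup>+x'. indicator N x + indicator N x' \<partial>gauss n \<partial>gauss n) = 0"
    using z0 G.emeasure_space_1 by (simp add: nn_integral_add)
  then have "(\<integral>\<^sup>+z. \<integral>\<^sup>+y. indicator N (lin n r y r z) + indicator N (lin n (-r) y r z) \<partial>gauss n \<partial>gauss n) = 0"
    unfolding r_def by (subst (asm) nn_integral_gauss_half_rotation) simp_all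
  then have "AE z in gauss n. (\<integral>\<^sup>+y. indicator N (lin n r y r z) + indicator N (lin n (-r) y r z) \<partial>gauss n) = 0"
    by (subst (asm) nn_integral_0_iff_AE) simp_all
  then show ?thesis
    using AE_space
  proof eventually_elim
    case (elim z)
    then have [measurable]: "z \<in> space (lborel_pow n)" by simp
    have "AE y in gauss n. indicator N (lin n r y r z) + indicator N (lin n (-r) y r z) = (0::ennreal)"
      using elim(1) by (subst (asm) nn_integral_0_iff_AE) simp_all
    then have "AE y in lborel_pow n. indicator N (lin n r y r z) + indicator N (lin n (-r) y r z) = (0::ennreal)"
      by (simp only: AE_gauss_iff)
    then have "AE y in lborel_pow n. y \<in> slice K z \<longleftrightarrow> y \<in> slice B z"
    proof eventually_elim
      case (elim y)
      then have "lin n r y r z \<notin> N" "lin n (-r) y r z \<notin> N" by (auto simp: indicator_def split: if_splits)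
      then show ?case unfolding sl using N'[of "lin n r y r z"] N'[of "lin n (-r) y r z"] by simp
    qed
    moreover have "convex_in n (slice K z)"
      unfolding convex_in_def
    proof (intro conjI ballI allI impI, goal_cases)
      case 1 show ?case by (auto simp: slice_def)
    next
      case (2 x y u w)
      have w: "w = 1 - u" using 2 by simp
      have "lin n u (lin n r x r z) w (lin n r y r z) \<in> K" "lin n u (lin n (-r) x r z) w (lin n (-r) y r z) \<in> K"
        using 2 unfolding sl by (auto intro: convex_inD[OF convex])
      moreover have "lin n u (lin n r x r z) w (lin n r y r z) = lin n r (lin n u x w y) r z"
        "lin n u (lin n (-r) x r z) w (lin n (-r) y r z) = lin n (-r) (lin n u x w y) r z"
        unfolding w by (simp_all add: lin_eq_iff algebra_simps)
      ultimately have "lin n u x w y \<in> slice K z" unfolding sl by simp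
      then show ?case by (simp add: lin_def)
    qed
    moreover have "lin n (-1) y 0 y \<in> slice K z" if "y \<in> slice K z" for y
    proof -
      have "lin n r (lin n (-1) y 0 y) r z = lin n (-r) y r z" "lin n (-r) (lin n (-1) y 0 y) r z = lin n r y r z"
        by (simp_all add: lin_eq_iff)
      then show ?thesis using that unfolding sl by simp
    qed
    ultimately show ?case unfolding symmetric_body_def by auto
  qed
qed

definition half_sq_dist :: "(nat \<Rightarrow> real) \<Rightarrow> (nat \<Rightarrow> real) \<Rightarrow> real" where
  "half_sq_dist x x' = dot n (lin n 1 x (-1) x') (lin n 1 x (-1) x') / 2"

lemma half_sq_dist_nonneg [simp]: "0 \<le> half_sq_dist x x'"
  by (simp add: half_sq_dist_def del: dot_lin_left dot_lin_right)

lemma measurable_half_sq_dist [measurable (raw)]: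
  assumes [measurable]: "f \<in> M \<rightarrow>\<^sub>M lborel_pow n" "g \<in> M \<rightarrow>\<^sub>M lborel_pow n"
  shows "(\<lambda>x. half_sq_dist (f x) (g x)) \<in> borel_measurable M"
  unfolding half_sq_dist_def by measurable

lemma half_sq_dist_rotation:
  "half_sq_dist (lin n (sqrt (1 / 2)) y (sqrt (1 / 2)) z) (lin n (- sqrt (1 / 2)) y (sqrt (1 / 2)) z) = dot n y y"
proof -
  define r :: real where "r = sqrt (1 / 2)"
  have r: "r * r = 1 / 2" by (simp add: r_def)
  have "lin n 1 (lin n r y r z) (-1) (lin n (-r) y r z) = lin n (2 * r) y 0 y"
    by (simp add: lin_eq_iff algebra_simps)
  then have "half_sq_dist (lin n r y r z) (lin n (-r) y r z) = 2 * (r * r) * dot n y y"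
    by (simp add: half_sq_dist_def)
  then show ?thesis by (simp add: r r_def)
qed

lemma pair_moment:
  "(\<integral>\<^sup>+x. \<integral>\<^sup>+x'. indicator B x * indicator B x' * ennreal (half_sq_dist x x' ^ Suc k) \<partial>gauss n \<partial>gauss n) \<le>
    ennreal (real (n + 2 * k)) *
    (\<integral>\<^sup>+x. \<integral>\<^sup>+x'. indicator B x * indicator B x' * ennreal (half_sq_dist x x' ^ k) \<partial>gauss n \<partial>gauss n)"
proof -
  interpret G: prob_space "gauss n" by (rule prob_space_gauss)
  have m: "(\<lambda>(z, y). indicator (slice B z) y * ennreal (dot n y y ^ j)) \<in> borel_measurable (lborel_pow n \<Otimes>\<^sub>M lborel_pow n)" for j
  proof -
    have "(\<lambda>x. indicator B (lin n (sqrt (1 / 2)) (snd x) (sqrt (1 / 2)) (fst x)) *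
        indicator B (lin n (- sqrt (1 / 2)) (snd x) (sqrt (1 / 2)) (fst x)) * ennreal (dot n (snd x) (snd x) ^ j) :: ennreal)
      \<in> borel_measurable (lborel_pow n \<Otimes>\<^sub>M lborel_pow n)" by measurable
    moreover have "(case w of (z, y) \<Rightarrow> indicator (slice B z) y * ennreal (dot n y y ^ j)) =
        indicator B (lin n (sqrt (1 / 2)) (snd w) (sqrt (1 / 2)) (fst w)) *
        indicator B (lin n (- sqrt (1 / 2)) (snd w) (sqrt (1 / 2)) (fst w)) * ennreal (dot n (snd w) (snd w) ^ j)"
      if "w \<in> space (lborel_pow n \<Otimes>\<^sub>M lborel_pow n)" for w
      using that by (cases w) (simp add: space_pair_measure slice_def indicator_def)
    ultimately show ?thesis
      by (subst measurable_cong) assumption+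
  qed
  have E: "(\<integral>\<^sup>+x. \<integral>\<^sup>+x'. indicator B x * indicator B x' * ennreal (half_sq_dist x x' ^ j) \<partial>gauss n \<partial>gauss n) =
      (\<integral>\<^sup>+z. \<integral>\<^sup>+y. indicator (slice B z) y * ennreal (dot n y y ^ j) \<partial>gauss n \<partial>gauss n)" for j
    by (subst nn_integral_pair_slices) (simp_all add: half_sq_dist_rotation)
  have "(\<integral>\<^sup>+z. \<integral>\<^sup>+y. indicator (slice B z) y * ennreal (dot n y y ^ Suc k) \<partial>gauss n \<partial>gauss n) \<le>
      (\<integral>\<^sup>+z. ennreal (real (n + 2 * k)) * (\<integral>\<^sup>+y. indicator (slice B z) y * ennreal (dot n y y ^ k) \<partial>gauss n) \<partial>gauss n)"
    using AE_slice_symmetric_body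
    by (intro nn_integral_mono_AE) (erule eventually_mono, rule symmetric_body_moment)
  also have "\<dots> = ennreal (real (n + 2 * k)) * (\<integral>\<^sup>+z. \<integral>\<^sup>+y. indicator (slice B z) y * ennreal (dot n y y ^ k) \<partial>gauss n \<partial>gauss n)"
    using m[of k] by (intro nn_integral_cmult G.borel_measurable_nn_integral) simp
  finally show ?thesis unfolding E .
qed

text \<open>Given z, both samples lie below level \<open>t\<close> along \<open>v\<close>, so |<v,
  y>| \<le> b with b = sqrt 2 * t - <v, z>. If b \<le> 1, then <v, y>^2 \<le> b and the slab bound
  applies; if b > 1, the plain moment bound n suffices. Either way the section satisfies a bound
  linear in b, so that averaging over z involves only the mean of the body.\<close>

lemma pair_slab:
  assumes v: "dot n v v = 1" "v \<in> {..<n} \<rightarrow>\<^sub>E UNIV" and t: "\<And>k. k \<in> K \<Longrightarrow> dot n v k \<le> t"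
  shows "(\<integral>\<^sup>+x. \<integral>\<^sup>+x'. indicator B x * indicator B x' * ennreal (half_sq_dist x x' + 1) \<partial>gauss n \<partial>gauss n) \<le>
    (\<integral>\<^sup>+x. \<integral>\<^sup>+x'. indicator B x * indicator B x' *
       ennreal (real n + sqrt (1 / 2) * (2 * t - dot n v x - dot n v x')) \<partial>gauss n \<partial>gauss n)"
proof -
  have [measurable]: "v \<in> space (lborel_pow n)" using v by simp
  define r :: real where "r = sqrt (1 / 2)"
  have r: "r * r = 1 / 2" "r > 0" by (simp_all add: r_def)
  have "(\<integral>\<^sup>+x. \<integral>\<^sup>+x'. indicator B x * indicator B x' * ennreal (half_sq_dist x x' + 1) \<partial>gauss n \<partial>gauss n) =
      (\<integral>\<^sup>+z. \<integral>\<^sup>+y. indicator (slice B z) y * ennreal (dot n y y + 1) \<partial>gauss n \<partial>gauss n)"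
    by (subst nn_integral_pair_slices) (simp_all add: half_sq_dist_rotation)
  also have "\<dots> \<le> (\<integral>\<^sup>+z. \<integral>\<^sup>+y. indicator (slice B z) y * ennreal (real n + (2 * r * t - dot n v z)) \<partial>gauss n \<partial>gauss n)"
  proof (rule nn_integral_mono_AE)
    show "AE z in gauss n. (\<integral>\<^sup>+y. indicator (slice B z) y * ennreal (dot n y y + 1) \<partial>gauss n) \<le>
       (\<integral>\<^sup>+y. indicator (slice B z) y * ennreal (real n + (2 * r * t - dot n v z)) \<partial>gauss n)"
      using AE_slice_symmetric_body AE_space
    proof eventually_elim
      case (elim z)
      then have [measurable]: "z \<in> space (lborel_pow n)" by simp
      define b where "b = 2 * r * t - dot n v z"
      have vy: "\<bar>dot n v y\<bar> \<le> b" if "y \<in> slice B z" for y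
      proof -
        have "dot n v (lin n r y r z) \<le> t" "dot n v (lin n (-r) y r z) \<le> t"
          using that B_subset by (auto simp: slice_def r_def simp del: dot_lin_right intro!: t)
        then have "r * (dot n v y + dot n v z) \<le> t" "r * (- dot n v y + dot n v z) \<le> t"
          by (simp_all add: algebra_simps)
        then have "2 * r * (r * (dot n v y + dot n v z)) \<le> 2 * r * t" "2 * r * (r * (- dot n v y + dot n v z)) \<le> 2 * r * t"
          using r(2) by (auto intro!: mult_left_mono)
        then have "2 * (r * r) * (dot n v y + dot n v z) \<le> 2 * r * t" "2 * (r * r) * (- dot n v y + dot n v z) \<le> 2 * r * t"
          by (simp_all add: algebra_simps)
        then show ?thesis unfolding r(1) b_def by simp
      qed
      let ?I = "indicator (slice B z) :: _ \<Rightarrow> ennreal"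
      show ?case
      proof (cases "slice B z = {}")
        case True then show ?thesis by simp
      next
        case False
        \<comment> \<open>Only a nonempty section forces b to be nonnegative, hence the separate
          empty case.\<close>
        then have b0: "0 \<le> b" using vy by fastforce
        have nb: "(\<integral>\<^sup>+y. ?I y * ennreal (real n + b) \<partial>gauss n) = ennreal (real n) * (\<integral>\<^sup>+y. ?I y \<partial>gauss n) + ennreal b * (\<integral>\<^sup>+y. ?I y \<partial>gauss n)"
        proof -
          have 1: "(\<integral>\<^sup>+y. ?I y * ennreal (real n + b) \<partial>gauss n) = (\<integral>\<^sup>+y. ?I y \<partial>gauss n) * ennreal (real n + b)"
            by (rule nn_integral_multc) measurable
          have 2: "ennreal (real n + b) = ennreal (real n) + ennreal b" using b0 by simp
          show ?thesis unfolding 1 unfolding 2 by (simp add: distrib_right mult.commute)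
        qed
        show ?thesis
        proof (cases "b \<le> 1")
          case True
          have "(\<integral>\<^sup>+y. ?I y * ennreal (dot n y y + 1) \<partial>gauss n) \<le>
              (\<integral>\<^sup>+y. ?I y * ennreal (dot n y y - (dot n v y)\<^sup>2 + 1) + ennreal b * ?I y \<partial>gauss n)"
          proof (rule nn_integral_mono)
            fix y
            show "?I y * ennreal (dot n y y + 1) \<le> ?I y * ennreal (dot n y y - (dot n v y)\<^sup>2 + 1) + ennreal b * ?I y"
            proof (cases "y \<in> slice B z")
              case y: True
              have CS: "(dot n v y)\<^sup>2 \<le> dot n y y" using dot_Cauchy_Schwarz[of n v y] v by simp
              have "(dot n v y)\<^sup>2 \<le> b\<^sup>2" using vy[OF y] by (metis abs_le_square_iff abs_of_nonneg b0)
              also have "\<dots> \<le> b" using b0 True by (simp add: power2_eq_square mult_left_le)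
              finally have "dot n y y + 1 \<le> (dot n y y - (dot n v y)\<^sup>2 + 1) + b" by simp
              then show ?thesis using y CS b0 by (simp flip: ennreal_plus add: ennreal_leI)
            qed simp
          qed
          also have "\<dots> = (\<integral>\<^sup>+y. ?I y * ennreal (dot n y y - (dot n v y)\<^sup>2 + 1) \<partial>gauss n) + ennreal b * (\<integral>\<^sup>+y. ?I y \<partial>gauss n)"
            by (subst nn_integral_add) (simp_all add: nn_integral_cmult)
          also have "\<dots> \<le> ennreal (real n) * (\<integral>\<^sup>+y. ?I y \<partial>gauss n) + ennreal b * (\<integral>\<^sup>+y. ?I y \<partial>gauss n)"
            by (intro add_right_mono symmetric_body_slab[OF elim(1) v])
          finally show ?thesis unfolding b_def[symmetric] nb .
        next
          case False
          have "(\<integral>\<^sup>+y. ?I y * ennreal (dot n y y + 1) \<partial>gauss n) =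
              (\<integral>\<^sup>+y. ?I y * ennreal (dot n y y ^ Suc 0) \<partial>gauss n) + (\<integral>\<^sup>+y. ?I y \<partial>gauss n)"
            by (subst nn_integral_add[symmetric]) (simp_all add: distrib_left)
          also have "\<dots> \<le> ennreal (real (n + 2 * 0)) * (\<integral>\<^sup>+y. ?I y * ennreal (dot n y y ^ 0) \<partial>gauss n) + ennreal b * (\<integral>\<^sup>+y. ?I y \<partial>gauss n)"
          proof (intro add_mono symmetric_body_moment[OF elim(1)])
            have "1 \<le> ennreal b" using False by simp
            then show "(\<integral>\<^sup>+y. ?I y \<partial>gauss n) \<le> ennreal b * (\<integral>\<^sup>+y. ?I y \<partial>gauss n)"
              using mult_right_mono[of 1 "ennreal b" "\<integral>\<^sup>+y. ?I y \<partial>gauss n"] by simp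
          qed
          finally have "(\<integral>\<^sup>+y. ?I y * ennreal (dot n y y + 1) \<partial>gauss n) \<le>
              ennreal (real n) * (\<integral>\<^sup>+y. ?I y \<partial>gauss n) + ennreal b * (\<integral>\<^sup>+y. ?I y \<partial>gauss n)" by simp
          then show ?thesis unfolding b_def[symmetric] nb .
        qed
      qed
    qed
  qed
  also have "\<dots> = (\<integral>\<^sup>+x. \<integral>\<^sup>+x'. indicator B x * indicator B x' *
       ennreal (real n + r * (2 * t - dot n v x - dot n v x')) \<partial>gauss n \<partial>gauss n)"
  proof -
    have "r * (2 * t - dot n v (lin n r y r z) - dot n v (lin n (-r) y r z)) = 2 * r * t - 2 * (r * r) * dot n v z" for y z
      by (simp add: algebra_simps)
    then have "r * (2 * t - dot n v (lin n r y r z) - dot n v (lin n (-r) y r z)) = 2 * r * t - dot n v z" for y z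
      by (simp add: r(1))
    then show ?thesis
      unfolding r_def by (subst nn_integral_pair_slices) (simp_all del: dot_lin_right)
  qed
  finally show ?thesis by (simp add: r_def)
qed

end

section \<open>Mean and variance deficit of a convex body\<close>

lemma integrable_gauss_norm: "integrable (gauss n) (\<lambda>x. dot n x x)"
  by (rule integrableI_nonneg) (auto simp: nn_integral_gauss_norm)

lemma integrable_gauss_norm2: "integrable (gauss n) (\<lambda>x. (dot n x x)\<^sup>2)"
proof (rule integrableI_nonneg)
  have "(\<integral>\<^sup>+x. 1 * ennreal (dot n x x ^ Suc 1) \<partial>gauss n) \<le>
      ennreal (real (n + 2 * 1)) * (\<integral>\<^sup>+x. 1 * ennreal (dot n x x ^ 1) \<partial>gauss n)"
    by (rule radial_moment) auto
  also have "\<dots> < \<infinity>" by (simp add: nn_integral_gauss_norm ennreal_mult_less_top)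
  finally show "(\<integral>\<^sup>+x. ennreal ((dot n x x)\<^sup>2) \<partial>gauss n) < \<infinity>" by (simp add: numeral_2_eq_2)
qed auto

lemma measurable_gauss_coordinate: "i < n \<Longrightarrow> (\<lambda>x. x i) \<in> borel_measurable (gauss n)"
  by (simp add: measurable_cong_sets[OF sets_gauss refl])

lemma integrable_gauss_coordinate:
  assumes "i < n"
  shows "integrable (gauss n) (\<lambda>x. x i)"
proof (rule Bochner_Integration.integrable_bound)
  interpret prob_space "gauss n" by (rule prob_space_gauss)
  show "integrable (gauss n) (\<lambda>x. 1 + dot n x x)"
    by (intro Bochner_Integration.integrable_add integrable_gauss_norm) simp
  show "(\<lambda>x. x i) \<in> borel_measurable (gauss n)" using assms by (rule measurable_gauss_coordinate)
  show "AE x in gauss n. norm (x i) \<le> norm (1 + dot n x x)"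
  proof (rule AE_I2)
    fix x :: "nat \<Rightarrow> real"
    have "x i * x i \<le> dot n x x"
      unfolding dot_def using assms by (intro member_le_sum) auto
    moreover have "2 * \<bar>x i\<bar> \<le> 1 + x i * x i"
      using zero_le_power2[of "\<bar>x i\<bar> - 1"] by (simp add: power2_eq_square algebra_simps)
    ultimately show "norm (x i) \<le> norm (1 + dot n x x)"
      using dot_nonneg[of n x] by (simp del: dot_nonneg)
  qed
qed

lemma integrable_gauss_dot: "integrable (gauss n) (\<lambda>x. dot n u x)"
  unfolding dot_def
  by (intro Bochner_Integration.integrable_sum integrable_mult_right integrable_gauss_coordinate) simp

text \<open>Needed for all x below 1 and not only near 0: the rate to which it is applied is bounded
  above but unbounded below.\<close>

lemma exp_le_quadratic:
  fixes x :: real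
  assumes "x \<le> 1"
  shows "exp x \<le> 1 + x + x\<^sup>2"
proof (cases "0 \<le> x")
  case True
  then show ?thesis using exp_bound[of x] assms by simp
next
  case False
  define y where "y = - x"
  have y: "y \<ge> 0" using False by (simp add: y_def)
  have "1 + y + y\<^sup>2 / 2 \<le> exp y" using y by (rule exp_lower_Taylor_quadratic)
  moreover have "0 < 1 + y + y\<^sup>2 / 2" using y by (simp add: add_pos_nonneg)
  ultimately have "exp (- y) \<le> 1 / (1 + y + y\<^sup>2 / 2)"
    by (simp add: exp_minus inverse_eq_divide frac_le)
  also have "\<dots> \<le> 1 - y + y\<^sup>2"
  proof -
    have "(1 - y + y\<^sup>2) * (1 + y + y\<^sup>2 / 2) = 1 + (y\<^sup>2 / 2 + y ^ 3 / 2 + y ^ 4 / 2)"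
      by (simp add: field_simps power2_eq_square power3_eq_cube power4_eq_xxxx)
    moreover have "0 \<le> y\<^sup>2 / 2 + y ^ 3 / 2 + y ^ 4 / 2" using y by simp
    ultimately show ?thesis using \<open>0 < 1 + y + y\<^sup>2 / 2\<close> by (simp add: divide_le_eq)
  qed
  finally show ?thesis by (simp add: y_def)
qed

context convex_body
begin

lemma B_Int_space: "B \<inter> ({..<n} \<rightarrow>\<^sub>E UNIV) = B"
  using sets.sets_into_space[OF B_sets] by auto

lemma integrable_indicator_B:
  fixes f :: "_ \<Rightarrow> real"
  shows "integrable (gauss n) f \<Longrightarrow> integrable (gauss n) (\<lambda>x. indicator B x * f x)"
  using integrable_mult_indicator[of B "gauss n" f] by simp

definition mean :: "nat \<Rightarrow> real" where
  "mean = (\<lambda>i\<in>{..<n}. (\<integral>x. indicator B x * x i \<partial>gauss n) / p)"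

definition second_moment :: real where
  "second_moment = (\<integral>x. indicator B x * dot n x x \<partial>gauss n) / p"

text \<open>Here \<open>second_moment - dot n mean mean\<close> is the trace of the covariance
  matrix of the Gaussian conditioned on \<open>B\<close>.\<close>

definition deficit :: real where
  "deficit = real n - second_moment + dot n mean mean"

lemma mean_space [simp]: "mean \<in> {..<n} \<rightarrow>\<^sub>E UNIV"
  by (simp add: mean_def)

lemma mean_space' [measurable]: "mean \<in> space (lborel_pow n)" by simp

lemma integrable_quadratic:
  "integrable (gauss n) (\<lambda>x. indicator B x * (a * dot n x x + dot n u x + c))"
proof -
  interpret prob_space "gauss n" by (rule prob_space_gauss)
  show ?thesis
    by (intro integrable_indicator_B Bochner_Integration.integrable_add integrable_mult_right
        integrable_gauss_norm integrable_gauss_dot) simp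
qed

lemma integral_quadratic:
  "(\<integral>x. indicator B x * (a * dot n x x + dot n u x + c) \<partial>gauss n) = p * (a * second_moment + dot n u mean + c)"
proof -
  interpret prob_space "gauss n" by (rule prob_space_gauss)
  have 1: "(\<integral>x. indicator B x * dot n x x \<partial>gauss n) = p * second_moment"
    using p_pos by (simp add: second_moment_def)
  have 2: "(\<integral>x. indicator B x * dot n u x \<partial>gauss n) = p * dot n u mean"
  proof -
    have "(\<integral>x. indicator B x * dot n u x \<partial>gauss n) = (\<integral>x. (\<Sum>i<n. u i * (indicator B x * x i)) \<partial>gauss n)"
      by (simp add: dot_def sum_distrib_left mult_ac)
    also have "\<dots> = (\<Sum>i<n. \<integral>x. u i * (indicator B x * x i) \<partial>gauss n)"
      by (intro Bochner_Integration.integral_sum integrable_mult_right integrable_indicator_B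
          integrable_gauss_coordinate) simp
    also have "\<dots> = (\<Sum>i<n. p * (u i * mean i))"
      using p_pos by (intro sum.cong) (auto simp: mean_def)
    finally show ?thesis by (simp add: dot_def sum_distrib_left)
  qed
  have "(\<integral>x. indicator B x * (a * dot n x x + dot n u x + c) \<partial>gauss n) =
      (\<integral>x. a * (indicator B x * dot n x x) + indicator B x * dot n u x + c * indicator B x \<partial>gauss n)"
    by (simp add: algebra_simps)
  also have "\<dots> = a * (p * second_moment) + p * dot n u mean + c * p"
    using integrable_indicator_B[OF integrable_gauss_norm] integrable_indicator_B[OF integrable_gauss_dot[of n u]]
      integrable_indicator_B[of "\<lambda>_. 1"]
    by (simp add: 1 2 B_Int_space p_def[symmetric])
  finally show ?thesis by (simp add: algebra_simps)
qed

text \<open>All pair expectations in the argument are quadratics symmetric in the two samples, so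
  they reduce to \<open>second_moment\<close> and \<open>mean\<close>. The factor p^2 appears
  because the measures are restricted to \<open>B\<close> and not normalised.\<close>

lemma nn_integral_pair_quadratic:
  assumes F: "\<And>x x'. F x x' = a * dot n x x + a * dot n x' x' + b * dot n x x' + dot n w x + dot n w x' + c"
    and pos: "\<And>x x'. x \<in> B \<Longrightarrow> x' \<in> B \<Longrightarrow> 0 \<le> F x x'"
  shows "(\<integral>\<^sup>+x. \<integral>\<^sup>+x'. indicator B x * indicator B x' * ennreal (F x x') \<partial>gauss n \<partial>gauss n) =
    ennreal (p\<^sup>2 * (2 * a * second_moment + b * dot n mean mean + 2 * dot n w mean + c))"
proof -
  define H where "H x = p * (a * second_moment + dot n (lin n b x 1 w) mean + (a * dot n x x + dot n w x + c))" for x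
  have Fx: "F x x' = a * dot n x' x' + dot n (lin n b x 1 w) x' + (a * dot n x x + dot n w x + c)" for x x'
    by (simp add: F)
  have int: "(\<integral>x'. indicator B x' * F x x' \<partial>gauss n) = H x" for x
    unfolding Fx H_def by (rule integral_quadratic)
  have inner: "(\<integral>\<^sup>+x'. indicator B x * indicator B x' * ennreal (F x x') \<partial>gauss n) = ennreal (indicator B x * H x)" for x
  proof (cases "x \<in> B")
    case True
    have "(\<integral>\<^sup>+x'. indicator B x * indicator B x' * ennreal (F x x') \<partial>gauss n) = (\<integral>\<^sup>+x'. ennreal (indicator B x' * F x x') \<partial>gauss n)"
      using True by (intro nn_integral_cong) (auto simp: indicator_def)
    also have "\<dots> = ennreal (\<integral>x'. indicator B x' * F x x' \<partial>gauss n)"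
    proof (rule nn_integral_eq_integral)
      show "integrable (gauss n) (\<lambda>x'. indicator B x' * F x x')"
        unfolding Fx by (rule integrable_quadratic)
      show "AE x' in gauss n. 0 \<le> indicator B x' * F x x'"
        using pos[OF True] by (auto simp: indicator_def)
    qed
    finally show ?thesis using True by (simp add: int)
  qed simp
  have H': "H x = a * p * dot n x x + dot n (lin n (b * p) mean p w) x + p * (a * second_moment + dot n w mean + c)" for x
    by (simp add: H_def dot_commute[of n x mean] algebra_simps)
  have "(\<integral>\<^sup>+x. \<integral>\<^sup>+x'. indicator B x * indicator B x' * ennreal (F x x') \<partial>gauss n \<partial>gauss n) =
      (\<integral>\<^sup>+x. ennreal (indicator B x * H x) \<partial>gauss n)"
    by (simp only: inner)
  also have "\<dots> = ennreal (\<integral>x. indicator B x * H x \<partial>gauss n)"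
  proof (rule nn_integral_eq_integral)
    show "integrable (gauss n) (\<lambda>x. indicator B x * H x)"
      unfolding H' by (rule integrable_quadratic)
    have "0 \<le> H x" if "x \<in> B" for x
      unfolding int[symmetric] using pos[OF that] by (intro integral_nonneg_AE) (auto simp: indicator_def)
    then show "AE x in gauss n. 0 \<le> indicator B x * H x"
      by (auto simp: indicator_def)
  qed
  also have "(\<integral>x. indicator B x * H x \<partial>gauss n) =
      p * (a * p * second_moment + dot n (lin n (b * p) mean p w) mean + p * (a * second_moment + dot n w mean + c))"
    unfolding H' by (rule integral_quadratic)
  also have "\<dots> = p\<^sup>2 * (2 * a * second_moment + b * dot n mean mean + 2 * dot n w mean + c)"
    by (simp add: power2_eq_square algebra_simps)
  finally show ?thesis .
qed

lemma half_sq_dist_eq: "half_sq_dist x x' = dot n x x / 2 + dot n x' x' / 2 - dot n x x'"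
  by (simp add: half_sq_dist_def dot_commute[of n x' x] field_simps)

lemma pair_mean:
  assumes "0 \<le> c"
  shows "(\<integral>\<^sup>+x. \<integral>\<^sup>+x'. indicator B x * indicator B x' * ennreal (half_sq_dist x x' + c) \<partial>gauss n \<partial>gauss n) =
    ennreal (p\<^sup>2 * (real n - deficit + c))"
proof -
  have "(\<integral>\<^sup>+x. \<integral>\<^sup>+x'. indicator B x * indicator B x' * ennreal (half_sq_dist x x' + c) \<partial>gauss n \<partial>gauss n) =
      ennreal (p\<^sup>2 * (2 * (1 / 2) * second_moment + (-1) * dot n mean mean + 2 * dot n (\<lambda>_. 0) mean + c))"
  proof (rule nn_integral_pair_quadratic)
    show "half_sq_dist x x' + c =
      1 / 2 * dot n x x + 1 / 2 * dot n x' x' + - 1 * dot n x x' + dot n (\<lambda>_. 0) x + dot n (\<lambda>_. 0) x' + c" for x x'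
      by (simp add: half_sq_dist_eq) (simp add: dot_def)
  qed (use assms in auto)
  then show ?thesis by (simp add: deficit_def dot_def)
qed

text \<open>With t = <v, mean> + 1/2 the bound of \<open>pair_slab\<close> averages to n + sqrt
  (1/2), so the deficit is at least 1 - sqrt (1/2). Any offset below sqrt (1/2) in place of 1/2
  would leave something positive.\<close>

lemma deficit_ge_slab:
  assumes v: "dot n v v = 1" "v \<in> {..<n} \<rightarrow>\<^sub>E UNIV" and K: "\<And>k. k \<in> K \<Longrightarrow> dot n v k \<le> dot n v mean + 1 / 2"
  shows "1 / 4 \<le> deficit"
proof -
  define r :: real where "r = sqrt (1 / 2)"
  have "sqrt (1 / 2) \<le> 3 / (4 :: real)"
    by (rule real_le_lsqrt) (auto simp: power2_eq_square)
  then have r: "r > 0" "r \<le> 3 / 4" by (auto simp: r_def)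
  define t where "t = dot n v mean + 1 / 2"
  have RHS: "(\<integral>\<^sup>+x. \<integral>\<^sup>+x'. indicator B x * indicator B x' *
       ennreal (real n + r * (2 * t - dot n v x - dot n v x')) \<partial>gauss n \<partial>gauss n) =
     ennreal (p\<^sup>2 * (2 * 0 * second_moment + 0 * dot n mean mean + 2 * dot n (lin n (-r) v 0 v) mean + (real n + 2 * r * t)))"
  proof (rule nn_integral_pair_quadratic)
    fix x x' assume "x \<in> B" "x' \<in> B"
    then have "dot n v x \<le> t" "dot n v x' \<le> t" using K B_subset by (auto simp: t_def)
    then show "0 \<le> real n + r * (2 * t - dot n v x - dot n v x')" using r by simp
  qed (simp add: algebra_simps)
  have le: "ennreal (p\<^sup>2 * (real n - deficit + 1)) \<le>
     ennreal (p\<^sup>2 * (2 * 0 * second_moment + 0 * dot n mean mean + 2 * dot n (lin n (-r) v 0 v) mean + (real n + 2 * r * t)))"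
  proof -
    have "(\<integral>\<^sup>+x. \<integral>\<^sup>+x'. indicator B x * indicator B x' * ennreal (half_sq_dist x x' + 1) \<partial>gauss n \<partial>gauss n) \<le>
      (\<integral>\<^sup>+x. \<integral>\<^sup>+x'. indicator B x * indicator B x' *
         ennreal (real n + r * (2 * t - dot n v x - dot n v x')) \<partial>gauss n \<partial>gauss n)"
      unfolding r_def by (rule pair_slab[OF v]) (use K in \<open>simp add: t_def\<close>)
    then show ?thesis by (simp only: RHS pair_mean[OF zero_le_one])
  qed
  have eq: "2 * 0 * second_moment + 0 * dot n mean mean + 2 * dot n (lin n (-r) v 0 v) mean + (real n + 2 * r * t) = real n + r"
    by (simp add: t_def algebra_simps)
  have "p\<^sup>2 * (real n - deficit + 1) \<le> p\<^sup>2 * (real n + r)"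
    using le r unfolding eq by (subst (asm) ennreal_le_iff) auto
  then have "real n - deficit + 1 \<le> real n + r" using p_pos by simp
  then show ?thesis using r by simp
qed

section \<open>Growth of the Gaussian measure under dilation from the mean\<close>

definition dilate :: "real \<Rightarrow> (nat \<Rightarrow> real) set \<Rightarrow> (nat \<Rightarrow> real) set" where
  "dilate s A = {x \<in> {..<n} \<rightarrow>\<^sub>E UNIV. lin n (1 / s) x (1 - 1 / s) mean \<in> A}"

lemma dilate_B_sets [measurable]: "dilate s B \<in> sets (lborel_pow n)"
proof -
  have "{x \<in> space (lborel_pow n). lin n (1 / s) x (1 - 1 / s) mean \<in> B} \<in> sets (lborel_pow n)" by measurable
  then show ?thesis by (simp add: dilate_def)
qed

text \<open>The logarithmic derivative at \<tau> = 0 of (1 + \<tau>)^n times the Gaussian density at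
  x + \<tau> (x - mean), namely n - <x, x - mean>. Its integral over \<open>B\<close> is
  \<open>p * deficit\<close>.\<close>

definition dilation_rate :: "(nat \<Rightarrow> real) \<Rightarrow> real" where
  "dilation_rate x = real n - dot n x x + dot n mean x"

text \<open>It may depend on the body and the dimension in any way: it is multiplied by the square
  of the dilation parameter and disappears in the limit.\<close>

definition dilation_remainder :: real where
  "dilation_remainder = (\<integral>x. indicator B x * (dilation_rate x)\<^sup>2 \<partial>gauss n)"

lemma integrable_dilation_rate_square:
  "integrable (gauss n) (\<lambda>x. (dilation_rate x)\<^sup>2)"
proof (rule Bochner_Integration.integrable_bound)
  interpret prob_space "gauss n" by (rule prob_space_gauss)
  show "integrable (gauss n) (\<lambda>x. 3 * (real n)\<^sup>2 + 3 * (dot n x x)\<^sup>2 + 3 * dot n mean mean * dot n x x)"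
    by (intro Bochner_Integration.integrable_add integrable_mult_right integrable_gauss_norm integrable_gauss_norm2) simp
  show "(\<lambda>x. (dilation_rate x)\<^sup>2) \<in> borel_measurable (gauss n)"
    unfolding dilation_rate_def by measurable
  show "AE x in gauss n. norm ((dilation_rate x)\<^sup>2) \<le>
      norm (3 * (real n)\<^sup>2 + 3 * (dot n x x)\<^sup>2 + 3 * dot n mean mean * dot n x x)"
  proof (rule AE_I2)
    fix x
    have q: "(a - b + c)\<^sup>2 \<le> 3 * a\<^sup>2 + 3 * b\<^sup>2 + 3 * c\<^sup>2" for a b c :: real
      using zero_le_power2[of "a + b"] zero_le_power2[of "a - c"] zero_le_power2[of "b + c"]
      unfolding power2_eq_square by (simp only: ring_distribs)
    have "(dilation_rate x)\<^sup>2 \<le> 3 * (real n)\<^sup>2 + 3 * (dot n x x)\<^sup>2 + 3 * (dot n mean x)\<^sup>2"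
      unfolding dilation_rate_def by (rule q)
    also have "\<dots> \<le> 3 * (real n)\<^sup>2 + 3 * (dot n x x)\<^sup>2 + 3 * dot n mean mean * dot n x x"
      using dot_Cauchy_Schwarz[of n mean x] by simp
    finally show "norm ((dilation_rate x)\<^sup>2) \<le>
      norm (3 * (real n)\<^sup>2 + 3 * (dot n x x)\<^sup>2 + 3 * dot n mean mean * dot n x x)" by simp
  qed
qed

text \<open>Pulling the dilate back to \<open>B\<close> multiplies the density by at most exp
  (\<tau> * rate). The second hypothesis on \<tau> keeps the exponent below 1, because <mean, x>
  \<le> |mean|^2 + |x|^2 bounds the rate by n + |mean|^2; a quadratic bound for exp then separates
  the orders in \<tau>.\<close>

lemma dilate_measure_le:
  assumes \<tau>: "0 < \<tau>" "\<tau> * (real n + dot n mean mean) \<le> 1"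
  shows "measure (gauss n) (dilate (1 + \<tau>) B) \<le> p + \<tau> * (p * deficit) + \<tau>\<^sup>2 * dilation_remainder"
proof -
  interpret G: prob_space "gauss n" by (rule prob_space_gauss)
  define s where "s = 1 + \<tau>"
  have s: "s > 1" using \<tau> by (simp add: s_def)
  let ?a = "lin n (1 - s) mean 0 mean"
  have [measurable]: "?a \<in> space (lborel_pow n)" by simp
  have int0: "(\<integral>x. indicator B x * dilation_rate x \<partial>gauss n) = p * deficit"
    "integrable (gauss n) (\<lambda>x. indicator B x * dilation_rate x)"
    using integral_quadratic[of "-1" mean "real n"] integrable_quadratic[of "-1" mean "real n"]
    by (simp_all add: dilation_rate_def deficit_def algebra_simps)
  have rate_le: "\<tau> * dilation_rate x \<le> 1" for x
  proof -
    have "dot n mean x \<le> dot n mean mean + dot n x x"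
      using dot_nonneg[of n "lin n 1 mean (-1) x"] dot_nonneg[of n mean] dot_nonneg[of n x]
      by (simp add: dot_commute[of n x mean] algebra_simps del: dot_nonneg)
    then have "\<tau> * dilation_rate x \<le> \<tau> * (real n + dot n mean mean)"
      using \<tau>(1) by (intro mult_left_mono) (auto simp: dilation_rate_def)
    then show ?thesis using \<tau>(2) by simp
  qed
  let ?q = "\<lambda>x. indicator B x * (1 + \<tau> * dilation_rate x + (\<tau> * dilation_rate x)\<^sup>2)"
  have q_pos: "0 \<le> ?q x" for x
    using order_trans[OF exp_ge_zero exp_le_quadratic[OF rate_le[of x]]] by (simp add: indicator_def)
  have q_eq: "?q = (\<lambda>x. indicator B x * 1 + \<tau> * (indicator B x * dilation_rate x) + \<tau>\<^sup>2 * (indicator B x * (dilation_rate x)\<^sup>2))"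
    by (simp add: fun_eq_iff algebra_simps power_mult_distrib)
  have q_int: "integrable (gauss n) ?q"
    unfolding q_eq
    by (intro Bochner_Integration.integrable_add integrable_mult_right int0(2) integrable_indicator_B
        integrable_dilation_rate_square) simp
  have E_pos: "0 \<le> (\<integral>x. ?q x \<partial>gauss n)"
    by (rule integral_nonneg_AE) (rule AE_I2, rule q_pos)
  have E: "(\<integral>x. ?q x \<partial>gauss n) = p + \<tau> * (p * deficit) + \<tau>\<^sup>2 * dilation_remainder"
    unfolding q_eq
    using int0 integrable_indicator_B[OF integrable_dilation_rate_square] integrable_indicator_B[of "\<lambda>_. 1"]
    by (simp add: dilation_remainder_def B_Int_space p_def[symmetric])
  have "emeasure (gauss n) (dilate s B) = (\<integral>\<^sup>+x. indicator (dilate s B) x \<partial>gauss n)" by simp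
  also have "\<dots> = (\<integral>\<^sup>+x. ennreal (gaussian_density n x) * indicator (dilate s B) x \<partial>lborel_pow n)"
    by (rule nn_integral_gauss) measurable
  also have "\<dots> = ennreal (\<bar>s\<bar> ^ n) * (\<integral>\<^sup>+x. ennreal (gaussian_density n (lin n s x 1 ?a)) * indicator (dilate s B) (lin n s x 1 ?a) \<partial>lborel_pow n)"
    by (rule nn_integral_lborel_pow_affine) (use s in auto)
  also have "\<dots> = (\<integral>\<^sup>+x. ennreal (\<bar>s\<bar> ^ n) * (ennreal (gaussian_density n (lin n s x 1 ?a)) * indicator (dilate s B) (lin n s x 1 ?a)) \<partial>lborel_pow n)"
    by (rule nn_integral_cmult[symmetric]) measurable
  also have "\<dots> \<le> (\<integral>\<^sup>+x. ennreal (gaussian_density n x) *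
      ennreal (indicator B x * (1 + \<tau> * dilation_rate x + (\<tau> * dilation_rate x)\<^sup>2)) \<partial>lborel_pow n)"
  proof (rule nn_integral_mono)
    fix x assume x: "x \<in> space (lborel_pow n)"
    have eq: "lin n (1 / s) (lin n s x 1 ?a) (1 - 1 / s) mean = x"
      using x s by (subst eq_commute, subst eq_lin_iff) (auto simp: field_simps)
    have ind: "indicator (dilate s B) (lin n s x 1 ?a) = (indicator B x :: ennreal)"
      by (simp add: indicator_def dilate_def eq)
    have "s ^ n * gaussian_density n (lin n s x 1 ?a) \<le> gaussian_density n x * exp (\<tau> * dilation_rate x)"
    proof -
      \<comment> \<open>The Jacobian is absorbed into the exponent by 1 + \<tau> \<le> exp
        \<tau>.\<close>
      have "s ^ n \<le> exp \<tau> ^ n"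
        unfolding s_def using \<tau>(1) by (intro power_mono) auto
      also have "\<dots> = exp (\<tau> * real n)" by (simp add: exp_of_nat_mult[symmetric] mult.commute)
      finally have 1: "s ^ n \<le> exp (\<tau> * real n)" .
      have "lin n s x 1 ?a = lin n 1 x \<tau> (lin n 1 x (-1) mean)"
        by (simp add: lin_eq_iff s_def algebra_simps)
      then have "dot n (lin n s x 1 ?a) (lin n s x 1 ?a) =
          dot n x x + 2 * \<tau> * (dot n x x - dot n mean x) + \<tau> * \<tau> * dot n (lin n 1 x (-1) mean) (lin n 1 x (-1) mean)"
        by (simp add: dot_commute[of n x mean] algebra_simps)
      \<comment> \<open>The term \<tau>^2 |x - mean|^2 only lowers the density and is
        dropped.\<close>
      then have "dot n x x + 2 * \<tau> * (dot n x x - dot n mean x) \<le> dot n (lin n s x 1 ?a) (lin n s x 1 ?a)"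
        using \<tau>(1) by (simp del: dot_lin_left dot_lin_right)
      then have "\<tau> * real n + - dot n (lin n s x 1 ?a) (lin n s x 1 ?a) / 2 \<le> - dot n x x / 2 + \<tau> * dilation_rate x"
        unfolding dilation_rate_def by (simp del: dot_lin_left dot_lin_right add: algebra_simps)
      then have "exp (\<tau> * real n) * exp (- dot n (lin n s x 1 ?a) (lin n s x 1 ?a) / 2) \<le> exp (- dot n x x / 2) * exp (\<tau> * dilation_rate x)"
        by (simp only: exp_add[symmetric] exp_le_cancel_iff)
      then have "s ^ n * exp (- dot n (lin n s x 1 ?a) (lin n s x 1 ?a) / 2) \<le> exp (- dot n x x / 2) * exp (\<tau> * dilation_rate x)"
        by (rule order_trans[OF mult_right_mono[OF 1 exp_ge_zero]])
      then have "(1 / sqrt (2 * pi)) ^ n * (s ^ n * exp (- dot n (lin n s x 1 ?a) (lin n s x 1 ?a) / 2)) \<le>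
          (1 / sqrt (2 * pi)) ^ n * (exp (- dot n x x / 2) * exp (\<tau> * dilation_rate x))"
        by (intro mult_left_mono) auto
      then show ?thesis unfolding gaussian_density_eq by (simp only: mult.assoc mult.left_commute[of "s ^ n"])
    qed
    also have "\<dots> \<le> gaussian_density n x * (1 + \<tau> * dilation_rate x + (\<tau> * dilation_rate x)\<^sup>2)"
      by (intro mult_left_mono exp_le_quadratic rate_le) (simp add: gaussian_density_pos less_imp_le)
    finally have "ennreal (s ^ n * gaussian_density n (lin n s x 1 ?a)) \<le>
        ennreal (gaussian_density n x * (1 + \<tau> * dilation_rate x + (\<tau> * dilation_rate x)\<^sup>2))" by (rule ennreal_leI)
    then have "ennreal (s ^ n) * ennreal (gaussian_density n (lin n s x 1 ?a)) \<le>
        ennreal (gaussian_density n x) * ennreal (1 + \<tau> * dilation_rate x + (\<tau> * dilation_rate x)\<^sup>2)"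
      using s gaussian_density_pos[of n] less_imp_le by (subst (asm) (1 2) ennreal_mult') auto
    then show "ennreal (\<bar>s\<bar> ^ n) * (ennreal (gaussian_density n (lin n s x 1 ?a)) * indicator (dilate s B) (lin n s x 1 ?a)) \<le>
      ennreal (gaussian_density n x) * ennreal (indicator B x * (1 + \<tau> * dilation_rate x + (\<tau> * dilation_rate x)\<^sup>2))"
      unfolding ind using s by (auto simp: indicator_def)
  qed
  also have "\<dots> = (\<integral>\<^sup>+x. ennreal (indicator B x * (1 + \<tau> * dilation_rate x + (\<tau> * dilation_rate x)\<^sup>2)) \<partial>gauss n)"
    unfolding dilation_rate_def by (rule nn_integral_gauss[symmetric]) measurable
  also have "\<dots> = ennreal (\<integral>x. ?q x \<partial>gauss n)"
    by (rule nn_integral_eq_integral[OF q_int]) (rule AE_I2, rule q_pos)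
  finally have "measure (gauss n) (dilate s B) \<le> (\<integral>x. ?q x \<partial>gauss n)"
    using E_pos by (simp add: G.emeasure_eq_measure)
  then show ?thesis unfolding E by (simp add: s_def)
qed

end

section \<open>Bodies extending in all directions beyond their mean\<close>

lemma one_minus_cos_le: "1 - cos \<theta> \<le> \<theta>\<^sup>2 / 2" for \<theta> :: real
proof -
  have "1 - cos \<theta> = 2 * (sin (\<theta> / 2))\<^sup>2"
    using cos_double_sin[of "\<theta> / 2"] by simp
  also have "\<dots> \<le> 2 * (\<theta> / 2)\<^sup>2"
    using abs_sin_x_le_abs_x[of "\<theta> / 2"] by (intro mult_left_mono) (auto simp only: abs_le_square_iff)
  finally show ?thesis by (simp add: power2_eq_square)
qed

context convex_body
begin

lemma deficit_nonneg: "0 \<le> deficit"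
proof -
  have "ennreal (p\<^sup>2 * (real n - deficit)) =
      (\<integral>\<^sup>+x. \<integral>\<^sup>+x'. indicator B x * indicator B x' * ennreal (half_sq_dist x x' ^ Suc 0) \<partial>gauss n \<partial>gauss n)"
    using pair_mean[of 0] by simp
  also have "\<dots> \<le> ennreal (real (n + 2 * 0)) *
    (\<integral>\<^sup>+x. \<integral>\<^sup>+x'. indicator B x * indicator B x' * ennreal (half_sq_dist x x' ^ 0) \<partial>gauss n \<partial>gauss n)"
    by (rule pair_moment)
  also have "(\<integral>\<^sup>+x. \<integral>\<^sup>+x'. indicator B x * indicator B x' * ennreal (half_sq_dist x x' ^ 0) \<partial>gauss n \<partial>gauss n) = ennreal (p\<^sup>2)"
    using nn_integral_pair_quadratic[of "\<lambda>_ _. 1" 0 0 "\<lambda>_. 0" 1] by (simp add: dot_def)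
  finally have "p\<^sup>2 * (real n - deficit) \<le> real n * p\<^sup>2"
    by (simp add: ennreal_mult[symmetric])
  then have "0 \<le> p\<^sup>2 * deficit" by (simp add: algebra_simps)
  then show ?thesis using p_pos by (simp add: zero_le_mult_iff)
qed

text \<open>The conditional probability, given that a rotating Gaussian vector is now at
  \<open>u\<close>, that it was in \<open>B\<close> an angle \<theta> earlier; the minus sign is
  that of the inverse rotation.\<close>

definition entering :: "real \<Rightarrow> (nat \<Rightarrow> real) \<Rightarrow> ennreal" where
  "entering \<theta> u = (\<integral>\<^sup>+y. indicator B (lin n (cos \<theta>) u (- sin \<theta>) y) \<partial>gauss n)"

lemma measurable_entering [measurable]: "entering \<theta> \<in> borel_measurable (lborel_pow n)"
proof -
  interpret G: prob_space "gauss n" by (rule prob_space_gauss)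
  show ?thesis unfolding entering_def by measurable
qed

lemma entering_le_1: "entering \<theta> u \<le> 1"
proof -
  interpret G: prob_space "gauss n" by (rule prob_space_gauss)
  have "entering \<theta> u \<le> (\<integral>\<^sup>+y. 1 \<partial>gauss n)"
    unfolding entering_def by (intro nn_integral_mono) (auto simp: indicator_def)
  then show ?thesis using G.emeasure_space_1 by simp
qed

text \<open>Two rotations: one by \<alpha> makes the earlier vector a coordinate, which removes
  \<alpha> from the integral; one by \<theta> makes the later vector a coordinate, so that the
  earlier one can be integrated out. Both hypotheses come from the rotation lemma.\<close>

lemma crossing_probability:
  assumes j: "cos \<alpha> \<noteq> -1" "cos \<theta> \<noteq> -1"
  shows "(\<integral>\<^sup>+g. \<integral>\<^sup>+h. indicator B (lin n (cos \<alpha>) g (sin \<alpha>) h) *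
      indicator (- B) (lin n (cos (\<alpha> + \<theta>)) g (sin (\<alpha> + \<theta>)) h) \<partial>gauss n \<partial>gauss n) =
    (\<integral>\<^sup>+u. indicator (- B) u * entering \<theta> u \<partial>gauss n)"
proof -
  let ?F = "\<lambda>x y. indicator B x * indicator (- B) (lin n (cos \<theta>) x (sin \<theta>) y) :: ennreal"
  let ?H = "\<lambda>u y. indicator (- B) u * indicator B (lin n (cos \<theta>) u (- sin \<theta>) y) :: ennreal"
  \<comment> \<open>The complement of \<open>B\<close> in the full function type contains
    non-extensional functions and is no measurable set; it is cut down to the carrier, where the
    arguments lie anyway.\<close>
  have cB [measurable]: "- B \<inter> space (lborel_pow n) \<in> sets (lborel_pow n)"
    using sets.compl_sets[OF B_sets] by (simp add: Diff_eq Int_commute)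
  have ci: "(indicator (- B) (lin n a x b y) :: ennreal) = indicator (- B \<inter> space (lborel_pow n)) (lin n a x b y)" for a b x y
    by (simp add: indicator_def)
  have Fm: "(\<lambda>(x, y). ?F x y) \<in> borel_measurable (lborel_pow n \<Otimes>\<^sub>M lborel_pow n)"
    unfolding ci by measurable
  have Hm': "(\<lambda>(u, y). indicator (- B \<inter> space (lborel_pow n)) u * indicator B (lin n (cos \<theta>) u (- sin \<theta>) y) :: ennreal)
      \<in> borel_measurable (lborel_pow n \<Otimes>\<^sub>M lborel_pow n)"
    by measurable
  have Hm: "(\<lambda>(x, y). ?H x y) \<in> borel_measurable (lborel_pow n \<Otimes>\<^sub>M lborel_pow n)"
  proof -
    have "(case w of (x, y) \<Rightarrow> ?H x y) = (case w of (u, y) \<Rightarrow>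
        indicator (- B \<inter> space (lborel_pow n)) u * indicator B (lin n (cos \<theta>) u (- sin \<theta>) y))"
      if "w \<in> space (lborel_pow n \<Otimes>\<^sub>M lborel_pow n)" for w
      using that by (cases w) (simp add: space_pair_measure indicator_def)
    with Hm' show ?thesis by (subst measurable_cong) assumption+
  qed
  have "(\<integral>\<^sup>+g. \<integral>\<^sup>+h. indicator B (lin n (cos \<alpha>) g (sin \<alpha>) h) *
      indicator (- B) (lin n (cos (\<alpha> + \<theta>)) g (sin (\<alpha> + \<theta>)) h) \<partial>gauss n \<partial>gauss n) =
    (\<integral>\<^sup>+g. \<integral>\<^sup>+h. ?F (lin n (cos \<alpha>) g (sin \<alpha>) h) (lin n (- sin \<alpha>) g (cos \<alpha>) h) \<partial>gauss n \<partial>gauss n)"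
  proof -
    have "lin n (cos \<theta>) (lin n (cos \<alpha>) g (sin \<alpha>) h) (sin \<theta>) (lin n (- sin \<alpha>) g (cos \<alpha>) h) =
        lin n (cos (\<alpha> + \<theta>)) g (sin (\<alpha> + \<theta>)) h" for g h
      by (simp add: lin_eq_iff cos_add sin_add algebra_simps)
    then show ?thesis by simp
  qed
  also have "\<dots> = (\<integral>\<^sup>+x. \<integral>\<^sup>+y. ?F x y \<partial>gauss n \<partial>gauss n)"
    by (rule nn_integral_gauss_rotation[OF _ j(1) Fm]) simp
  also have "\<dots> = (\<integral>\<^sup>+x. \<integral>\<^sup>+y. ?H (lin n (cos \<theta>) x (sin \<theta>) y) (lin n (- sin \<theta>) x (cos \<theta>) y) \<partial>gauss n \<partial>gauss n)"
  proof (intro nn_integral_cong)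
    fix x y assume x: "x \<in> space (gauss n)"
    have "x = lin n (cos \<theta>) (lin n (cos \<theta>) x (sin \<theta>) y) (- sin \<theta>) (lin n (- sin \<theta>) x (cos \<theta>) y)"
    proof (subst eq_lin_iff, use x in simp, intro allI impI)
      fix i assume "i < n"
      have "cos \<theta> * (cos \<theta> * x i + sin \<theta> * y i) + - sin \<theta> * (- sin \<theta> * x i + cos \<theta> * y i)
          = ((cos \<theta>)\<^sup>2 + (sin \<theta>)\<^sup>2) * x i" by algebra
      then show "x i = cos \<theta> * lin n (cos \<theta>) x (sin \<theta>) y i + - sin \<theta> * lin n (- sin \<theta>) x (cos \<theta>) y i"
        using \<open>i < n\<close> by simp
    qed
    then show "?F x y = ?H (lin n (cos \<theta>) x (sin \<theta>) y) (lin n (- sin \<theta>) x (cos \<theta>) y)"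
      by (metis mult.commute)
  qed
  also have "\<dots> = (\<integral>\<^sup>+u. \<integral>\<^sup>+y. ?H u y \<partial>gauss n \<partial>gauss n)"
    by (rule nn_integral_gauss_rotation[OF _ j(2) Hm]) simp
  also have "\<dots> = (\<integral>\<^sup>+u. indicator (- B) u * entering \<theta> u \<partial>gauss n)"
    unfolding entering_def
  proof (intro nn_integral_cong nn_integral_cmult)
    fix u assume "u \<in> space (gauss n)"
    then have [measurable]: "u \<in> space (lborel_pow n)" by simp
    show "(\<lambda>y. indicator B (lin n (cos \<theta>) u (- sin \<theta>) y)) \<in> borel_measurable (gauss n)" by measurable
  qed
  finally show ?thesis .
qed

text \<open>
  Rotating \<open>g\<close> into \<open>h\<close> in \<open>N\<close> steps, a path which starts in \<open>B\<close> and ends outside leaves \<open>B\<close> in some step,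
  and all steps have the same distribution.
\<close>

lemma variance_le_crossing:
  assumes N: "0 < N" and \<theta>: "\<theta> = pi / (2 * real N)"
  shows "ennreal (p * (1 - p)) \<le> of_nat N * (\<integral>\<^sup>+u. indicator (- B) u * entering \<theta> u \<partial>gauss n)"
proof -
  interpret G: prob_space "gauss n" by (rule prob_space_gauss)
  define C where "C = - B \<inter> space (lborel_pow n)"
  have C [measurable]: "C \<in> sets (lborel_pow n)"
    using sets.compl_sets[OF B_sets] by (simp add: C_def Diff_eq Int_commute)
  have ci: "(indicator (- B) (lin n a x b y) :: ennreal) = indicator C (lin n a x b y)" for a b x y
    by (simp add: indicator_def C_def)
  let ?x = "\<lambda>j g h. lin n (cos (real j * \<theta>)) g (sin (real j * \<theta>)) h"
  have compl: "(\<integral>\<^sup>+h. indicator (- B) h \<partial>gauss n) = ennreal (1 - p)"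
  proof -
    have "(\<integral>\<^sup>+h. indicator (- B) h \<partial>gauss n) = (\<integral>\<^sup>+h. indicator (space (gauss n) - B) h \<partial>gauss n)"
      by (intro nn_integral_cong) (auto simp: indicator_def)
    also have "\<dots> = emeasure (gauss n) (space (gauss n) - B)" by simp
    also have "\<dots> = ennreal (1 - p)"
      using G.prob_compl[of B] by (simp add: G.emeasure_eq_measure p_def)
    finally show ?thesis .
  qed
  have "ennreal (p * (1 - p)) = ennreal p * ennreal (1 - p)"
    using p_pos p_le_1 by (simp add: ennreal_mult)
  also have "\<dots> = (\<integral>\<^sup>+g. indicator B g \<partial>gauss n) * ennreal (1 - p)"
    by (simp only: nn_integral_indicator_B)
  also have "\<dots> = (\<integral>\<^sup>+g. indicator B g * ennreal (1 - p) \<partial>gauss n)"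
    by (rule nn_integral_multc[symmetric]) measurable
  also have "\<dots> = (\<integral>\<^sup>+g. \<integral>\<^sup>+h. indicator B g * indicator (- B) h \<partial>gauss n \<partial>gauss n)"
    unfolding compl[symmetric]
  proof (intro nn_integral_cong nn_integral_cmult[symmetric])
    show "indicator (- B) \<in> borel_measurable (gauss n)"
      by (intro borel_measurable_indicator' ) (simp add: vimage_def Int_def[symmetric] Compl_eq[symmetric] C[unfolded C_def, simplified])
  qed
  also have "\<dots> \<le> (\<integral>\<^sup>+g. \<integral>\<^sup>+h. (\<Sum>j<N. indicator B (?x j g h) * indicator (- B) (?x (Suc j) g h)) \<partial>gauss n \<partial>gauss n)"
  proof (intro nn_integral_mono)
    fix g h assume gh: "g \<in> space (gauss n)" "h \<in> space (gauss n)"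
    have x0: "?x 0 g h = g" using gh by (subst eq_commute, subst eq_lin_iff) auto
    \<comment> \<open>N steps of angle \<theta> add up to a right angle, so the path ends at the
      independent vector h.\<close>
    have xN: "?x N g h = h"
    proof -
      have "real N * \<theta> = pi / 2" using N by (simp add: \<theta>)
      then have "cos (real N * \<theta>) = 0" "sin (real N * \<theta>) = 1"
        by (simp_all only: cos_pi_half sin_pi_half)
      then show ?thesis using gh by (subst eq_commute, subst eq_lin_iff) simp_all
    qed
    have step: "\<exists>j<M. ?x j g h \<in> B \<and> ?x (Suc j) g h \<notin> B" if "?x 0 g h \<in> B" "?x M g h \<notin> B" for M
      using that
    proof (induction M)
      case (Suc M)
      then show ?case by (cases "?x M g h \<in> B") (auto intro: less_SucI)
    qed simp
    show "indicator B g * indicator (- B) h \<le> (\<Sum>j<N. indicator B (?x j g h) * indicator (- B) (?x (Suc j) g h) :: ennreal)"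
    proof (cases "g \<in> B \<and> h \<notin> B")
      case True
      then obtain j where j: "j < N" "?x j g h \<in> B" "?x (Suc j) g h \<notin> B"
        using step[of N] x0 xN by auto
      have "(1::ennreal) = indicator B (?x j g h) * indicator (- B) (?x (Suc j) g h)" using j by simp
      also have "\<dots> \<le> (\<Sum>j<N. indicator B (?x j g h) * indicator (- B) (?x (Suc j) g h))"
        using j(1) by (intro member_le_sum) auto
      finally show ?thesis using True by simp
    qed (auto simp: indicator_def)
  qed
  also have "\<dots> = (\<Sum>j<N. \<integral>\<^sup>+g. \<integral>\<^sup>+h. indicator B (?x j g h) * indicator (- B) (?x (Suc j) g h) \<partial>gauss n \<partial>gauss n)"
  proof -
    have "(\<integral>\<^sup>+g. \<integral>\<^sup>+h. (\<Sum>j<N. indicator B (?x j g h) * indicator (- B) (?x (Suc j) g h)) \<partial>gauss n \<partial>gauss n) =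
        (\<integral>\<^sup>+g. (\<Sum>j<N. \<integral>\<^sup>+h. indicator B (?x j g h) * indicator (- B) (?x (Suc j) g h) \<partial>gauss n) \<partial>gauss n)"
      unfolding ci
    proof (intro nn_integral_cong nn_integral_sum)
      fix g j assume "g \<in> space (gauss n)"
      then have [measurable]: "g \<in> space (lborel_pow n)" by simp
      show "(\<lambda>h. indicator B (?x j g h) * indicator C (?x (Suc j) g h) :: ennreal) \<in> borel_measurable (gauss n)"
        by measurable
    qed
    also have "\<dots> = (\<Sum>j<N. \<integral>\<^sup>+g. \<integral>\<^sup>+h. indicator B (?x j g h) * indicator (- B) (?x (Suc j) g h) \<partial>gauss n \<partial>gauss n)"
      unfolding ci by (rule nn_integral_sum) measurable
    finally show ?thesis .
  qed
  also have "\<dots> = (\<Sum>j<N. \<integral>\<^sup>+u. indicator (- B) u * entering \<theta> u \<partial>gauss n)"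
  proof (rule sum.cong[OF refl])
    fix j assume j: "j \<in> {..<N}"
    have "0 \<le> \<theta>" using N by (simp add: \<theta>)
    have pos: "cos (real i * \<theta>) \<noteq> -1" if "i \<le> N" for i
    proof -
      have "real i * \<theta> \<le> real N * \<theta>" using that \<open>0 \<le> \<theta>\<close> by (intro mult_right_mono) auto
      then have "real i * \<theta> \<le> pi / 2" using N by (simp add: \<theta>)
      then have "0 \<le> cos (real i * \<theta>)" using \<open>0 \<le> \<theta>\<close> by (intro cos_ge_zero) (auto intro: order_trans[of _ 0])
      then show ?thesis by linarith
    qed
    have "real (Suc j) * \<theta> = real j * \<theta> + \<theta>" by (simp add: algebra_simps)
    then show "(\<integral>\<^sup>+g. \<integral>\<^sup>+h. indicator B (?x j g h) * indicator (- B) (?x (Suc j) g h) \<partial>gauss n \<partial>gauss n) =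
        (\<integral>\<^sup>+u. indicator (- B) u * entering \<theta> u \<partial>gauss n)"
      using crossing_probability[of "real j * \<theta>" \<theta>] pos[of j] pos[of 1] j N by simp
  qed
  finally show ?thesis by simp
qed

section \<open>Points outside the body at dyadic distances\<close>

lemma AE_dilate: "1 \<le> s \<Longrightarrow> AE x in gauss n. x \<in> dilate s K \<longleftrightarrow> x \<in> dilate s B"
proof -
  assume s: "1 \<le> s"
  let ?a = "lin n (1 - 1 / s) mean 0 mean"
  have "AE x in lborel_pow n. x \<in> K \<longleftrightarrow> x \<in> B" using AE_K by eventually_elim (use B_subset in auto)
  then have "AE x in lborel_pow n. lin n (1 / s) x 1 ?a \<in> K \<longleftrightarrow> lin n (1 / s) x 1 ?a \<in> B"
    by (rule AE_lborel_pow_affine[rotated 2]) (use s in auto)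
  moreover have "lin n (1 / s) x 1 ?a = lin n (1 / s) x (1 - 1 / s) mean" for x
    by (simp add: lin_eq_iff)
  ultimately show ?thesis unfolding AE_gauss_iff by (auto simp: dilate_def elim!: eventually_mono)
qed

text \<open>A hyperplane separating the mean from \<open>K\<close> would have a normal direction in
  which \<open>K\<close> does not extend beyond its mean at all.\<close>

lemma mean_in_K:
  assumes case1: "\<And>v. dot n v v = 1 \<Longrightarrow> \<exists>k\<in>K. dot n v k > dot n v mean + 1 / 2"
  shows "mean \<in> K"
proof (rule ccontr)
  assume "mean \<notin> K"
  then obtain v where "v \<in> {..<n} \<rightarrow>\<^sub>E UNIV" "dot n v v = 1" "\<And>k. k \<in> K \<Longrightarrow> dot n v k \<le> dot n v mean"
    by (rule convex_separation[OF convex K_nonempty mean_space]) (rule that; blast)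
  then show False using case1[of v] by fastforce
qed

text \<open>Since the mean belongs to \<open>K\<close>, dilating from it enlarges \<open>K\<close>.
  So the measure of the added part is a difference of measures, and the terms of order 0
  cancel.\<close>

lemma dilate_diff_measure_le:
  assumes case1: "\<And>v. dot n v v = 1 \<Longrightarrow> \<exists>k\<in>K. dot n v k > dot n v mean + 1 / 2"
    and \<tau>: "0 < \<tau>" "\<tau> * (real n + dot n mean mean) \<le> 1"
  shows "measure (gauss n) (dilate (1 + \<tau>) B - B) \<le> \<tau> * (p * deficit) + \<tau>\<^sup>2 * dilation_remainder"
proof -
  interpret G: prob_space "gauss n" by (rule prob_space_gauss)
  let ?D = "dilate (1 + \<tau>)"
  have KD: "K \<subseteq> ?D K"
  proof
    fix x assume x: "x \<in> K"
    have "lin n (1 / (1 + \<tau>)) x (1 - 1 / (1 + \<tau>)) mean \<in> K"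
      by (rule convex_inD[OF convex x mean_in_K[OF case1]]) (use \<tau> in \<open>auto simp: field_simps\<close>)
    then show "x \<in> ?D K" using convex_in_space[OF convex x] by (simp add: dilate_def)
  qed
  have "AE x in gauss n. x \<in> ?D B \<inter> B \<longleftrightarrow> x \<in> B"
    using AE_dilate[of "1 + \<tau>"] \<tau> KD B_subset by (auto elim!: eventually_mono)
  then have "measure (gauss n) (?D B \<inter> B) = p"
    unfolding p_def by (rule G.finite_measure_eq_AE) auto
  moreover have "measure (gauss n) (?D B - B) = measure (gauss n) (?D B) - measure (gauss n) (?D B \<inter> B)"
    by (rule G.finite_measure_Diff') auto
  ultimately show ?thesis using dilate_measure_le[OF \<tau>] by simp
qed

text \<open>
  Outside the dilate of \<open>K\<close> by \<open>1 + \<tau>\<close>, a hyperplane separates \<open>u\<close> from \<open>K\<close> by a margin of order \<open>\<tau>\<close>, so reaching \<open>K\<close> from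
  \<open>u\<close> by a rotation of angle \<open>\<theta>\<close> requires a deviation of order \<open>\<tau> / \<theta>\<close> of a standard normal variable.
\<close>

lemma entering_le_level:
  assumes case1: "\<And>v. dot n v v = 1 \<Longrightarrow> \<exists>k\<in>K. dot n v k > dot n v mean + 1 / 2"
    and \<theta>: "0 < \<theta>" "\<theta> * (1 + sqrt (dot n mean mean)) \<le> 1" "\<theta> \<le> 1" and \<tau>: "\<tau> = 2 ^ i * (4 * \<theta>)" "\<tau> \<le> 1"
    and u: "u \<in> {..<n} \<rightarrow>\<^sub>E UNIV" "u \<notin> dilate (1 + \<tau>) K"
  shows "entering \<theta> u \<le> ennreal ((1 / 4) ^ i)"
proof -
  define s where "s = 1 + \<tau>"
  have \<tau>pos: "0 < \<tau>" using \<theta> by (simp add: \<tau>(1))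
  have s: "1 < s" "s \<le> 2" using \<tau>pos \<tau>(2) by (auto simp: s_def)
  define w where "w = lin n (1 / s) u (1 - 1 / s) mean"
  have w: "w \<notin> K" "w \<in> {..<n} \<rightarrow>\<^sub>E UNIV" using u by (auto simp: dilate_def w_def s_def)
  obtain v where v: "v \<in> {..<n} \<rightarrow>\<^sub>E UNIV" "dot n v v = 1" and vK: "\<And>k. k \<in> K \<Longrightarrow> dot n v k \<le> dot n v w"
    by (rule convex_separation[OF convex K_nonempty w(2,1)]) (rule that; blast)
  define A where "A = dot n v w - dot n v mean"
  define m where "m = dot n v mean"
  \<comment> \<open>\<open>K\<close> reaches further than 1/2 beyond its mean along v, yet it stays
    behind the hyperplane through w.\<close>
  have A: "A > 1 / 2"
    using case1[OF v(2)] vK unfolding A_def by fastforce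
  have dvw: "dot n v w = m + A" by (simp add: A_def m_def)
  \<comment> \<open>u lies s times as far from the mean as w, so it is beyond the hyperplane by
    \<tau> * A, more than \<tau> / 2.\<close>
  have dvu: "dot n v u = m + s * A"
  proof -
    have "s * dot n v w = dot n v u + (s - 1) * m"
      using s unfolding w_def m_def by (simp add: field_simps)
    then show ?thesis unfolding dvw by (simp add: algebra_simps)
  qed
  have m_le: "m \<le> sqrt (dot n mean mean)"
    using dot_Cauchy_Schwarz[of n v mean] v(2) unfolding m_def by (simp add: real_le_rsqrt)
  have sin_le: "sin \<theta> \<le> \<theta>" using \<theta>(1) by (simp add: sin_x_le_x)
  have sin_pos: "0 < sin \<theta>" using \<theta> pi_gt3 by (intro sin_gt_zero) auto
  \<comment> \<open>The rotation must bridge this gap by sin \<theta> * <v, y>. Of \<tau> / 2 = 2 *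
    2^i * \<theta>, one half pays for the curvature terms of order \<theta>^2 * (1 + |mean|), which
    are at most \<theta>; the other half remains. Hence the factor 4 in \<tau>.\<close>
  have margin: "2 ^ i \<le> dot n v y" if y: "lin n (cos \<theta>) u (- sin \<theta>) y \<in> B" for y
  proof -
    define c where "c = cos \<theta>"
    have c: "1 - c \<le> \<theta>\<^sup>2 / 2" "c \<le> 1" using one_minus_cos_le[of \<theta>] by (auto simp: c_def)
    have "dot n v (lin n c u (- sin \<theta>) y) \<le> m + A"
      using vK[of "lin n c u (- sin \<theta>) y"] y B_subset dvw unfolding c_def by auto
    then have 1: "c * (m + s * A) - m - A \<le> sin \<theta> * dot n v y"
      by (simp add: dvu)
    have "(1 - c) * s \<le> \<theta>\<^sup>2 / 2 * 2"
      using c s by (intro mult_mono) auto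
    then have cs: "\<tau> - \<theta>\<^sup>2 \<le> c * s - 1" by (simp add: s_def algebra_simps)
    have "\<theta>\<^sup>2 \<le> \<theta>" using \<theta> by (simp add: power2_eq_square mult_left_le)
    also have "\<dots> \<le> 2 ^ i * (4 * \<theta>)"
      using mult_mono[of 1 "2 ^ i" \<theta> "4 * \<theta>"] \<theta>(1) by simp
    finally have "\<theta>\<^sup>2 \<le> \<tau>" by (simp add: \<tau>(1))
    then have "1 / 2 * (\<tau> - \<theta>\<^sup>2) \<le> A * (c * s - 1)"
      using A cs by (intro mult_mono) auto
    moreover have "(1 - c) * m \<le> \<theta>\<^sup>2 / 2 * sqrt (dot n mean mean)"
    proof -
      have "(1 - c) * m \<le> (1 - c) * sqrt (dot n mean mean)"
        using m_le c by (intro mult_left_mono) auto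
      also have "\<dots> \<le> \<theta>\<^sup>2 / 2 * sqrt (dot n mean mean)"
        using c by (intro mult_right_mono) auto
      finally show ?thesis .
    qed
    moreover have "c * (m + s * A) - m - A = A * (c * s - 1) - (1 - c) * m"
      by (simp add: algebra_simps)
    ultimately have "\<tau> / 2 - \<theta>\<^sup>2 / 2 - \<theta>\<^sup>2 / 2 * sqrt (dot n mean mean) \<le> sin \<theta> * dot n v y"
      using 1 by argo
    moreover have "\<theta>\<^sup>2 / 2 + \<theta>\<^sup>2 / 2 * sqrt (dot n mean mean) \<le> \<theta>"
    proof -
      have "\<theta>\<^sup>2 / 2 + \<theta>\<^sup>2 / 2 * sqrt (dot n mean mean) = \<theta> * (\<theta> * (1 + sqrt (dot n mean mean))) / 2"
        by (simp add: power2_eq_square field_simps)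
      also have "\<dots> \<le> \<theta> * 1 / 2"
        using \<theta> by (intro divide_right_mono mult_left_mono) auto
      finally show ?thesis using \<theta>(1) by simp
    qed
    moreover have "\<theta> \<le> 2 ^ i * \<theta>" using \<theta>(1) by simp
    moreover have "\<tau> / 2 = 2 ^ i * \<theta> + 2 ^ i * \<theta>" by (simp add: \<tau>(1))
    ultimately have 2: "2 ^ i * \<theta> \<le> sin \<theta> * dot n v y" by linarith
    have "0 < sin \<theta> * dot n v y" using 2 \<theta>(1) by (auto intro: less_le_trans[of 0 "2 ^ i * \<theta>"])
    then have "0 < dot n v y" using sin_pos by (simp add: zero_less_mult_iff)
    then have "2 ^ i * \<theta> \<le> \<theta> * dot n v y"
      using 2 mult_right_mono[OF sin_le, of "dot n v y"] by linarith
    then show ?thesis using \<theta>(1) by (simp add: mult.commute)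
  qed
  \<comment> \<open>Markov's inequality for <v, y>^2, which has expectation 1.\<close>
  have "entering \<theta> u \<le> (\<integral>\<^sup>+y. ennreal ((1 / 4) ^ i) * ennreal ((dot n v y)\<^sup>2) \<partial>gauss n)"
    unfolding entering_def
  proof (intro nn_integral_mono)
    fix y
    show "indicator B (lin n (cos \<theta>) u (- sin \<theta>) y) \<le> ennreal ((1 / 4) ^ i) * ennreal ((dot n v y)\<^sup>2)"
    proof (cases "lin n (cos \<theta>) u (- sin \<theta>) y \<in> B")
      case True
      have "(2 ^ i)\<^sup>2 \<le> (dot n v y)\<^sup>2" using margin[OF True] by (intro power_mono) auto
      moreover have "((2::real) ^ i)\<^sup>2 = 4 ^ i" by (simp add: power2_eq_square flip: power_mult_distrib)
      ultimately have "1 \<le> (1 / 4) ^ i * (dot n v y)\<^sup>2" by (simp add: power_one_over field_simps)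
      then have "ennreal 1 \<le> ennreal ((1 / 4) ^ i * (dot n v y)\<^sup>2)" by (rule ennreal_leI)
      then show ?thesis using True by (simp add: ennreal_mult)
    qed simp
  qed
  also have "\<dots> = ennreal ((1 / 4) ^ i) * (\<integral>\<^sup>+y. ennreal ((dot n v y)\<^sup>2) \<partial>gauss n)"
  proof (rule nn_integral_cmult)
    have [measurable]: "v \<in> space (lborel_pow n)" using v by simp
    show "(\<lambda>y. ennreal ((dot n v y)\<^sup>2)) \<in> borel_measurable (gauss n)" by measurable
  qed
  also have "\<dots> = ennreal ((1 / 4) ^ i)"
    using nn_integral_gauss_dot_square[OF v(2,1)] by simp
  finally show ?thesis .
qed

end

context convex_body
begin

text \<open>Points outside \<open>B\<close> are sorted by the first dyadic dilate that contains
  them. At level i > 0 the previous dilate is missed, so \<open>entering\<close> is at most 4 *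
  (1/4)^i, against a set of measure of order 2^i * \<theta>: the first-order terms form a geometric
  series bounded independently of \<open>J\<close>. The second-order terms are equal at all levels,
  hence \<open>Suc J\<close>, and points beyond level \<open>J\<close> cost (1/4)^J. The conditions
  on \<open>J\<close> keep every level within reach of the dilation bound.\<close>

lemma crossing_le:
  assumes case1: "\<And>v. dot n v v = 1 \<Longrightarrow> \<exists>k\<in>K. dot n v k > dot n v mean + 1 / 2"
    and \<theta>: "0 < \<theta>" "\<theta> * (1 + sqrt (dot n mean mean)) \<le> 1" "\<theta> \<le> 1"
    and J: "2 ^ J * (4 * \<theta>) \<le> 1" "2 ^ J * (4 * \<theta>) * (real n + dot n mean mean) \<le> 1"
  shows "(\<integral>\<^sup>+u. indicator (- B) u * entering \<theta> u \<partial>gauss n) \<le>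
    ennreal ((1 / 4) ^ J + (32 * \<theta> * (p * deficit) + 64 * \<theta>\<^sup>2 * dilation_remainder * real (Suc J)))"
proof -
  interpret G: prob_space "gauss n" by (rule prob_space_gauss)
  define \<tau> where "\<tau> i = 2 ^ i * (4 * \<theta>)" for i :: nat
  define W where "W i = dilate (1 + \<tau> i) B - B" for i
  have [measurable]: "W i \<in> sets (lborel_pow n)" for i unfolding W_def by measurable
  have \<tau>pos: "0 < \<tau> i" for i using \<theta> by (simp add: \<tau>_def)
  have \<tau>_mono: "\<tau> i \<le> \<tau> J" if "i \<le> J" for i
    unfolding \<tau>_def using that \<theta> by (intro mult_right_mono power_increasing) auto
  have \<tau>1: "\<tau> i \<le> 1" if "i \<le> J" for i using \<tau>_mono[OF that] J(1) by (simp add: \<tau>_def)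
  have \<tau>2: "\<tau> i * (real n + dot n mean mean) \<le> 1" if "i \<le> J" for i
  proof -
    have "\<tau> i * (real n + dot n mean mean) \<le> \<tau> J * (real n + dot n mean mean)"
      using \<tau>_mono[OF that] by (intro mult_right_mono) auto
    then show ?thesis using J(2) by (simp add: \<tau>_def)
  qed
  have "AE u in gauss n. \<forall>i. u \<in> dilate (1 + \<tau> i) K \<longleftrightarrow> u \<in> dilate (1 + \<tau> i) B"
    unfolding AE_all_countable using AE_dilate[of "1 + \<tau> _"] \<tau>pos by (simp add: less_imp_le)
  then have "AE u in gauss n. indicator (- B) u * entering \<theta> u \<le>
      ennreal ((1 / 4) ^ J) + (\<Sum>i\<le>J. ennreal (4 * (1 / 4) ^ i) * indicator (W i) u)"
    using AE_space
  proof eventually_elim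
    case (elim u)
    have u: "u \<in> {..<n} \<rightarrow>\<^sub>E UNIV" using elim(2) by simp
    show ?case
    proof (cases "u \<in> B")
      case False
      show ?thesis
      proof (cases "\<exists>i\<le>J. u \<in> dilate (1 + \<tau> i) K")
        case True
        define i where "i = (LEAST i. u \<in> dilate (1 + \<tau> i) K)"
        have i: "u \<in> dilate (1 + \<tau> i) K" "i \<le> J"
          using True unfolding i_def by (auto intro: LeastI Least_le order_trans)
        have least: "u \<notin> dilate (1 + \<tau> j) K" if "j < i" for j
          using that not_less_Least unfolding i_def by blast
        have "entering \<theta> u \<le> ennreal (4 * (1 / 4) ^ i)"
        proof (cases i)
          case 0
          have "(1::ennreal) \<le> ennreal 4" using ennreal_leI[of 1 4] by simp
          then show ?thesis using entering_le_1[of \<theta> u] 0 by (auto intro: order_trans)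
        next
          case (Suc j)
          have "entering \<theta> u \<le> ennreal ((1 / 4) ^ j)"
            by (rule entering_le_level[OF case1 \<theta> \<tau>_def _ u least]) (use Suc i \<tau>1[of j] in auto)
          then show ?thesis using Suc by simp
        qed
        also have "\<dots> = ennreal (4 * (1 / 4) ^ i) * indicator (W i) u"
          using i(1) elim(1) False by (simp add: W_def)
        also have "\<dots> \<le> (\<Sum>i\<le>J. ennreal (4 * (1 / 4) ^ i) * indicator (W i) u)"
          using i(2) by (intro member_le_sum) auto
        finally show ?thesis using False by (simp add: add_increasing)
      next
        case F: False
        have "entering \<theta> u \<le> ennreal ((1 / 4) ^ J)"
          by (rule entering_le_level[OF case1 \<theta> \<tau>_def _ u]) (use F \<tau>1[of J] in auto)
        then show ?thesis using False by (simp add: add_increasing2)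
      qed
    qed simp
  qed
  then have "(\<integral>\<^sup>+u. indicator (- B) u * entering \<theta> u \<partial>gauss n) \<le>
      (\<integral>\<^sup>+u. ennreal ((1 / 4) ^ J) + (\<Sum>i\<le>J. ennreal (4 * (1 / 4) ^ i) * indicator (W i) u) \<partial>gauss n)"
    by (rule nn_integral_mono_AE)
  also have "\<dots> = ennreal ((1 / 4) ^ J) + (\<Sum>i\<le>J. ennreal (4 * (1 / 4) ^ i) * emeasure (gauss n) (W i))"
  proof -
    have "(\<integral>\<^sup>+u. ennreal ((1 / 4) ^ J) + (\<Sum>i\<le>J. ennreal (4 * (1 / 4) ^ i) * indicator (W i) u) \<partial>gauss n) =
        (\<integral>\<^sup>+u. ennreal ((1 / 4) ^ J) \<partial>gauss n) + (\<integral>\<^sup>+u. (\<Sum>i\<le>J. ennreal (4 * (1 / 4) ^ i) * indicator (W i) u) \<partial>gauss n)"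
      by (rule nn_integral_add) measurable
    also have "(\<integral>\<^sup>+u. ennreal ((1 / 4) ^ J) \<partial>gauss n) = ennreal ((1 / 4) ^ J)"
      using G.emeasure_space_1 by simp
    also have "(\<integral>\<^sup>+u. (\<Sum>i\<le>J. ennreal (4 * (1 / 4) ^ i) * indicator (W i) u) \<partial>gauss n) =
        (\<Sum>i\<le>J. \<integral>\<^sup>+u. ennreal (4 * (1 / 4) ^ i) * indicator (W i) u \<partial>gauss n)"
      by (rule nn_integral_sum) measurable
    also have "\<dots> = (\<Sum>i\<le>J. ennreal (4 * (1 / 4) ^ i) * emeasure (gauss n) (W i))"
      by (intro sum.cong refl nn_integral_cmult_indicator) simp
    finally show ?thesis .
  qed
  also have "\<dots> = ennreal ((1 / 4) ^ J + (\<Sum>i\<le>J. 4 * (1 / 4) ^ i * measure (gauss n) (W i)))"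
    by (simp add: G.emeasure_eq_measure ennreal_mult[symmetric] sum_nonneg)
  also have "\<dots> \<le> ennreal ((1 / 4) ^ J + (32 * \<theta> * (p * deficit) + 64 * \<theta>\<^sup>2 * dilation_remainder * real (Suc J)))"
  proof (intro ennreal_leI add_left_mono)
    have "(\<Sum>i\<le>J. 4 * (1 / 4) ^ i * measure (gauss n) (W i)) \<le>
        (\<Sum>i\<le>J. 4 * (1 / 4) ^ i * (\<tau> i * (p * deficit) + (\<tau> i)\<^sup>2 * dilation_remainder))"
      unfolding W_def
      by (intro sum_mono mult_left_mono dilate_diff_measure_le[OF case1 \<tau>pos \<tau>2]) auto
    also have "\<dots> = (\<Sum>i\<le>J. 16 * \<theta> * (p * deficit) * (1 / 2) ^ i + 64 * \<theta>\<^sup>2 * dilation_remainder)"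
    proof (rule sum.cong[OF refl])
      fix i
      have "(1 / 4 :: real) ^ i * 2 ^ i = (1 / 2) ^ i" "(1 / 4 :: real) ^ i * (2 ^ i)\<^sup>2 = 1"
        by (simp_all add: power2_eq_square flip: power_mult_distrib)
      moreover have "4 * a * (b * (4 * \<theta>) * x + b\<^sup>2 * (4\<^sup>2 * \<theta>\<^sup>2) * y) = 16 * \<theta> * x * (a * b) + 64 * \<theta>\<^sup>2 * y * (a * b\<^sup>2)"
        for a b x y :: real by (simp add: power2_eq_square algebra_simps)
      ultimately show "4 * (1 / 4) ^ i * (\<tau> i * (p * deficit) + (\<tau> i)\<^sup>2 * dilation_remainder) =
          16 * \<theta> * (p * deficit) * (1 / 2) ^ i + 64 * \<theta>\<^sup>2 * dilation_remainder"
        unfolding \<tau>_def power_mult_distrib by (simp only: mult_1_right)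
    qed
    also have "\<dots> = 16 * \<theta> * (p * deficit) * (\<Sum>i\<le>J. (1 / 2) ^ i) + 64 * \<theta>\<^sup>2 * dilation_remainder * real (Suc J)"
      by (simp add: sum.distrib sum_distrib_left[symmetric])
    also have "\<dots> \<le> 16 * \<theta> * (p * deficit) * 2 + 64 * \<theta>\<^sup>2 * dilation_remainder * real (Suc J)"
    proof (intro add_right_mono mult_left_mono)
      have "(\<Sum>i\<le>J. (1 / 2 :: real) ^ i) = 2 - (1 / 2) ^ J"
        by (induction J) (auto simp: field_simps)
      then show "(\<Sum>i\<le>J. (1 / 2 :: real) ^ i) \<le> 2" by simp
      show "0 \<le> 16 * \<theta> * (p * deficit)" using \<theta> p_pos deficit_nonneg by simp
    qed
    finally show "(\<Sum>i\<le>J. 4 * (1 / 4) ^ i * measure (gauss n) (W i)) \<le>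
        32 * \<theta> * (p * deficit) + 64 * \<theta>\<^sup>2 * dilation_remainder * real (Suc J)" by simp
  qed
  finally show ?thesis .
qed

lemma dilation_remainder_nonneg: "0 \<le> dilation_remainder"
  unfolding dilation_remainder_def by (intro integral_nonneg_AE) simp

text \<open>With N = 16^m steps and \<theta> of order 1 / N, the dilation bound wants 2^J * \<theta>
  to vanish and the tail wants N * (1/4)^J to vanish, so 2^J must grow faster than 4^m and slower
  than 16^m; J = 3 * m gives 8^m. N times the first-order term is 16 * pi * p * deficit for every m,
  the rest tends to 0, and pi < 4 gives 64.\<close>

lemma deficit_ge_round:
  assumes case1: "\<And>v. dot n v v = 1 \<Longrightarrow> \<exists>k\<in>K. dot n v k > dot n v mean + 1 / 2"
  shows "(1 - p) / 64 \<le> deficit"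
proof -
  define \<theta> :: "nat \<Rightarrow> real" where "\<theta> m = pi / (2 * 16 ^ m)" for m
  define R where "R = (1 + sqrt (dot n mean mean)) + (real n + dot n mean mean) + 1"
  have R: "R \<ge> 1" "1 + sqrt (dot n mean mean) \<le> R" "real n + dot n mean mean \<le> R"
    by (simp_all add: R_def)
  define C where "C = 1 + 16 * pi * pi * dilation_remainder"
  have pow0: "(\<lambda>m. c * (1 / k) ^ m) \<longlonglongrightarrow> 0" if "1 < k" for c k :: real
    using LIMSEQ_power_zero[of "1 / k"] that by (intro tendsto_mult_right_zero) simp
  have "\<forall>\<^sub>F m in sequentially. 2 * pi * R * (1 / 2) ^ m < 1"
    using order_tendstoD(2)[OF pow0[of 2 "2 * pi * R"]] by simp
  then have "\<forall>\<^sub>F m in sequentially. p * (1 - p) - 16 * pi * (p * deficit) \<le> C * (1 / 4) ^ m"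
  proof eventually_elim
    case (elim m)
    have \<theta>pos: "0 < \<theta> m" by (simp add: \<theta>_def)
    have e8: "(2::real) ^ (3 * m) = 8 ^ m" by (simp add: power_mult)
    have big: "2 ^ (3 * m) * (4 * \<theta> m) * R < 1"
    proof -
      have "(8::real) ^ m / 16 ^ m = (1 / 2) ^ m" by (simp add: power_divide[symmetric])
      then have eq: "2 ^ (3 * m) * (4 * \<theta> m) = 2 * pi * (1 / 2) ^ m"
        unfolding e8 \<theta>_def by (simp add: field_simps)
      show ?thesis unfolding eq using elim by (simp only: mult_ac)
    qed
    have \<tau>0: "0 \<le> 2 ^ (3 * m) * (4 * \<theta> m)" using \<theta>pos by simp
    have le: "2 ^ (3 * m) * (4 * \<theta> m) * x \<le> 1" if "x \<le> R" for x
      using mult_left_mono[OF that \<tau>0] big by linarith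
    have \<theta>le: "\<theta> m \<le> 2 ^ (3 * m) * (4 * \<theta> m)"
      using mult_mono[of 1 "2 ^ (3 * m)" "\<theta> m" "4 * \<theta> m"] \<theta>pos by simp
    have th: "\<theta> m * x \<le> 1" if "0 \<le> x" "x \<le> R" for x
      using mult_right_mono[OF \<theta>le that(1)] le[OF that(2)] by linarith
    have cross: "(\<integral>\<^sup>+u. indicator (- B) u * entering (\<theta> m) u \<partial>gauss n) \<le>
      ennreal ((1 / 4) ^ (3 * m) + (32 * \<theta> m * (p * deficit) + 64 * (\<theta> m)\<^sup>2 * dilation_remainder * real (Suc (3 * m))))"
      (is "_ \<le> ennreal ?E")
      by (rule crossing_le[OF case1]) (use \<theta>pos th[of 1] th[of "1 + sqrt (dot n mean mean)"] le[of 1]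
        le[of "real n + dot n mean mean"] R in auto)
    have E0: "0 \<le> ?E"
      using \<theta>pos p_pos deficit_nonneg dilation_remainder_nonneg by (intro add_nonneg_nonneg mult_nonneg_nonneg) auto
    have "ennreal (p * (1 - p)) \<le> of_nat (16 ^ m) * (\<integral>\<^sup>+u. indicator (- B) u * entering (\<theta> m) u \<partial>gauss n)"
      by (rule variance_le_crossing) (simp_all add: \<theta>_def)
    also have "\<dots> \<le> of_nat (16 ^ m) * ennreal ?E"
      by (intro mult_left_mono cross) simp
    also have "\<dots> = ennreal (16 ^ m * ?E)"
      using E0 by (simp add: ennreal_mult ennreal_of_nat_eq_real_of_nat del: ennreal_plus flip: ennreal_power)
    finally have main: "p * (1 - p) \<le> 16 ^ m * ?E"
      using E0 by (subst (asm) ennreal_le_iff) auto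
    have 1: "(16::real) ^ m * (1 / 4) ^ (3 * m) = (1 / 4) ^ m"
    proof -
      have "(16::real) ^ m * (1 / 4) ^ (3 * m) = (16 * (1 / 4) ^ 3) ^ m"
        by (simp only: power_mult_distrib power_mult)
      also have "16 * (1 / 4) ^ 3 = (1 / 4 :: real)" by (simp add: power3_eq_cube)
      finally show ?thesis .
    qed
    have 2: "16 ^ m * \<theta> m = pi / 2" by (simp add: \<theta>_def)
    \<comment> \<open>The number of levels is only linear in m and is absorbed by a spare power of
      \<theta>, of order 16^(-m).\<close>
    have "real (Suc (3 * m)) \<le> 4 ^ m"
      using Bernoulli_inequality[of 3 m] by (simp add: mult.commute)
    then have "\<theta> m * real (Suc (3 * m)) \<le> \<theta> m * 4 ^ m"
      using \<theta>pos by (intro mult_left_mono) auto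
    also have "\<dots> = pi / 2 * (1 / 4) ^ m"
    proof -
      have "(4::real) ^ m / 16 ^ m = (1 / 4) ^ m" by (simp add: power_divide[symmetric])
      then show ?thesis unfolding \<theta>_def by (simp add: field_simps)
    qed
    finally have 3: "\<theta> m * real (Suc (3 * m)) \<le> pi / 2 * (1 / 4) ^ m" .
    have "16 ^ m * ?E = 16 ^ m * (1 / 4) ^ (3 * m) + 32 * (16 ^ m * \<theta> m) * (p * deficit)
        + 64 * (16 ^ m * \<theta> m) * dilation_remainder * (\<theta> m * real (Suc (3 * m)))"
      by (simp add: power2_eq_square algebra_simps)
    also have "\<dots> \<le> (1 / 4) ^ m + 32 * (pi / 2) * (p * deficit) + 64 * (pi / 2) * dilation_remainder * (pi / 2 * (1 / 4) ^ m)"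
      unfolding 1 2 using dilation_remainder_nonneg by (intro add_left_mono mult_left_mono[OF 3]) simp
    finally show ?case using main by (simp add: C_def algebra_simps)
  qed
  then have "p * (1 - p) - 16 * pi * (p * deficit) \<le> 0"
    using pow0[of 4 C] by (intro tendsto_lowerbound[of "\<lambda>m. C * (1 / 4) ^ m" 0 sequentially]) auto
  then have "p * (1 - p) \<le> p * (16 * pi * deficit)" by (simp add: algebra_simps)
  then have "1 - p \<le> 16 * pi * deficit" using p_pos by simp
  also have "\<dots> \<le> 64 * deficit" using deficit_nonneg pi_less_4 by (intro mult_right_mono) auto
  finally show ?thesis by simp
qed

theorem deficit_lower_bound: "(1 - p) / 64 \<le> deficit"
proof (cases "\<forall>v. dot n v v = 1 \<longrightarrow> (\<exists>k\<in>K. dot n v k > dot n v mean + 1 / 2)")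
  case True
  then show ?thesis by (intro deficit_ge_round) auto
next
  case False
  then obtain v where v: "dot n v v = 1" "\<And>k. k \<in> K \<Longrightarrow> dot n v k \<le> dot n v mean + 1 / 2"
    by (auto simp: not_less)
  have d: "dot n (restrict v {..<n}) y = dot n v y" for y by (simp add: dot_def)
  have d': "dot n v (restrict v {..<n}) = dot n v v" by (simp add: dot_def)
  have "1 / 4 \<le> deficit"
    by (rule deficit_ge_slab[of "restrict v {..<n}"]) (use v in \<open>auto simp: d d'\<close>)
  then show ?thesis using p_pos by simp
qed

end

section \<open>Chebyshev's inequality for disjoint pairs of samples\<close>

lemma prob_space_iid_samples: "prob_space D \<Longrightarrow> prob_space (iid_samples D)"
  unfolding iid_samples_def by (intro prob_space_PiM)

lemma nn_integral_iid_samples_pair: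
  assumes D: "prob_space D" and ab: "a \<noteq> b"
    and F [measurable]: "(\<lambda>(x, y). F x y) \<in> borel_measurable (D \<Otimes>\<^sub>M D)"
  shows "(\<integral>\<^sup>+\<omega>. F (\<omega> a) (\<omega> b) \<partial>iid_samples D) = (\<integral>\<^sup>+x. \<integral>\<^sup>+y. F x y \<partial>D \<partial>D)"
proof -
  interpret D: prob_space D by fact
  interpret P: product_prob_space "\<lambda>_::nat. D" UNIV ..
  interpret pair_sigma_finite D D ..
  have "(\<integral>\<^sup>+\<omega>. F (\<omega> a) (\<omega> b) \<partial>iid_samples D) =
      (\<integral>\<^sup>+\<sigma>. F (\<sigma> a) (\<sigma> b) \<partial>distr (iid_samples D) (Pi\<^sub>M {a, b} (\<lambda>_. D)) (\<lambda>\<omega>. restrict \<omega> {a, b}))"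
    unfolding iid_samples_def by (subst nn_integral_distr) (auto intro!: measurable_restrict_subset)
  also have "distr (iid_samples D) (Pi\<^sub>M {a, b} (\<lambda>_. D)) (\<lambda>\<omega>. restrict \<omega> {a, b}) = Pi\<^sub>M {a, b} (\<lambda>_. D)"
    unfolding iid_samples_def by (rule P.distr_PiM_restrict_finite) auto
  also have "(\<integral>\<^sup>+\<sigma>. F (\<sigma> a) (\<sigma> b) \<partial>Pi\<^sub>M {a, b} (\<lambda>_. D)) = (\<integral>\<^sup>+z. F (fst z) (snd z) \<partial>(D \<Otimes>\<^sub>M D))"
    using ab by (intro P.product_nn_integral_pair) simp_all
  also have "\<dots> = (\<integral>\<^sup>+x. \<integral>\<^sup>+y. F x y \<partial>D \<partial>D)"
    by (subst D.nn_integral_fst[symmetric]) simp_all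
  finally show ?thesis .
qed

text \<open>The joint law of all coordinates is the product measure itself, and this characterises
  independence.\<close>

lemma indep_vars_iid_samples:
  assumes D: "prob_space D"
  shows "prob_space.indep_vars (iid_samples D) (\<lambda>_. D) (\<lambda>i \<omega>. \<omega> i) UNIV"
proof -
  interpret D: prob_space D by fact
  interpret P: product_prob_space "\<lambda>_::nat. D" UNIV ..
  interpret I: prob_space "iid_samples D" by (rule prob_space_iid_samples[OF D])
  have rv: "(\<lambda>\<omega>. \<omega> i) \<in> iid_samples D \<rightarrow>\<^sub>M D" for i
    unfolding iid_samples_def by (rule measurable_component_singleton) simp
  show ?thesis
  proof (subst I.indep_vars_iff_distr_eq_PiM[OF _ rv])
    have "distr (iid_samples D) (Pi\<^sub>M UNIV (\<lambda>_. D)) (\<lambda>x. \<lambda>i\<in>UNIV. x i) = distr (iid_samples D) (iid_samples D) (\<lambda>x. x)"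
      by (intro distr_cong) (auto simp: iid_samples_def)
    also have "\<dots> = iid_samples D" by (rule distr_id)
    also have "\<dots> = Pi\<^sub>M UNIV (\<lambda>i. distr (iid_samples D) D (\<lambda>\<omega>. \<omega> i))"
      unfolding iid_samples_def by (intro PiM_cong refl P.PiM_component[symmetric]) simp
    finally show "distr (iid_samples D) (Pi\<^sub>M UNIV (\<lambda>_. D)) (\<lambda>x. \<lambda>i\<in>UNIV. x i) = Pi\<^sub>M UNIV (\<lambda>i. distr (iid_samples D) D (\<lambda>\<omega>. \<omega> i))" .
  qed simp
qed

text \<open>Pairs are functions of the disjoint index blocks {2j, 2j + 1}, hence independent; the
  mixed products of the centred variables integrate to 0, and each of the \<open>J\<close> variances
  is at most s - m^2. An upper bound on the second moment is enough.\<close>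

lemma Chebyshev_iid_pairs:
  fixes V :: "'a \<Rightarrow> 'a \<Rightarrow> real"
  assumes D: "prob_space D" and V [measurable]: "(\<lambda>(x, y). V x y) \<in> borel_measurable (D \<Otimes>\<^sub>M D)"
    and pos: "\<And>x y. 0 \<le> V x y"
    and m: "(\<integral>\<^sup>+x. \<integral>\<^sup>+y. ennreal (V x y) \<partial>D \<partial>D) = ennreal m" "0 \<le> m"
    and s: "(\<integral>\<^sup>+x. \<integral>\<^sup>+y. ennreal ((V x y)\<^sup>2) \<partial>D \<partial>D) \<le> ennreal s" "0 \<le> s" and a: "0 < a"
    and S: "S = (\<lambda>\<omega>. \<Sum>j<J. V (\<omega> (2 * j)) (\<omega> (2 * j + 1)))"
  shows "S \<in> borel_measurable (iid_samples D)"
    "measure (iid_samples D) {\<omega> \<in> space (iid_samples D). a \<le> \<bar>S \<omega> - real J * m\<bar>} \<le> real J * (s - m\<^sup>2) / a\<^sup>2"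
proof -
  interpret D: prob_space D by fact
  interpret I: prob_space "iid_samples D" by (rule prob_space_iid_samples[OF D])
  define X where "X j \<omega> = V (\<omega> (2 * j)) (\<omega> (2 * j + 1))" for j :: nat and \<omega>
  have comp [measurable]: "(\<lambda>\<omega>. \<omega> i) \<in> iid_samples D \<rightarrow>\<^sub>M D" for i
    unfolding iid_samples_def by (rule measurable_component_singleton) simp
  have Xm [measurable]: "X j \<in> borel_measurable (iid_samples D)" for j
    unfolding X_def using measurable_compose[OF measurable_Pair[OF comp comp] V] by simp
  show Sm: "S \<in> borel_measurable (iid_samples D)"
    unfolding S using Xm unfolding X_def by measurable
  have X1: "(\<integral>\<^sup>+\<omega>. ennreal (X j \<omega>) \<partial>iid_samples D) = ennreal m" for j
    unfolding X_def m(1)[symmetric] by (rule nn_integral_iid_samples_pair[OF D]) simp_all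
  have X2: "(\<integral>\<^sup>+\<omega>. ennreal ((X j \<omega>)\<^sup>2) \<partial>iid_samples D) \<le> ennreal s" for j
  proof -
    have "(\<integral>\<^sup>+\<omega>. ennreal ((X j \<omega>)\<^sup>2) \<partial>iid_samples D) = (\<integral>\<^sup>+x. \<integral>\<^sup>+y. ennreal ((V x y)\<^sup>2) \<partial>D \<partial>D)"
      unfolding X_def by (rule nn_integral_iid_samples_pair[OF D]) simp_all
    then show ?thesis using s by simp
  qed
  have Xpos: "0 \<le> X j \<omega>" for j \<omega> by (simp add: X_def pos)
  have int1: "integrable (iid_samples D) (X j)" for j
    by (rule integrableI_nonneg) (auto simp: X1 Xpos)
  have int2: "integrable (iid_samples D) (\<lambda>\<omega>. (X j \<omega>)\<^sup>2)" for j
    by (rule integrableI_nonneg) (auto intro: le_less_trans[OF X2])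
  have E1: "(\<integral>\<omega>. X j \<omega> \<partial>iid_samples D) = m" for j
    by (subst integral_eq_nn_integral) (auto simp: X1 m Xpos)
  have E2: "(\<integral>\<omega>. (X j \<omega>)\<^sup>2 \<partial>iid_samples D) \<le> s" for j
    using s(2) enn2real_mono[OF X2[of j]] by (subst integral_eq_nn_integral) auto
  define W where "W j \<omega> = X j \<omega> - m" for j \<omega>
  have Wm [measurable]: "W j \<in> borel_measurable (iid_samples D)" for j unfolding W_def by measurable
  have Wint: "integrable (iid_samples D) (W j)" for j
    unfolding W_def using int1 by simp
  have W0: "(\<integral>\<omega>. W j \<omega> \<partial>iid_samples D) = 0" for j
    unfolding W_def using int1[of j] E1[of j] by (simp add: I.prob_space)
  have Wsq: "(W j \<omega>)\<^sup>2 = (X j \<omega>)\<^sup>2 - 2 * m * X j \<omega> + m\<^sup>2" for j \<omega>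
    unfolding W_def by (simp add: power2_diff)
  have W2int: "integrable (iid_samples D) (\<lambda>\<omega>. (W j \<omega>)\<^sup>2)" for j
    unfolding Wsq using int1[of j] int2[of j] by simp
  have W2: "(\<integral>\<omega>. (W j \<omega>)\<^sup>2 \<partial>iid_samples D) \<le> s - m\<^sup>2" for j
    unfolding Wsq using int1[of j] int2[of j] E1[of j] E2[of j]
    by (simp add: I.prob_space power2_eq_square)
  have ind: "I.indep_vars (\<lambda>_. borel) W UNIV"
  proof -
    have "I.indep_vars (\<lambda>j. Pi\<^sub>M {2 * j, 2 * j + 1} (\<lambda>_. D)) (\<lambda>j \<omega>. restrict (\<lambda>i. \<omega> i) {2 * j, 2 * j + 1}) UNIV"
    proof (rule I.indep_vars_restrict[OF indep_vars_iid_samples[OF D]])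
      show "disjoint_family_on (\<lambda>j::nat. {2 * j, 2 * j + 1}) UNIV"
        by (auto simp: disjoint_family_on_def)
    qed simp
    then have "I.indep_vars (\<lambda>_. borel) (\<lambda>j \<omega>. (\<lambda>\<sigma>. V (\<sigma> (2 * j)) (\<sigma> (2 * j + 1)) - m) (restrict (\<lambda>i. \<omega> i) {2 * j, 2 * j + 1})) UNIV"
    proof (rule I.indep_vars_compose2)
      fix j :: nat
      have "(\<lambda>\<sigma>. \<sigma> (2 * j)) \<in> Pi\<^sub>M {2 * j, 2 * j + 1} (\<lambda>_. D) \<rightarrow>\<^sub>M D"
        "(\<lambda>\<sigma>. \<sigma> (2 * j + 1)) \<in> Pi\<^sub>M {2 * j, 2 * j + 1} (\<lambda>_. D) \<rightarrow>\<^sub>M D"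
        by (rule measurable_component_singleton, simp)+
      from measurable_compose[OF measurable_Pair[OF this] V]
      have [measurable]: "(\<lambda>\<sigma>. V (\<sigma> (2 * j)) (\<sigma> (2 * j + 1))) \<in> borel_measurable (Pi\<^sub>M {2 * j, 2 * j + 1} (\<lambda>_. D))"
        by simp
      show "(\<lambda>\<sigma>. V (\<sigma> (2 * j)) (\<sigma> (2 * j + 1)) - m) \<in> borel_measurable (Pi\<^sub>M {2 * j, 2 * j + 1} (\<lambda>_. D))"
        by measurable
    qed
    then show ?thesis by (simp add: W_def[abs_def] X_def)
  qed
  have cross: "(\<integral>\<omega>. W j \<omega> * W k \<omega> \<partial>iid_samples D) = 0 \<and> integrable (iid_samples D) (\<lambda>\<omega>. W j \<omega> * W k \<omega>)" if "j \<noteq> k" for j k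
  proof -
    have jk: "I.indep_vars (\<lambda>_. borel) W {j, k}" by (rule I.indep_vars_subset[OF ind]) simp
    show ?thesis
      using I.indep_vars_lebesgue_integral[OF _ jk Wint] I.indep_vars_integrable[OF _ jk Wint] that W0 by simp
  qed
  have prod_int: "integrable (iid_samples D) (\<lambda>\<omega>. W j \<omega> * W k \<omega>)" for j k
    using cross[of j k] W2int[of j] by (cases "j = k") (auto simp: power2_eq_square)
  have SW: "S \<omega> - real J * m = (\<Sum>j<J. W j \<omega>)" for \<omega>
    by (simp add: S W_def X_def sum_subtractf)
  have SW2: "(S \<omega> - real J * m)\<^sup>2 = (\<Sum>j<J. \<Sum>k<J. W j \<omega> * W k \<omega>)" for \<omega>
    by (simp add: SW power2_eq_square sum_product)
  have ES: "(\<integral>\<omega>. S \<omega> \<partial>iid_samples D) = real J * m"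
    using int1 E1 unfolding S X_def[symmetric] by (subst Bochner_Integration.integral_sum) auto
  have S2int: "integrable (iid_samples D) (\<lambda>\<omega>. (S \<omega> - real J * m)\<^sup>2)"
    unfolding SW2 by (intro Bochner_Integration.integrable_sum prod_int)
  have Sint: "integrable (iid_samples D) S"
    unfolding S X_def[symmetric] using int1 by auto
  have S2: "integrable (iid_samples D) (\<lambda>\<omega>. (S \<omega>)\<^sup>2)"
  proof -
    have "integrable (iid_samples D) (\<lambda>\<omega>. (S \<omega> - real J * m)\<^sup>2 + 2 * (real J * m) * S \<omega> - (real J * m)\<^sup>2)"
      using S2int Sint by simp
    then show ?thesis by (simp add: power2_diff)
  qed
  have "measure (iid_samples D) {\<omega> \<in> space (iid_samples D). a \<le> \<bar>S \<omega> - real J * m\<bar>} \<le> I.variance S / a\<^sup>2"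
    using I.Chebyshev_inequality[OF Sm S2 a] by (simp add: ES)
  also have "I.variance S = (\<Sum>j<J. \<Sum>k<J. \<integral>\<omega>. W j \<omega> * W k \<omega> \<partial>iid_samples D)"
    unfolding ES SW2 using prod_int by (simp add: Bochner_Integration.integral_sum)
  also have "\<dots> = (\<Sum>j<J. \<Sum>k<J. if k = j then (\<integral>\<omega>. (W j \<omega>)\<^sup>2 \<partial>iid_samples D) else 0)"
    using cross by (intro sum.cong refl) (auto simp: power2_eq_square)
  also have "\<dots> = (\<Sum>j<J. \<integral>\<omega>. (W j \<omega>)\<^sup>2 \<partial>iid_samples D)"
    by (intro sum.cong refl) simp
  also have "\<dots> \<le> (\<Sum>j<J. s - m\<^sup>2)" by (intro sum_mono W2)
  finally show "measure (iid_samples D) {\<omega> \<in> space (iid_samples D). a \<le> \<bar>S \<omega> - real J * m\<bar>} \<le> real J * (s - m\<^sup>2) / a\<^sup>2"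
    using a by (simp add: divide_right_mono)
qed

section \<open>Truncated Gaussians\<close>

text \<open>A Lebesgue measurable \<open>A\<close> differs from its Borel main part by a null set,
  to which the integral over the Borel measure on the right is insensitive.\<close>

lemma emeasure_gaussian:
  assumes A: "A \<in> sets (lebesgue_space n)"
  shows "emeasure (gaussian n) A = (\<integral>\<^sup>+x. indicator A x \<partial>gauss n)"
proof -
  have dm: "(\<lambda>x. ennreal (gaussian_density n x)) \<in> borel_measurable (lebesgue_space n)"
    unfolding lebesgue_space_def by (intro measurable_completion) measurable
  have "emeasure (gaussian n) A = (\<integral>\<^sup>+x. ennreal (gaussian_density n x) * indicator A x \<partial>lborel_pow n)"
    unfolding gaussian_def emeasure_density[OF dm A] by (simp add: lebesgue_space_def nn_integral_completion)
  also have "\<dots> = (\<integral>\<^sup>+x. ennreal (gaussian_density n x) * indicator (main_part (lborel_pow n) A) x \<partial>lborel_pow n)"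
    using AE_in_main_part[of A "lborel_pow n"] A unfolding lebesgue_space_def
    by (intro nn_integral_cong_AE) (auto elim!: eventually_mono simp: indicator_def)
  also have "\<dots> = (\<integral>\<^sup>+x. indicator (main_part (lborel_pow n) A) x \<partial>gauss n)"
    using A unfolding lebesgue_space_def
    by (intro nn_integral_gauss[symmetric] borel_measurable_indicator main_part_sets)
  also have "\<dots> = (\<integral>\<^sup>+x. indicator A x \<partial>gauss n)"
  proof (rule nn_integral_cong_AE)
    have "AE x in lborel_pow n. x \<in> main_part (lborel_pow n) A \<longleftrightarrow> x \<in> A"
      using AE_in_main_part[of A "lborel_pow n"] A unfolding lebesgue_space_def by simp
    then show "AE x in gauss n. indicator (main_part (lborel_pow n) A) x = (indicator A x :: ennreal)"
      unfolding AE_gauss_iff by eventually_elim (simp add: indicator_def)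
  qed
  finally show ?thesis .
qed

locale truncated_body =
  fixes n :: nat and K :: "(nat \<Rightarrow> real) set"
  assumes K_sets: "K \<in> sets (lebesgue_space n)" and K_convex: "convex_in n K" and K_pos: "gaussian_vol n K > 0"
begin

text \<open>The Borel part of \<open>K\<close>; it serves as the set \<open>B\<close> of
  \<open>convex_body\<close>.\<close>

definition core :: "(nat \<Rightarrow> real) set" where "core = main_part (lborel_pow n) K"

lemma core_sets [measurable]: "core \<in> sets (lborel_pow n)"
  unfolding core_def by (rule main_part_sets) (use K_sets in \<open>simp add: lebesgue_space_def\<close>)

lemma AE_core: "AE x in lborel_pow n. x \<in> core \<longleftrightarrow> x \<in> K"
  unfolding core_def by (rule AE_in_main_part) (use K_sets in \<open>simp add: lebesgue_space_def\<close>)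

lemma vol_eq: "gaussian_vol n K = measure (gauss n) core"
proof -
  have "(\<integral>\<^sup>+x. indicator K x \<partial>gauss n) = (\<integral>\<^sup>+x. indicator core x \<partial>gauss n)"
    using AE_core[folded AE_gauss_iff] by (intro nn_integral_cong_AE) (auto elim!: eventually_mono simp: indicator_def)
  then show ?thesis
    unfolding gaussian_vol_def measure_def emeasure_gaussian[OF K_sets] by simp
qed

sublocale convex_body n K core
proof
  have "main_part (lborel_pow n) K \<union> null_part (lborel_pow n) K = K"
    by (rule main_part_null_part_Un) (use K_sets in \<open>simp add: lebesgue_space_def\<close>)
  then show "core \<subseteq> K" unfolding core_def by blast
  show "AE x in lborel_pow n. x \<in> K \<longrightarrow> x \<in> core" using AE_core by eventually_elim auto
  show "0 < measure (gauss n) core" using K_pos by (simp add: vol_eq)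
qed (use K_convex in auto)

lemma sets_truncated [simp]: "sets (truncated_gaussian n K) = sets (lebesgue_space n)"
  by (simp add: truncated_gaussian_def)

lemma measurable_truncated:
  "f \<in> lborel_pow n \<rightarrow>\<^sub>M N \<Longrightarrow> f \<in> truncated_gaussian n K \<rightarrow>\<^sub>M N"
  unfolding measurable_cong_sets[OF sets_truncated refl] lebesgue_space_def by (rule measurable_completion)

lemma nn_integral_truncated:
  assumes f [measurable]: "f \<in> borel_measurable (lborel_pow n)"
  shows "(\<integral>\<^sup>+x. f x \<partial>truncated_gaussian n K) = ennreal (1 / p) * (\<integral>\<^sup>+x. indicator core x * f x \<partial>gauss n)"
proof -
  have p: "gaussian_vol n K = p" by (simp add: vol_eq p_def)
  have Km: "(indicator K :: _ \<Rightarrow> real) \<in> borel_measurable (lebesgue_space n)"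
    using K_sets by simp
  have dm: "gaussian_density n \<in> borel_measurable (lebesgue_space n)"
    unfolding lebesgue_space_def by (intro measurable_completion) measurable
  have fm: "f \<in> borel_measurable (lebesgue_space n)"
    unfolding lebesgue_space_def using f by (intro measurable_completion)
  have "(\<integral>\<^sup>+x. f x \<partial>truncated_gaussian n K) =
      (\<integral>\<^sup>+x. ennreal (inverse p * gaussian_density n x * indicator K x) * f x \<partial>lebesgue_space n)"
    unfolding truncated_gaussian_def p
    by (intro nn_integral_density fm measurable_compose[OF _ measurable_ennreal] borel_measurable_times
        borel_measurable_const Km dm)
  also have "\<dots> = (\<integral>\<^sup>+x. ennreal (inverse p * gaussian_density n x * indicator K x) * f x \<partial>lborel_pow n)"
    by (simp add: lebesgue_space_def nn_integral_completion)
  also have "\<dots> = (\<integral>\<^sup>+x. ennreal (1 / p) * (ennreal (gaussian_density n x) * (indicator core x * f x)) \<partial>lborel_pow n)"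
    using AE_core
  proof (intro nn_integral_cong_AE, eventually_elim)
    case (elim x)
    have "ennreal (inverse p * gaussian_density n x) = ennreal (1 / p) * ennreal (gaussian_density n x)"
      using p_pos by (simp add: ennreal_mult[symmetric] gaussian_density_pos less_imp_le inverse_eq_divide)
    then show ?case using elim by (cases "x \<in> K") (simp_all add: indicator_def mult.assoc)
  qed
  also have "\<dots> = ennreal (1 / p) * (\<integral>\<^sup>+x. ennreal (gaussian_density n x) * (indicator core x * f x) \<partial>lborel_pow n)"
    by (intro nn_integral_cmult) measurable
  also have "(\<integral>\<^sup>+x. ennreal (gaussian_density n x) * (indicator core x * f x) \<partial>lborel_pow n) = (\<integral>\<^sup>+x. indicator core x * f x \<partial>gauss n)"
    by (intro nn_integral_gauss[symmetric]) measurable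
  finally show ?thesis .
qed

lemma prob_space_truncated: "prob_space (truncated_gaussian n K)"
proof
  have "emeasure (truncated_gaussian n K) (space (truncated_gaussian n K)) = (\<integral>\<^sup>+x. 1 \<partial>truncated_gaussian n K)" by simp
  also have "\<dots> = ennreal (1 / p) * (\<integral>\<^sup>+x. indicator core x * 1 \<partial>gauss n)"
    by (rule nn_integral_truncated) simp
  also have "\<dots> = ennreal (1 / p) * ennreal p"
    using nn_integral_indicator_B by simp
  also have "\<dots> = 1" using p_pos by (simp flip: ennreal_mult)
  finally show "emeasure (truncated_gaussian n K) (space (truncated_gaussian n K)) = 1" .
qed

lemma nn_integral_truncated_pair:
  assumes F [measurable]: "(\<lambda>(x, y). F x y) \<in> borel_measurable (lborel_pow n \<Otimes>\<^sub>M lborel_pow n)"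
  shows "(\<integral>\<^sup>+x. \<integral>\<^sup>+y. F x y \<partial>truncated_gaussian n K \<partial>truncated_gaussian n K) =
    ennreal (1 / p\<^sup>2) * (\<integral>\<^sup>+x. \<integral>\<^sup>+y. indicator core x * indicator core y * F x y \<partial>gauss n \<partial>gauss n)"
proof -
  interpret G: prob_space "gauss n" by (rule prob_space_gauss)
  have Fx: "F x \<in> borel_measurable (lborel_pow n)" if "x \<in> {..<n} \<rightarrow>\<^sub>E UNIV" for x
    using measurable_compose[OF measurable_Pair1' F, of x] that by simp
  have sp: "space (truncated_gaussian n K) = {..<n} \<rightarrow>\<^sub>E UNIV"
    by (simp add: truncated_gaussian_def lebesgue_space_def)
  have "(\<integral>\<^sup>+x. \<integral>\<^sup>+y. F x y \<partial>truncated_gaussian n K \<partial>truncated_gaussian n K) =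
      (\<integral>\<^sup>+x. ennreal (1 / p) * (\<integral>\<^sup>+y. indicator core y * F x y \<partial>gauss n) \<partial>truncated_gaussian n K)"
    by (intro nn_integral_cong nn_integral_truncated Fx) (simp add: sp)
  also have "\<dots> = ennreal (1 / p) * (\<integral>\<^sup>+x. indicator core x * (ennreal (1 / p) * (\<integral>\<^sup>+y. indicator core y * F x y \<partial>gauss n)) \<partial>gauss n)"
    by (rule nn_integral_truncated) measurable
  also have "(\<integral>\<^sup>+x. indicator core x * (ennreal (1 / p) * (\<integral>\<^sup>+y. indicator core y * F x y \<partial>gauss n)) \<partial>gauss n) =
      (\<integral>\<^sup>+x. ennreal (1 / p) * (\<integral>\<^sup>+y. indicator core x * indicator core y * F x y \<partial>gauss n) \<partial>gauss n)"
  proof (rule nn_integral_cong)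
    fix x assume "x \<in> space (gauss n)"
    then have [measurable]: "F x \<in> borel_measurable (lborel_pow n)" by (intro Fx) simp
    have "(\<integral>\<^sup>+y. indicator core x * indicator core y * F x y \<partial>gauss n) = indicator core x * (\<integral>\<^sup>+y. indicator core y * F x y \<partial>gauss n)"
      unfolding mult.assoc by (rule nn_integral_cmult) measurable
    then show "indicator core x * (ennreal (1 / p) * (\<integral>\<^sup>+y. indicator core y * F x y \<partial>gauss n)) =
        ennreal (1 / p) * (\<integral>\<^sup>+y. indicator core x * indicator core y * F x y \<partial>gauss n)"
      by (simp only: mult.left_commute)
  qed
  also have "\<dots> = ennreal (1 / p) * (\<integral>\<^sup>+x. \<integral>\<^sup>+y. indicator core x * indicator core y * F x y \<partial>gauss n \<partial>gauss n)"
    by (rule nn_integral_cmult) measurable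
  also have "ennreal (1 / p) * \<dots> = ennreal (1 / p\<^sup>2) * (\<integral>\<^sup>+x. \<integral>\<^sup>+y. indicator core x * indicator core y * F x y \<partial>gauss n \<partial>gauss n)"
    using p_pos by (simp add: mult.assoc[symmetric] ennreal_mult[symmetric] power2_eq_square)
  finally show ?thesis .
qed

lemma truncated_first_moment:
  "(\<integral>\<^sup>+x. \<integral>\<^sup>+y. ennreal (half_sq_dist x y) \<partial>truncated_gaussian n K \<partial>truncated_gaussian n K) = ennreal (real n - deficit)"
proof -
  have "(\<integral>\<^sup>+x. \<integral>\<^sup>+y. ennreal (half_sq_dist x y) \<partial>truncated_gaussian n K \<partial>truncated_gaussian n K) =
      ennreal (1 / p\<^sup>2) * ennreal (p\<^sup>2 * (real n - deficit))"
    using pair_mean[of 0] by (subst nn_integral_truncated_pair) simp_all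
  also have "\<dots> = ennreal (real n - deficit)"
    using p_pos by (simp add: ennreal_mult'[symmetric])
  finally show ?thesis .
qed

text \<open>The expectation of a nonnegative variable is nonnegative, but \<open>pair_mean\<close>
  is an identity in \<open>ennreal\<close>, where a negative value would silently become 0. Adding c
  > 0 makes the left side strictly positive and excludes this.\<close>

lemma deficit_le: "deficit \<le> real n"
proof -
  have "0 \<le> p\<^sup>2 * (real n - deficit + c)" if "0 < c" for c
  proof (rule ccontr)
    assume neg: "\<not> 0 \<le> p\<^sup>2 * (real n - deficit + c)"
    have "ennreal (p\<^sup>2 * c) = (\<integral>\<^sup>+x. \<integral>\<^sup>+x'. indicator core x * indicator core x' * ennreal c \<partial>gauss n \<partial>gauss n)"
      using nn_integral_pair_quadratic[of "\<lambda>_ _. c" 0 0 "\<lambda>_. 0" c] that by (simp add: dot_def)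
    also have "\<dots> \<le> (\<integral>\<^sup>+x. \<integral>\<^sup>+x'. indicator core x * indicator core x' * ennreal (half_sq_dist x x' + c) \<partial>gauss n \<partial>gauss n)"
      by (intro nn_integral_mono mult_left_mono ennreal_leI) auto
    also have "\<dots> = ennreal (p\<^sup>2 * (real n - deficit + c))" using that by (intro pair_mean) simp
    also have "\<dots> = 0" using neg by (simp add: ennreal_neg)
    finally show False using that p_pos by simp
  qed
  then have "deficit \<le> real n + c" if "0 < c" for c
    using that p_pos by (fastforce simp: zero_le_mult_iff)
  then show ?thesis by (rule field_le_epsilon)
qed

lemma truncated_second_moment:
  "(\<integral>\<^sup>+x. \<integral>\<^sup>+y. ennreal ((half_sq_dist x y)\<^sup>2) \<partial>truncated_gaussian n K \<partial>truncated_gaussian n K) \<le>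
    ennreal (real (n + 2) * (real n - deficit))"
proof -
  have "(\<integral>\<^sup>+x. \<integral>\<^sup>+y. ennreal ((half_sq_dist x y)\<^sup>2) \<partial>truncated_gaussian n K \<partial>truncated_gaussian n K) =
    ennreal (1 / p\<^sup>2) * (\<integral>\<^sup>+x. \<integral>\<^sup>+y. indicator core x * indicator core y * ennreal (half_sq_dist x y ^ Suc 1) \<partial>gauss n \<partial>gauss n)"
    by (subst nn_integral_truncated_pair) (simp_all add: numeral_2_eq_2)
  also have "\<dots> \<le> ennreal (1 / p\<^sup>2) * (ennreal (real (n + 2 * 1)) *
      (\<integral>\<^sup>+x. \<integral>\<^sup>+y. indicator core x * indicator core y * ennreal (half_sq_dist x y ^ 1) \<partial>gauss n \<partial>gauss n))"
    by (intro mult_left_mono pair_moment) simp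
  also have "(\<integral>\<^sup>+x. \<integral>\<^sup>+y. indicator core x * indicator core y * ennreal (half_sq_dist x y ^ 1) \<partial>gauss n \<partial>gauss n) =
      ennreal (p\<^sup>2 * (real n - deficit))"
    using pair_mean[of 0] by simp
  also have "ennreal (1 / p\<^sup>2) * (ennreal (real (n + 2 * 1)) * ennreal (p\<^sup>2 * (real n - deficit))) = ennreal (real (n + 2) * (real n - deficit))"
  proof -
    have gen: "ennreal x * (ennreal y * ennreal z) = ennreal (x * (y * z))" if "0 \<le> x" "0 \<le> y" "0 \<le> z" for x y z
      using that by (simp add: ennreal_mult)
    have "ennreal (1 / p\<^sup>2) * (ennreal (real (n + 2 * 1)) * ennreal (p\<^sup>2 * (real n - deficit))) =
        ennreal (1 / p\<^sup>2 * (real (n + 2 * 1) * (p\<^sup>2 * (real n - deficit))))"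
      by (rule gen) (use deficit_le in simp_all)
    also have "1 / p\<^sup>2 * (real (n + 2 * 1) * (p\<^sup>2 * (real n - deficit))) = real (n + 2) * (real n - deficit)"
      using p_pos by simp
    finally show ?thesis .
  qed
  finally show ?thesis .
qed

text \<open>For the mass c of the Borel part of \<open>A\<close> inside \<open>core\<close>,
  conditioning raises c to c / p, a gain of at most 1 - p, while the part outside
  \<open>core\<close> loses at most 1 - p. Hence a distance of at least \<epsilon> forces 1 - p
  \<ge> \<epsilon>.\<close>

lemma tv_dist_le: "tv_dist (truncated_gaussian n K) (gaussian n) \<le> 1 - p"
  unfolding tv_dist_def
proof (rule cSUP_least)
  show "sets (truncated_gaussian n K) \<noteq> {}" by auto
  interpret G: prob_space "gauss n" by (rule prob_space_gauss)
  fix A assume "A \<in> sets (truncated_gaussian n K)"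
  then have A: "A \<in> sets (lebesgue_space n)" by simp
  define A' where "A' = main_part (lborel_pow n) A"
  have A' [measurable]: "A' \<in> sets (lborel_pow n)" using A by (simp add: A'_def lebesgue_space_def)
  have AE: "AE x in lborel_pow n. x \<in> A' \<longleftrightarrow> x \<in> A"
    using AE_in_main_part[of A "lborel_pow n"] A by (simp add: A'_def lebesgue_space_def)
  have gA: "measure (gaussian n) A = measure (gauss n) A'"
  proof -
    have "(\<integral>\<^sup>+x. indicator A x \<partial>gauss n) = (\<integral>\<^sup>+x. indicator A' x \<partial>gauss n)"
      using AE[folded AE_gauss_iff] by (intro nn_integral_cong_AE) (auto elim!: eventually_mono simp: indicator_def)
    then show ?thesis unfolding measure_def emeasure_gaussian[OF A] by simp
  qed
  have tA: "measure (truncated_gaussian n K) A = measure (gauss n) (A' \<inter> core) / p"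
  proof -
    have "emeasure (truncated_gaussian n K) A = (\<integral>\<^sup>+x. indicator A x \<partial>truncated_gaussian n K)"
      using A by simp
    also have "\<dots> = (\<integral>\<^sup>+x. indicator A' x \<partial>truncated_gaussian n K)"
    proof (rule nn_integral_cong_AE)
      have "AE x in lebesgue_space n. x \<in> A' \<longleftrightarrow> x \<in> A"
        unfolding lebesgue_space_def by (rule AE_completion[OF AE])
      then have "AE x in truncated_gaussian n K. x \<in> A' \<longleftrightarrow> x \<in> A"
        unfolding truncated_gaussian_def
      proof (subst AE_density)
        show "(\<lambda>x. ennreal (inverse (gaussian_vol n K) * gaussian_density n x * indicator K x)) \<in> borel_measurable (lebesgue_space n)"
        proof -
          have [measurable]: "K \<in> sets (lebesgue_space n)" by (rule K_sets)
          have [measurable]: "gaussian_density n \<in> borel_measurable (lebesgue_space n)"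
            unfolding lebesgue_space_def by (intro measurable_completion) measurable
          show ?thesis by measurable
        qed
      qed (auto elim!: eventually_mono)
      then show "AE x in truncated_gaussian n K. (indicator A x :: ennreal) = indicator A' x"
        by eventually_elim (simp add: indicator_def)
    qed
    also have "\<dots> = ennreal (1 / p) * (\<integral>\<^sup>+x. indicator core x * indicator A' x \<partial>gauss n)"
      by (rule nn_integral_truncated) measurable
    also have "(\<integral>\<^sup>+x. indicator core x * indicator A' x \<partial>gauss n) = ennreal (measure (gauss n) (A' \<inter> core))"
      by (subst indicator_inter_arith[symmetric]) (simp add: G.emeasure_eq_measure Int_commute)
    finally show ?thesis using p_pos by (simp add: measure_def ennreal_mult[symmetric])
  qed
  have le1: "measure (gauss n) (A' \<inter> core) \<le> p"
    unfolding p_def by (rule G.finite_measure_mono) auto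
  have le2: "measure (gauss n) (A' \<inter> core) \<le> measure (gauss n) A'"
    by (rule G.finite_measure_mono) auto
  have le3: "measure (gauss n) A' \<le> measure (gauss n) (A' \<inter> core) + (1 - p)"
  proof -
    have "measure (gauss n) A' \<le> measure (gauss n) ((A' \<inter> core) \<union> (space (gauss n) - core))"
      using sets.sets_into_space[OF A'] by (intro G.finite_measure_mono) auto
    also have "\<dots> \<le> measure (gauss n) (A' \<inter> core) + measure (gauss n) (space (gauss n) - core)"
      by (rule measure_Un_le) auto
    also have "measure (gauss n) (space (gauss n) - core) = 1 - p"
      unfolding p_def by (rule G.prob_compl) simp
    finally show ?thesis .
  qed
  define c where "c = measure (gauss n) (A' \<inter> core)"
  have c: "0 \<le> c" "c \<le> p" using le1 by (auto simp: c_def)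
  have "c \<le> c / p" using c p_pos p_le_1 by (simp add: field_simps mult_left_le)
  moreover have "c / p - c \<le> 1 - p"
  proof -
    have "c / p - c = (c / p) * (1 - p)" using p_pos by (simp add: field_simps)
    also have "\<dots> \<le> 1 * (1 - p)" using c p_pos p_le_1 by (intro mult_right_mono) auto
    finally show ?thesis by simp
  qed
  ultimately show "\<bar>measure (truncated_gaussian n K) A - measure (gaussian n) A\<bar> \<le> 1 - p"
    unfolding gA tA using le2 le3 unfolding c_def[symmetric] by linarith
qed

end

section \<open>The tester\<close>

primrec block :: "instr list \<Rightarrow> prog" where
  "block [] = Skip"
| "block (c # cs) = Seq (Instr c) (block cs)"

text \<open>The closing \<open>Skip\<close> costs one unit, hence \<open>Suc\<close>.\<close>

lemma exec_block: "exec n \<omega> (block cs) s (Suc (length cs)) (fold (exec_instr n \<omega>) cs s)"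
proof (induction cs arbitrary: s)
  case Nil
  show ?case using exec.Skip[of n \<omega> s] by simp
next
  case (Cons c cs)
  show ?case using exec.Seq[OF exec.Instr[of n \<omega> c s] Cons.IH] by simp
qed

lemma exec_blockI: "t = Suc (length cs) \<Longrightarrow> exec n \<omega> (block cs) s t (fold (exec_instr n \<omega>) cs s)"
  by (simp add: exec_block)

text \<open>The index of the invariant counts completed rounds. Each round costs its test and at
  most \<open>T\<close>; the final unit pays for the test that fails.\<close>

lemma exec_while_invariant:
  assumes "I 0 s"
    and step: "\<And>i s. i < N \<Longrightarrow> I i s \<Longrightarrow> eval_test b s \<and> (\<exists>t s'. t \<le> T \<and> exec n \<omega> p s t s' \<and> I (Suc i) s')"
    and stop: "\<And>s. I N s \<Longrightarrow> \<not> eval_test b s"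
  shows "\<exists>t s'. t \<le> N * Suc T + 1 \<and> exec n \<omega> (While b p) s t s' \<and> I N s'"
proof -
  have "\<exists>t s'. t \<le> (N - i) * Suc T + 1 \<and> exec n \<omega> (While b p) s t s' \<and> I N s'" if "i \<le> N" "I i s" for i s
    using that
  proof (induction "N - i" arbitrary: i s)
    case 0
    then have "i = N" by simp
    then show ?case using 0 stop exec.WhileFalse[of b s n \<omega> p] by auto
  next
    case (Suc d)
    then have i: "i < N" by simp
    obtain t s' where b: "eval_test b s" and t: "t \<le> T" "exec n \<omega> p s t s'" "I (Suc i) s'"
      using step[OF i Suc.prems(2)] by blast
    obtain t' s'' where t': "t' \<le> (N - Suc i) * Suc T + 1" "exec n \<omega> (While b p) s' t' s''" "I N s''"
      using Suc.hyps(1)[of "Suc i" s', OF _ Suc_leI[OF i] t(3)] Suc.hyps(2) by (metis Suc_diff_Suc i nat.inject)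
    have "N - i = Suc (N - Suc i)" using i by simp
    then have "1 + t + t' \<le> (N - i) * Suc T + 1" using t(1) t'(1) by simp
    then show ?case using exec.WhileTrue[OF b t(2) t'(2)] t'(3) by blast
  qed
  from this[of 0 s] assms(1) show ?thesis by simp
qed

text \<open>Only the latest sample can be read, so the first of each pair is copied to the array.
  Index register 0 holds n, register 1 runs through the coordinates, and register 2 holds the
  increment 1.\<close>

definition store_sample :: prog where
  "store_sample = Seq (block [Draw, IConst 1 0])
     (While (ILess 1 0) (block [Coord 7 1, RStore 1 7, IAdd 1 1 2]))"

definition add_sq_dist :: prog where
  "add_sq_dist = Seq (block [Draw, IConst 1 0])
     (While (ILess 1 0) (block [Coord 7 1, RLoad 8 1, RSub 7 8 7, RMul 7 7 7, RAdd 2 2 7, IAdd 1 1 2]))"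

definition add_pair :: prog where
  "add_pair = Seq store_sample (Seq add_sq_dist (block [RAdd 3 3 1, RMul 6 3 5]))"

text \<open>
  Real registers: \<open>0\<close> holds \<open>\<epsilon>\<close>, \<open>1\<close> the constant 1, \<open>2\<close> the sum of squared distances, \<open>3\<close> the number of pairs,
  \<open>4\<close> the bound which register \<open>6\<close>, the number of pairs times \<open>\<epsilon>\<^sup>2\<close>, has to reach, and \<open>5\<close> holds \<open>\<epsilon>\<^sup>2\<close>.
\<close>

definition tester :: prog where
  "tester = Seq (block [RConst 1 1]) (Cond (RLess 1 0) (block [Answer Untruncated])
     (Seq (block [IConst 2 1, RIndex 4 0, RConst 7 400000, RMul 4 4 7, RMul 5 0 0])
     (Seq (While (RLess 6 4) add_pair)
     (Seq (block [RIndex 7 0, RConst 8 128, RDiv 8 0 8, RSub 7 7 8, RMul 7 7 3, RConst 8 2, RMul 7 7 8])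
        (Cond (RLess 2 7) (block [Answer Truncated]) (block [Answer Untruncated]))))))"

definition sq_dist :: "nat \<Rightarrow> (nat \<Rightarrow> real) \<Rightarrow> (nat \<Rightarrow> real) \<Rightarrow> real" where
  "sq_dist n x y = (\<Sum>i<n. (x i - y i)\<^sup>2)"

text \<open>The machine has no rounding; its loop reaches this ceiling as the first j with j *
  \<epsilon>^2 \<ge> 400000 * n. The constant keeps both Chebyshev bounds, at most 33024 / 400000,
  below 1/10.\<close>

definition pairs_used :: "nat \<Rightarrow> real \<Rightarrow> nat" where
  "pairs_used n \<epsilon> = nat \<lceil>400000 * real n / \<epsilon>\<^sup>2\<rceil>"

text \<open>For \<epsilon> > 1 no distance can reach \<epsilon>, and n / \<epsilon>^2 may be so
  small that the sample bound admits no draw at all; the answer is then given without sampling. The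
  factor 2 compensates for the halves in the definition of V.\<close>

definition tester_verdict :: "nat \<Rightarrow> real \<Rightarrow> (nat \<Rightarrow> nat \<Rightarrow> real) \<Rightarrow> verdict" where
  "tester_verdict n \<epsilon> \<omega> = (if 1 < \<epsilon> then Untruncated else
     if (\<Sum>j<pairs_used n \<epsilon>. sq_dist n (\<omega> (2 * j)) (\<omega> (2 * j + 1))) < (real n - \<epsilon> / 128) * real (pairs_used n \<epsilon>) * 2
     then Truncated else Untruncated)"

definition loop_frame :: "nat \<Rightarrow> real \<Rightarrow> nat \<Rightarrow> state \<Rightarrow> bool" where
  "loop_frame n \<epsilon> j s \<longleftrightarrow> rreg s 0 = \<epsilon> \<and> rreg s 1 = 1 \<and> rreg s 3 = real j \<and> rreg s 4 = 400000 * real n \<and>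
     rreg s 5 = \<epsilon>\<^sup>2 \<and> ireg s 0 = n \<and> ireg s 2 = 1"

lemma exec_store_sample:
  assumes "loop_frame n \<epsilon> j s" "rreg s 2 = a" "draws s = 2 * j"
  shows "\<exists>t s'. t \<le> 5 * n + 4 \<and> exec n \<omega> store_sample s t s' \<and> loop_frame n \<epsilon> j s' \<and> rreg s' 2 = a \<and>
    draws s' = 2 * j + 1 \<and> (\<forall>k<n. mem s' k = \<omega> (2 * j) k)"
proof -
  let ?I = "\<lambda>i s. loop_frame n \<epsilon> j s \<and> rreg s 2 = a \<and> draws s = 2 * j + 1 \<and> ireg s 1 = i \<and> (\<forall>k<i. mem s k = \<omega> (2 * j) k)"
  let ?s = "fold (exec_instr n \<omega>) [Draw, IConst 1 0] s"
  have eq4: "4 = Suc (length [Coord 7 1, RStore 1 7, IAdd 1 1 2])" by simp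
  have "?I 0 ?s" using assms by (auto simp: loop_frame_def)
  then have "\<exists>t s'. t \<le> n * Suc 4 + 1 \<and> exec n \<omega> (While (ILess 1 0) (block [Coord 7 1, RStore 1 7, IAdd 1 1 2])) ?s t s' \<and> ?I n s'"
  proof (rule exec_while_invariant)
    fix i s assume i: "i < n" and I: "?I i s"
    have "eval_test (ILess 1 0) s" using i I by (simp add: loop_frame_def)
    \<comment> \<open>After \<open>Draw\<close> the counter is 2 * j + 1, and
      \<open>sample_coord\<close> reads at the counter minus 1: sample 2 * j.\<close>
    moreover have "?I (Suc i) (fold (exec_instr n \<omega>) [Coord 7 1, RStore 1 7, IAdd 1 1 2] s)"
      using i I by (auto simp: loop_frame_def sample_coord_def less_Suc_eq)
    ultimately show "eval_test (ILess 1 0) s \<and> (\<exists>t s'. t \<le> 4 \<and> exec n \<omega> (block [Coord 7 1, RStore 1 7, IAdd 1 1 2]) s t s' \<and> ?I (Suc i) s')"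
      using exec_blockI[of 4 "[Coord 7 1, RStore 1 7, IAdd 1 1 2]" n \<omega> s, OF eq4] by (blast intro: order_refl)
  next
    fix s assume "?I n s"
    then show "\<not> eval_test (ILess 1 0) s" by (simp add: loop_frame_def)
  qed
  then obtain t s' where t: "t \<le> n * Suc 4 + 1" "?I n s'"
    and e: "exec n \<omega> (While (ILess 1 0) (block [Coord 7 1, RStore 1 7, IAdd 1 1 2])) ?s t s'" by blast
  from exec.Seq[OF exec_block e] have "exec n \<omega> store_sample s (3 + t) s'"
    by (simp add: store_sample_def numeral_3_eq_3)
  then show ?thesis using t by (intro exI[of _ "3 + t"] exI[of _ s']) auto
qed

lemma exec_add_sq_dist:
  assumes "loop_frame n \<epsilon> j s" "rreg s 2 = a" "draws s = 2 * j + 1" "\<forall>k<n. mem s k = \<omega> (2 * j) k"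
  shows "\<exists>t s'. t \<le> 8 * n + 4 \<and> exec n \<omega> add_sq_dist s t s' \<and> loop_frame n \<epsilon> j s' \<and>
    rreg s' 2 = a + sq_dist n (\<omega> (2 * j)) (\<omega> (2 * j + 1)) \<and> draws s' = 2 * j + 2"
proof -
  let ?c = "[Coord 7 1, RLoad 8 1, RSub 7 8 7, RMul 7 7 7, RAdd 2 2 7, IAdd 1 1 2]"
  let ?I = "\<lambda>i s. loop_frame n \<epsilon> j s \<and> rreg s 2 = a + (\<Sum>k<i. (\<omega> (2 * j) k - \<omega> (2 * j + 1) k)\<^sup>2) \<and>
    draws s = 2 * j + 2 \<and> ireg s 1 = i \<and> (\<forall>k<n. mem s k = \<omega> (2 * j) k)"
  let ?s = "fold (exec_instr n \<omega>) [Draw, IConst 1 0] s"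
  have eq7: "7 = Suc (length ?c)" by simp
  have "?I 0 ?s" using assms by (auto simp: loop_frame_def)
  then have "\<exists>t s'. t \<le> n * Suc 7 + 1 \<and> exec n \<omega> (While (ILess 1 0) (block ?c)) ?s t s' \<and> ?I n s'"
  proof (rule exec_while_invariant)
    fix i s assume i: "i < n" and I: "?I i s"
    have "eval_test (ILess 1 0) s" using i I by (simp add: loop_frame_def)
    moreover have "?I (Suc i) (fold (exec_instr n \<omega>) ?c s)"
      using i I by (auto simp: loop_frame_def sample_coord_def power2_eq_square)
    ultimately show "eval_test (ILess 1 0) s \<and> (\<exists>t s'. t \<le> 7 \<and> exec n \<omega> (block ?c) s t s' \<and> ?I (Suc i) s')"
      using exec_blockI[of 7 ?c n \<omega> s, OF eq7] by (blast intro: order_refl)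
  next
    fix s assume "?I n s"
    then show "\<not> eval_test (ILess 1 0) s" by (simp add: loop_frame_def)
  qed
  then obtain t s' where t: "t \<le> n * Suc 7 + 1" "?I n s'"
    and e: "exec n \<omega> (While (ILess 1 0) (block ?c)) ?s t s'" by blast
  from exec.Seq[OF exec_block e] have "exec n \<omega> add_sq_dist s (3 + t) s'"
    by (simp add: add_sq_dist_def numeral_3_eq_3)
  then show ?thesis using t by (intro exI[of _ "3 + t"] exI[of _ s']) (auto simp: sq_dist_def)
qed

lemma exec_add_pair:
  assumes "loop_frame n \<epsilon> j s" "rreg s 2 = a" "draws s = 2 * j"
  shows "\<exists>t s'. t \<le> 13 * n + 11 \<and> exec n \<omega> add_pair s t s' \<and> loop_frame n \<epsilon> (Suc j) s' \<and>
    rreg s' 2 = a + sq_dist n (\<omega> (2 * j)) (\<omega> (2 * j + 1)) \<and> draws s' = 2 * Suc j \<and> rreg s' 6 = real (Suc j) * \<epsilon>\<^sup>2"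
proof -
  obtain t1 s1 where 1: "t1 \<le> 5 * n + 4" "exec n \<omega> store_sample s t1 s1" "loop_frame n \<epsilon> j s1" "rreg s1 2 = a"
      "draws s1 = 2 * j + 1" "\<forall>k<n. mem s1 k = \<omega> (2 * j) k"
    using exec_store_sample[OF assms] by blast
  obtain t2 s2 where 2: "t2 \<le> 8 * n + 4" "exec n \<omega> add_sq_dist s1 t2 s2" "loop_frame n \<epsilon> j s2"
      "rreg s2 2 = a + sq_dist n (\<omega> (2 * j)) (\<omega> (2 * j + 1))" "draws s2 = 2 * j + 2"
    using exec_add_sq_dist[of n \<epsilon> j s1 a \<omega>, OF 1(3-6)] by blast
  let ?s = "fold (exec_instr n \<omega>) [RAdd 3 3 1, RMul 6 3 5] s2"
  have "exec n \<omega> add_pair s (t1 + (t2 + 3)) ?s"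
    unfolding add_pair_def using exec.Seq[OF 1(2) exec.Seq[OF 2(2) exec_block[of n \<omega> "[RAdd 3 3 1, RMul 6 3 5]" s2]]]
    by (simp add: numeral_3_eq_3)
  then show ?thesis
    using 1(1) 2 by (intro exI[of _ "t1 + (t2 + 3)"] exI[of _ ?s]) (auto simp: loop_frame_def)
qed

lemma pairs_used_bounds:
  assumes "0 < \<epsilon>"
  shows "400000 * real n \<le> real (pairs_used n \<epsilon>) * \<epsilon>\<^sup>2"
    and "j < pairs_used n \<epsilon> \<Longrightarrow> real j * \<epsilon>\<^sup>2 < 400000 * real n"
    and "real (pairs_used n \<epsilon>) \<le> 400000 * real n / \<epsilon>\<^sup>2 + 1"
proof -
  let ?x = "400000 * real n / \<epsilon>\<^sup>2"
  have \<epsilon>: "\<epsilon>\<^sup>2 > 0" using assms by simp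
  have x: "0 \<le> ?x" by simp
  have J: "real (pairs_used n \<epsilon>) = of_int \<lceil>?x\<rceil>" by (simp add: pairs_used_def)
  show "400000 * real n \<le> real (pairs_used n \<epsilon>) * \<epsilon>\<^sup>2"
    using le_of_int_ceiling[of ?x] \<epsilon> unfolding J by (simp only: pos_divide_le_eq)
  show "real (pairs_used n \<epsilon>) \<le> ?x + 1"
    unfolding J by linarith
  assume "j < pairs_used n \<epsilon>"
  then have "real j < ?x" unfolding pairs_used_def by linarith
  then show "real j * \<epsilon>\<^sup>2 < 400000 * real n" using \<epsilon> by (simp add: field_simps)
qed

lemma tester_runs_small:
  assumes \<epsilon>: "0 < \<epsilon>" "\<epsilon> \<le> 1"
  shows "\<exists>t. t \<le> pairs_used n \<epsilon> * (13 * n + 12) + 22 \<and>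
    runs tester n \<epsilon> \<omega> (tester_verdict n \<epsilon> \<omega>) (2 * pairs_used n \<epsilon>) t"
proof -
  define J where "J = pairs_used n \<epsilon>"
  let ?s0 = "fold (exec_instr n \<omega>) [RConst 1 1] (init_state n \<epsilon>)"
  let ?c1 = "[IConst 2 1, RIndex 4 0, RConst 7 400000, RMul 4 4 7, RMul 5 0 0]"
  let ?c2 = "[RIndex 7 0, RConst 8 128, RDiv 8 0 8, RSub 7 7 8, RMul 7 7 3, RConst 8 2, RMul 7 7 8]"
  let ?s1 = "fold (exec_instr n \<omega>) ?c1 ?s0"
  let ?a = "\<lambda>j. \<Sum>l<j. sq_dist n (\<omega> (2 * l)) (\<omega> (2 * l + 1))"
  let ?I = "\<lambda>j s. loop_frame n \<epsilon> j s \<and> rreg s 2 = ?a j \<and> draws s = 2 * j \<and> rreg s 6 = real j * \<epsilon>\<^sup>2"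
  \<comment> \<open>The accumulators in real registers 2, 3 and 6 rely on the initial value 0 of all
    registers but register 0.\<close>
  have "?I 0 ?s1" by (simp add: loop_frame_def init_state_def power2_eq_square)
  then have "\<exists>t s'. t \<le> J * Suc (13 * n + 11) + 1 \<and> exec n \<omega> (While (RLess 6 4) add_pair) ?s1 t s' \<and> ?I J s'"
  proof (rule exec_while_invariant)
    fix j s assume j: "j < J" and I: "?I j s"
    have "eval_test (RLess 6 4) s"
      using pairs_used_bounds(2)[OF \<epsilon>(1), of j n] j I by (simp add: loop_frame_def J_def)
    then show "eval_test (RLess 6 4) s \<and> (\<exists>t s'. t \<le> 13 * n + 11 \<and> exec n \<omega> add_pair s t s' \<and> ?I (Suc j) s')"
      using exec_add_pair[of n \<epsilon> j s "?a j" \<omega>] I by auto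
  next
    fix s assume "?I J s"
    then show "\<not> eval_test (RLess 6 4) s"
      using pairs_used_bounds(1)[OF \<epsilon>(1), of n] by (simp add: loop_frame_def J_def)
  qed
  then obtain t s where t: "t \<le> J * Suc (13 * n + 11) + 1" "?I J s"
    and loop: "exec n \<omega> (While (RLess 6 4) add_pair) ?s1 t s" by blast
  let ?s2 = "fold (exec_instr n \<omega>) ?c2 s"
  let ?v = "tester_verdict n \<epsilon> \<omega>"
  have fin: "exec n \<omega> (Cond (RLess 2 7) (block [Answer Truncated]) (block [Answer Untruncated])) ?s2 3 (?s2\<lparr>answer := Some ?v\<rparr>)"
  proof -
    have eq: "eval_test (RLess 2 7) ?s2 \<longleftrightarrow> ?a J < (real n - \<epsilon> / 128) * real J * 2"
      using t(2) by (simp add: loop_frame_def)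
    show ?thesis
    proof (cases "eval_test (RLess 2 7) ?s2")
      case True
      then have "?v = Truncated" using eq \<epsilon> by (simp add: tester_verdict_def J_def)
      then show ?thesis
        using exec.CondTrue[OF True exec_block[of n \<omega> "[Answer Truncated]" ?s2], of "block [Answer Untruncated]"]
        by (simp add: numeral_3_eq_3 del: eval_test.simps)
    next
      case False
      then have "?v = Untruncated" using eq \<epsilon> by (simp add: tester_verdict_def J_def)
      then show ?thesis
        using exec.CondFalse[OF False exec_block[of n \<omega> "[Answer Untruncated]" ?s2], of "block [Answer Truncated]"]
        by (simp add: numeral_3_eq_3 del: eval_test.simps)
    qed
  qed
  have nt: "\<not> eval_test (RLess 1 0) ?s0" using \<epsilon> by (simp add: init_state_def)
  note ex = exec.Seq[OF exec_block exec.CondFalse[OF nt exec.Seq[OF exec_block[of n \<omega> ?c1] exec.Seq[OF loop exec.Seq[OF exec_block[of n \<omega> ?c2] fin]]]]]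
  \<comment> \<open>The witness for the time is the sum produced by unification with
    \<open>ex\<close>; all parts except the loop have constant cost.\<close>
  have "\<exists>t'. exec n \<omega> tester (init_state n \<epsilon>) t' (?s2\<lparr>answer := Some ?v\<rparr>) \<and> t' \<le> t + 21"
    unfolding tester_def by (intro exI conjI, rule ex) simp
  then obtain t' where t': "exec n \<omega> tester (init_state n \<epsilon>) t' (?s2\<lparr>answer := Some ?v\<rparr>)" "t' \<le> t + 21" by blast
  have "draws (?s2\<lparr>answer := Some ?v\<rparr>) = 2 * J" using t(2) by simp
  then have "runs tester n \<epsilon> \<omega> ?v (2 * J) t'"
    unfolding runs_def using t'(1) by (intro exI[of _ "?s2\<lparr>answer := Some ?v\<rparr>"]) simp
  moreover have "t' \<le> J * (13 * n + 12) + 22" using t(1) t'(2) by (simp add: algebra_simps)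
  ultimately show ?thesis unfolding J_def by blast
qed

lemma tester_runs_large:
  assumes \<epsilon>: "1 < \<epsilon>"
  shows "runs tester n \<epsilon> \<omega> (tester_verdict n \<epsilon> \<omega>) 0 5"
proof -
  let ?s0 = "fold (exec_instr n \<omega>) [RConst 1 1] (init_state n \<epsilon>)"
  have test: "eval_test (RLess 1 0) ?s0" using \<epsilon> by (simp add: init_state_def)
  have "exec n \<omega> tester (init_state n \<epsilon>) 5 (fold (exec_instr n \<omega>) [Answer Untruncated] ?s0)"
    unfolding tester_def
    using exec.Seq[OF exec_block exec.CondTrue[OF test exec_block[of n \<omega> "[Answer Untruncated]" ?s0]]]
    by (simp add: eval_nat_numeral)
  then show ?thesis
    unfolding runs_def using \<epsilon> by (auto simp: tester_verdict_def init_state_def)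
qed

lemma outputs_tester_iff:
  assumes "0 < \<epsilon>"
  shows "outputs tester n \<epsilon> \<omega> v \<longleftrightarrow> v = tester_verdict n \<epsilon> \<omega>"
proof -
  obtain m t where r: "runs tester n \<epsilon> \<omega> (tester_verdict n \<epsilon> \<omega>) m t"
    using tester_runs_small[OF assms, of n \<omega>] tester_runs_large[of \<epsilon> n \<omega>] by (cases "\<epsilon> \<le> 1") auto
  have "v = tester_verdict n \<epsilon> \<omega>" if "runs tester n \<epsilon> \<omega> v m' t'" for m' t'
    using that r exec_deterministic unfolding runs_def by fastforce
  then show ?thesis using r unfolding outputs_def by blast
qed

text \<open>For \<epsilon> \<le> 1 and n \<ge> 1 the quantity n / \<epsilon>^2 is at least 1 and
  absorbs the rounding up of the number of pairs. That number is of order X^3 for X = 1 + n + 1 /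
  \<epsilon>, and a pair costs time linear in n, hence the degree 4.\<close>

lemma tester_complexity:
  assumes n: "1 \<le> n" and \<epsilon>: "0 < \<epsilon>"
  shows "\<exists>v m t. runs tester n \<epsilon> \<omega> v m t \<and> real m \<le> 1000000 * (real n / \<epsilon>\<^sup>2) \<and>
    real t \<le> 20000000 * (1 + real n + 1 / \<epsilon>) ^ 4"
proof (cases "\<epsilon> \<le> 1")
  case False
  define X where "X = 1 + real n + 1 / \<epsilon>"
  have "1 \<le> X" using \<epsilon> by (simp add: X_def)
  then have "1 \<le> X ^ 4" by simp
  then have "real 5 \<le> 20000000 * X ^ 4" by simp
  then show ?thesis
    using False tester_runs_large[of \<epsilon> n \<omega>] unfolding X_def
    by (intro exI[of _ "tester_verdict n \<epsilon> \<omega>"] exI[of _ 0] exI[of _ 5]) auto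
next
  case True
  define J where "J = pairs_used n \<epsilon>"
  define X where "X = 1 + real n + 1 / \<epsilon>"
  obtain t where t: "t \<le> J * (13 * n + 12) + 22" "runs tester n \<epsilon> \<omega> (tester_verdict n \<epsilon> \<omega>) (2 * J) t"
    using tester_runs_small[OF \<epsilon> True] unfolding J_def by blast
  have J: "real J \<le> 400000 * (real n / \<epsilon>\<^sup>2) + 1"
    using pairs_used_bounds(3)[OF \<epsilon>, of n] by (simp add: J_def)
  have "\<epsilon>\<^sup>2 \<le> 1" using \<epsilon> True by (simp add: power_le_one)
  then have "1 \<le> real n / \<epsilon>\<^sup>2" using n \<epsilon> by (simp add: le_divide_eq)
  then have J': "real J \<le> 400001 * (real n / \<epsilon>\<^sup>2)" using J by simp
  have X: "1 \<le> X" "real n \<le> X" "1 / \<epsilon> \<le> X" using \<epsilon> by (simp_all add: X_def)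
  have "real n / \<epsilon>\<^sup>2 = real n * (1 / \<epsilon>) * (1 / \<epsilon>)" by (simp add: power2_eq_square)
  also have "\<dots> \<le> X * X * X" using X \<epsilon> by (intro mult_mono) auto
  finally have JX: "real J \<le> 400001 * (X * X * X)" using J' by linarith
  have "real t \<le> real (J * (13 * n + 12) + 22)" using t(1) by (rule of_nat_mono)
  also have "\<dots> = real J * (13 * real n + 12) + 22" by simp
  also have "\<dots> \<le> (400001 * (X * X * X)) * (25 * X) + 22 * X ^ 4"
  proof (intro add_mono mult_mono)
    show "13 * real n + 12 \<le> 25 * X" using X by linarith
    have "1 \<le> X ^ 4" using X by simp
    then show "22 \<le> 22 * X ^ 4" by simp
  qed (use JX X in auto)
  also have "\<dots> \<le> 20000000 * X ^ 4"
  proof -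
    have "(400001 * (X * X * X)) * (25 * X) = 10000025 * X ^ 4" by (simp add: power4_eq_xxxx)
    moreover have "0 \<le> X ^ 4" by simp
    ultimately show ?thesis by linarith
  qed
  finally have "real t \<le> 20000000 * (1 + real n + 1 / \<epsilon>) ^ 4" by (simp add: X_def)
  moreover have "real (2 * J) \<le> 1000000 * (real n / \<epsilon>\<^sup>2)" using J' \<open>1 \<le> real n / \<epsilon>\<^sup>2\<close> by simp
  ultimately show ?thesis using t(2) by blast
qed

section \<open>Correctness of the tester\<close>

lemma pairs_used_ge:
  assumes "1 \<le> n" "0 < \<epsilon>"
  shows "0 < pairs_used n \<epsilon>" "real n / real (pairs_used n \<epsilon>) \<le> \<epsilon>\<^sup>2 / 400000"
proof -
  have J: "400000 * real n \<le> real (pairs_used n \<epsilon>) * \<epsilon>\<^sup>2" using pairs_used_bounds(1)[OF assms(2)] .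
  show pos: "0 < pairs_used n \<epsilon>"
  proof (rule ccontr)
    assume "\<not> 0 < pairs_used n \<epsilon>"
    then show False using J assms(1) by simp
  qed
  show "real n / real (pairs_used n \<epsilon>) \<le> \<epsilon>\<^sup>2 / 400000"
    using J pos by (simp add: field_simps)
qed

context truncated_body
begin

abbreviation D :: "(nat \<Rightarrow> real) measure" where "D \<equiv> truncated_gaussian n K"

definition statistic :: "real \<Rightarrow> (nat \<Rightarrow> nat \<Rightarrow> real) \<Rightarrow> real" where
  "statistic \<epsilon> = (\<lambda>\<omega>. \<Sum>j<pairs_used n \<epsilon>. half_sq_dist (\<omega> (2 * j)) (\<omega> (2 * j + 1)))"

lemma sq_dist_eq: "sq_dist n x y = 2 * half_sq_dist x y"
  unfolding half_sq_dist_def sq_dist_def by (simp add: dot_def power2_eq_square del: dot_lin_left dot_lin_right)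

lemma tester_verdict_eq:
  assumes "\<epsilon> \<le> 1"
  shows "tester_verdict n \<epsilon> \<omega> =
    (if statistic \<epsilon> \<omega> < real (pairs_used n \<epsilon>) * (real n - \<epsilon> / 128) then Truncated else Untruncated)"
proof -
  have "(\<Sum>j<pairs_used n \<epsilon>. sq_dist n (\<omega> (2 * j)) (\<omega> (2 * j + 1))) = statistic \<epsilon> \<omega> * 2"
    by (simp add: sq_dist_eq statistic_def sum_distrib_left mult.commute)
  then show ?thesis using assms by (simp add: tester_verdict_def mult.commute)
qed

lemma measurable_half_sq_dist_pair: "(\<lambda>(x, y). half_sq_dist x y) \<in> borel_measurable (D \<Otimes>\<^sub>M D)"
proof -
  have id: "(\<lambda>x. x) \<in> D \<rightarrow>\<^sub>M lborel_pow n" by (rule measurable_truncated) simp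
  have [measurable]: "fst \<in> D \<Otimes>\<^sub>M D \<rightarrow>\<^sub>M lborel_pow n" "snd \<in> D \<Otimes>\<^sub>M D \<rightarrow>\<^sub>M lborel_pow n"
    using measurable_compose[OF measurable_fst id] measurable_compose[OF measurable_snd id] by auto
  show ?thesis unfolding split_beta' by (rule measurable_half_sq_dist) measurable
qed

text \<open>The moment bounds leave each pair the variance (n + 2)(n - \<delta>) - (n - \<delta>)^2
  = (n - \<delta>)(2 + \<delta>), with \<delta> the deficit. It is linear in n, which is why a
  number of pairs linear in n suffices.\<close>

lemma
  shows measurable_statistic: "statistic \<epsilon> \<in> borel_measurable (iid_samples D)"
    and statistic_deviation: "0 < a \<Longrightarrow>
      measure (iid_samples D) {\<omega> \<in> space (iid_samples D). a \<le> \<bar>statistic \<epsilon> \<omega> - real (pairs_used n \<epsilon>) * (real n - deficit)\<bar>}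
      \<le> real (pairs_used n \<epsilon>) * ((real n - deficit) * (2 + deficit)) / a\<^sup>2"
proof -
  have m: "0 \<le> real n - deficit" using deficit_le by simp
  have s: "0 \<le> real (n + 2) * (real n - deficit)" using m by simp
  note C = Chebyshev_iid_pairs[OF prob_space_truncated measurable_half_sq_dist_pair half_sq_dist_nonneg
      truncated_first_moment m truncated_second_moment s _ statistic_def]
  show "statistic \<epsilon> \<in> borel_measurable (iid_samples D)" using C(1)[of 1] by simp
  have "real (n + 2) * (real n - deficit) - (real n - deficit)\<^sup>2 = (real n - deficit) * (2 + deficit)"
    by (simp add: power2_eq_square algebra_simps)
  then show "measure (iid_samples D) {\<omega> \<in> space (iid_samples D). a \<le> \<bar>statistic \<epsilon> \<omega> - real (pairs_used n \<epsilon>) * (real n - deficit)\<bar>}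
      \<le> real (pairs_used n \<epsilon>) * ((real n - deficit) * (2 + deficit)) / a\<^sup>2" if "0 < a"
    using C(2)[OF that] by simp
qed

lemma output_prob_tester:
  assumes "0 < \<epsilon>"
  shows "output_prob tester n \<epsilon> D v = measure (iid_samples D) {\<omega> \<in> space (iid_samples D). tester_verdict n \<epsilon> \<omega> = v}"
  unfolding output_prob_def outputs_tester_iff[OF assms] by (simp add: eq_commute)

lemma tester_complete:
  assumes n: "1 \<le> n" and \<epsilon>: "0 < \<epsilon>" and full: "deficit = 0"
  shows "9 / 10 \<le> output_prob tester n \<epsilon> D Untruncated"
proof -
  interpret I: prob_space "iid_samples D" by (rule prob_space_iid_samples[OF prob_space_truncated])
  note [measurable] = measurable_statistic
  show ?thesis
  proof (cases "\<epsilon> \<le> 1")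
    case False
    then show ?thesis unfolding output_prob_tester[OF \<epsilon>] by (simp add: tester_verdict_def I.prob_space)
  next
    case True
    define J where "J = real (pairs_used n \<epsilon>)"
    have J: "0 < J" "real n / J \<le> \<epsilon>\<^sup>2 / 400000" using pairs_used_ge[OF n \<epsilon>] by (simp_all add: J_def)
    let ?T = "{\<omega> \<in> space (iid_samples D). statistic \<epsilon> \<omega> < J * (real n - \<epsilon> / 128)}"
    have "measure (iid_samples D) ?T \<le>
        measure (iid_samples D) {\<omega> \<in> space (iid_samples D). J * (\<epsilon> / 128) \<le> \<bar>statistic \<epsilon> \<omega> - J * (real n - deficit)\<bar>}"
    proof (intro I.finite_measure_mono subsetI)
      fix \<omega> assume \<omega>: "\<omega> \<in> ?T"
      then have "statistic \<epsilon> \<omega> < J * real n - J * (\<epsilon> / 128)" by (simp add: right_diff_distrib)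
      then have "J * (\<epsilon> / 128) \<le> \<bar>statistic \<epsilon> \<omega> - J * real n\<bar>" by arith
      then show "\<omega> \<in> {\<omega> \<in> space (iid_samples D). J * (\<epsilon> / 128) \<le> \<bar>statistic \<epsilon> \<omega> - J * (real n - deficit)\<bar>}"
        using \<omega> by (simp add: full)
    qed measurable
    also have "\<dots> \<le> J * ((real n - deficit) * (2 + deficit)) / (J * (\<epsilon> / 128))\<^sup>2"
      unfolding J_def by (rule statistic_deviation) (use J \<epsilon> in \<open>simp add: J_def\<close>)
    \<comment> \<open>Variance 2 * n per pair and deviation \<epsilon> / 128: 2 * 128^2 =
      32768.\<close>
    also have "\<dots> = 32768 / \<epsilon>\<^sup>2 * (real n / J)"
      using J(1) \<epsilon> by (simp add: full power2_eq_square field_simps)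
    also have "\<dots> \<le> 32768 / \<epsilon>\<^sup>2 * (\<epsilon>\<^sup>2 / 400000)"
      by (rule mult_left_mono[OF J(2)]) simp
    also have "\<dots> \<le> 1 / 10" using \<epsilon> by simp
    finally have small: "measure (iid_samples D) ?T \<le> 1 / 10" .
    have "{\<omega> \<in> space (iid_samples D). tester_verdict n \<epsilon> \<omega> = Untruncated} = space (iid_samples D) - ?T"
      by (auto simp: tester_verdict_eq[OF True] J_def)
    then have "output_prob tester n \<epsilon> D Untruncated = 1 - measure (iid_samples D) ?T"
      unfolding output_prob_tester[OF \<epsilon>] using I.prob_compl[of ?T] by simp
    then show ?thesis using small by simp
  qed
qed

lemma tester_sound:
  assumes n: "1 \<le> n" and \<epsilon>: "0 < \<epsilon>" and far: "\<epsilon> \<le> tv_dist D (gaussian n)"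
  shows "9 / 10 \<le> output_prob tester n \<epsilon> D Truncated"
proof -
  interpret I: prob_space "iid_samples D" by (rule prob_space_iid_samples[OF prob_space_truncated])
  note [measurable] = measurable_statistic
  have ep: "\<epsilon> \<le> 1 - p" using far tv_dist_le by simp
  then have \<epsilon>1: "\<epsilon> \<le> 1" using p_pos by simp
  \<comment> \<open>Consequently the threshold n - \<epsilon> / 128 is at least n - deficit / 2, so
    an error requires a deviation of half the deficit.\<close>
  have \<delta>: "\<epsilon> / 64 \<le> deficit" using deficit_lower_bound ep by simp
  then have \<delta>pos: "0 < deficit" using \<epsilon> by (auto intro: less_le_trans[of 0 "\<epsilon> / 64"])
  define J where "J = real (pairs_used n \<epsilon>)"
  have J: "0 < J" "real n / J \<le> \<epsilon>\<^sup>2 / 400000" using pairs_used_ge[OF n \<epsilon>] by (simp_all add: J_def)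
  let ?T = "{\<omega> \<in> space (iid_samples D). statistic \<epsilon> \<omega> < J * (real n - \<epsilon> / 128)}"
  have "measure (iid_samples D) (space (iid_samples D) - ?T) \<le>
      measure (iid_samples D) {\<omega> \<in> space (iid_samples D). J * (deficit / 2) \<le> \<bar>statistic \<epsilon> \<omega> - J * (real n - deficit)\<bar>}"
  proof (intro I.finite_measure_mono subsetI)
    fix \<omega> assume \<omega>: "\<omega> \<in> space (iid_samples D) - ?T"
    have "J * (real n - \<epsilon> / 128) \<ge> J * (real n - deficit / 2)" using J(1) \<delta> by (intro mult_left_mono) auto
    then have "J * (real n - deficit / 2) \<le> statistic \<epsilon> \<omega>" using \<omega> by auto
    moreover have "J * (real n - deficit / 2) - J * (real n - deficit) = J * (deficit / 2)" by (simp add: algebra_simps)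
    ultimately have "J * (deficit / 2) \<le> \<bar>statistic \<epsilon> \<omega> - J * (real n - deficit)\<bar>" by arith
    then show "\<omega> \<in> {\<omega> \<in> space (iid_samples D). J * (deficit / 2) \<le> \<bar>statistic \<epsilon> \<omega> - J * (real n - deficit)\<bar>}"
      using \<omega> by simp
  qed measurable
  also have "\<dots> \<le> J * ((real n - deficit) * (2 + deficit)) / (J * (deficit / 2))\<^sup>2"
    unfolding J_def by (rule statistic_deviation) (use J \<delta>pos in \<open>simp add: J_def\<close>)
  also have "\<dots> \<le> J * (real n * (2 + deficit)) / (J * (deficit / 2))\<^sup>2"
    using J(1) \<delta>pos by (intro divide_right_mono mult_left_mono mult_right_mono) auto
  also have "\<dots> = (real n / J) * (8 / deficit\<^sup>2 + 4 / deficit)"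
    using J(1) \<delta>pos by (simp add: power2_eq_square field_simps)
  \<comment> \<open>The bound decreases in the deficit although the variance bound grows with it, so
    the worst case is \<epsilon> / 64.\<close>
  also have "\<dots> \<le> (\<epsilon>\<^sup>2 / 400000) * (8 / (\<epsilon> / 64)\<^sup>2 + 4 / (\<epsilon> / 64))"
    using \<delta> \<delta>pos \<epsilon> by (intro mult_mono J(2) add_mono divide_left_mono power_mono mult_pos_pos) auto
  also have "\<dots> = (32768 + 256 * \<epsilon>) / 400000"
    using \<epsilon> by (simp add: power2_eq_square field_simps)
  also have "\<dots> \<le> 1 / 10" using \<epsilon>1 by simp
  finally have small: "measure (iid_samples D) (space (iid_samples D) - ?T) \<le> 1 / 10" .
  have "{\<omega> \<in> space (iid_samples D). tester_verdict n \<epsilon> \<omega> = Truncated} = ?T"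
    by (auto simp: tester_verdict_eq[OF \<epsilon>1] J_def)
  then have "output_prob tester n \<epsilon> D Truncated = measure (iid_samples D) ?T"
    unfolding output_prob_tester[OF \<epsilon>] by simp
  moreover have "measure (iid_samples D) (space (iid_samples D) - ?T) = 1 - measure (iid_samples D) ?T"
    by (rule I.prob_compl) measurable
  ultimately show ?thesis using small by simp
qed

text \<open>Without truncation the half rotation turns V into the squared norm of one Gaussian
  vector, of expectation n. Passing from \<open>ennreal\<close> back to reals uses
  \<open>deficit_le\<close>.\<close>

lemma deficit_eq_0_if_full:
  assumes K: "K = {..<n} \<rightarrow>\<^sub>E UNIV"
  shows "deficit = 0"
proof -
  interpret G: prob_space "gauss n" by (rule prob_space_gauss)
  have AE: "AE x in gauss n. x \<in> core"
    using AE_core[folded AE_gauss_iff] AE_space by eventually_elim (simp add: K)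
  have full: "(\<integral>\<^sup>+x. \<integral>\<^sup>+x'. indicator core x * indicator core x' * F x x' \<partial>gauss n \<partial>gauss n) =
      (\<integral>\<^sup>+x. \<integral>\<^sup>+x'. F x x' \<partial>gauss n \<partial>gauss n)" for F :: "_ \<Rightarrow> _ \<Rightarrow> ennreal"
  proof (intro nn_integral_cong_AE)
    show "AE x in gauss n. (\<integral>\<^sup>+x'. indicator core x * indicator core x' * F x x' \<partial>gauss n) = (\<integral>\<^sup>+x'. F x x' \<partial>gauss n)"
      using AE
    proof eventually_elim
      case (elim x)
      show ?case
        by (rule nn_integral_cong_AE) (use AE elim in \<open>auto elim!: eventually_mono\<close>)
    qed
  qed
  have "p = 1"
  proof -
    have "ennreal p = (\<integral>\<^sup>+x. 1 \<partial>gauss n)"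
      unfolding nn_integral_indicator_B[symmetric] using AE by (intro nn_integral_cong_AE) (auto elim!: eventually_mono)
    then show ?thesis using G.emeasure_space_1 by simp
  qed
  then have "ennreal (real n - deficit) =
      (\<integral>\<^sup>+x. \<integral>\<^sup>+x'. ennreal (half_sq_dist x x') \<partial>gauss n \<partial>gauss n)"
    using pair_mean[of 0] full[of "\<lambda>x x'. ennreal (half_sq_dist x x')"] by simp
  also have "\<dots> = (\<integral>\<^sup>+z. \<integral>\<^sup>+y. ennreal (dot n y y) \<partial>gauss n \<partial>gauss n)"
    by (subst nn_integral_gauss_half_rotation) (simp_all add: half_sq_dist_rotation)
  also have "\<dots> = ennreal (real n)"
    using G.emeasure_space_1 by (simp add: nn_integral_gauss_norm)
  finally show ?thesis using deficit_le by simp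
qed

end

text \<open>The completeness guarantee is read off the whole space as truncation set, where the
  deficit is known to vanish.\<close>

lemma gaussian_eq_truncated: "gaussian n = truncated_gaussian n ({..<n} \<rightarrow>\<^sub>E UNIV)"
  and truncated_body_full: "truncated_body n ({..<n} \<rightarrow>\<^sub>E UNIV)"
proof -
  interpret G: prob_space "gauss n" by (rule prob_space_gauss)
  let ?S = "{..<n} \<rightarrow>\<^sub>E (UNIV :: real set)"
  have S: "?S \<in> sets (lebesgue_space n)"
    using sets.top[of "lebesgue_space n"] by (simp add: lebesgue_space_def)
  have "emeasure (gaussian n) ?S = (\<integral>\<^sup>+x. indicator ?S x \<partial>gauss n)"
    by (rule emeasure_gaussian[OF S])
  also have "\<dots> = (\<integral>\<^sup>+x. 1 \<partial>gauss n)" by (intro nn_integral_cong) simp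
  also have "\<dots> = 1" using G.emeasure_space_1 by simp
  finally have vol: "gaussian_vol n ?S = 1" by (simp add: gaussian_vol_def measure_def)
  show "truncated_body n ?S"
    by unfold_locales (use S vol in \<open>auto simp: convex_in_def\<close>)
  show "gaussian n = truncated_gaussian n ?S"
    unfolding gaussian_def truncated_gaussian_def vol
  proof (rule density_cong)
    show dm: "(\<lambda>x. ennreal (gaussian_density n x)) \<in> borel_measurable (lebesgue_space n)"
      unfolding lebesgue_space_def by (intro measurable_completion) measurable
    have eq: "ennreal (gaussian_density n x) = ennreal (inverse 1 * gaussian_density n x * indicator ?S x)"
      if "x \<in> space (lebesgue_space n)" for x
      using that by (simp add: lebesgue_space_def)
    show "(\<lambda>x. ennreal (inverse 1 * gaussian_density n x * indicator ?S x)) \<in> borel_measurable (lebesgue_space n)"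
      using dm eq by (subst measurable_cong[OF eq[symmetric]]) auto
    show "AE x in lebesgue_space n. ennreal (gaussian_density n x) = ennreal (inverse 1 * gaussian_density n x * indicator ?S x)"
      by (rule AE_I2) (rule eq)
  qed
qed

theorem theorem4p1:
  shows "\<exists>(P :: prog) (C :: real) (B :: real) (k :: nat).
    \<forall>(n :: nat) (\<epsilon> :: real). n \<ge> 1 \<longrightarrow> \<epsilon> > 0 \<longrightarrow>
      (\<forall>\<omega>. \<exists>v m t. runs P n \<epsilon> \<omega> v m t
          \<and> real m \<le> C * (real n / \<epsilon>\<^sup>2)
          \<and> real t \<le> B * (1 + real n + 1 / \<epsilon>) ^ k) \<and>
      (\<forall>D \<in> P_conv n.
          (D = gaussian n \<longrightarrow> output_prob P n \<epsilon> D Untruncated \<ge> 9 / 10) \<and>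
          (tv_dist D (gaussian n) \<ge> \<epsilon> \<longrightarrow> output_prob P n \<epsilon> D Truncated \<ge> 9 / 10))"
proof (rule exI[of _ tester], rule exI[of _ 1000000], rule exI[of _ 20000000], rule exI[of _ 4],
    intro allI impI conjI ballI)
  fix n :: nat and \<epsilon> :: real assume n: "1 \<le> n" and \<epsilon>: "0 < \<epsilon>"
  show "\<exists>v m t. runs tester n \<epsilon> \<omega> v m t \<and> real m \<le> 1000000 * (real n / \<epsilon>\<^sup>2) \<and>
      real t \<le> 20000000 * (1 + real n + 1 / \<epsilon>) ^ 4" for \<omega>
    by (rule tester_complexity[OF n \<epsilon>])
  fix D assume D: "D \<in> P_conv n"
  show "9 / 10 \<le> output_prob tester n \<epsilon> D Untruncated" if "D = gaussian n"
  proof -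
    interpret truncated_body n "{..<n} \<rightarrow>\<^sub>E UNIV" by (rule truncated_body_full)
    show ?thesis
      unfolding that gaussian_eq_truncated by (rule tester_complete[OF n \<epsilon> deficit_eq_0_if_full[OF refl]])
  qed
  show "9 / 10 \<le> output_prob tester n \<epsilon> D Truncated" if "\<epsilon> \<le> tv_dist D (gaussian n)"
  proof -
    obtain K where DK: "D = truncated_gaussian n K" and "truncated_body n K"
      using D unfolding P_conv_def truncated_body_def by blast
    then interpret truncated_body n K by simp
    show ?thesis using tester_sound[OF n \<epsilon>] that unfolding DK by simp
  qed
qed

end
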